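(* Let $G/K$ be a homogeneous space of a real Banach--Lie group $G$, equipped with the homogeneous vector bundle map $\mathcal N$ induced by an admissible operator $N\in\mathcal A(G,K)$. Let $X,Y$ be vector fields on $G/K$. Let $p=\pi(g)$ with $g\in G$, and take $v,w\in\mathfrak g$ such that $X(p)=(\alpha_g)_*\pi_{*1}v$ and $Y(p)=(\alpha_g)_*\pi_{*1}w$. Then the Nijenhuis torsion of $\mathcal N$ can be expressed as $$\Omega_{\mathcal N}(X,Y)(p)=(\alpha_g)_*\pi_{*1}\big(N[v,Nw]+N[Nv,w]-[Nv,Nw]-N^2[v,w]\big).$$ In particular, $\mathcal N$ is a Nijenhuis operator in $G/K$, i.e. $\Omega_{\mathcal N}\equiv0$, if and only if $$N[v,Nw]+N[Nv,w]-[Nv,Nw]-N^2[v,w]\in\mathfrak k\qquad\text{for all } v,w\in\mathfrak g .$$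
   Context: Setting. $G$ is a real Banach--Lie group with Banach--Lie algebra $\mathfrak g$; $K$ is an immersed Banach--Lie subgroup of $G$ with Banach--Lie subalgebra $\mathfrak k\subset\mathfrak g$ (immersion: each differential is injective with closed range). $G/K=\{gK: g\in G\}$ is a homogeneous space of $G$, meaning that it has a Hausdorff Banach manifold structure such that the quotient map $\pi:G\to G/K$, $\pi(g)=gK$, is a submersion, i.e. its differential is surjective at every point (no splitting of kernels is required; $\mathfrak k$ need not be complemented in $\mathfrak g$). The base point is $p_0=\pi(1)$. For $g\in G$, $\alpha_g:G/K\to G/K$ is $\alpha_g(\pi(h))=\pi(gh)$. $f_*$ denotes the differential of $f$ and $f_{*m}$ the differential at $m$; in $(\alpha_g)_*\pi_{*1}$ the differential of $\alpha_g$ is taken at $p_0$. $\mathrm{Ad}$ is the adjoint representation of $G$ on $\mathfrak g$; $\mathcal B(\mathfrak g)$ is the space of bounded linear operators on $\mathfrak g$. The bracket of $\mathfrak g$ is $[v,w]=\mathrm{ad}_vw$ (the usual one, defined via left-invariant vector fields). All vector bundle maps cover the identity. One has $\ker\pi_{*1}=\mathfrak k$. Admissible operators. $\mathcal A(G,K)=\{N\in\mathcal B(\mathfrak g): N\mathfrak k\subset\mathfrak k,\ \mathrm{Ran}(\mathrm{Ad}_kN-N\mathrm{Ad}_k)\subset\mathfrak k\ \ \forall k\in K\}$. Induced map. For $N\in\mathcal A(G,K)$, the homogeneous vector bundle map induced by $N$ is the smooth vector bundle map $\mathcal N:T(G/K)\to T(G/K)$ given by $\mathcal N_{p_0}\pi_{*1}v=\pi_{*1}Nv$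 for $v\in\mathfrak g$, and $\mathcal N_p=(\alpha_g)_*\mathcal N_{p_0}(\alpha_g)_*^{-1}$ for $p=\pi(g)$ (this is well defined). Nijenhuis torsion. For a smooth vector bundle map $\mathcal N$ of the tangent bundle of a manifold and vector fields $X,Y$, $\Omega_{\mathcal N}(X,Y)=\mathcal N[\mathcal NX,Y]+\mathcal N[X,\mathcal NY]-[\mathcal NX,\mathcal NY]-\mathcal N^2[X,Y]$. $\mathcal N$ is a Nijenhuis operator if $\Omega_{\mathcal N}\equiv0$. In a chart the Lie bracket of vector fields is $[X,Y]_p=Y_{*p}(X_p)-X_{*p}(Y_p)$. *)

theory Defs
  imports "HOL-Analysis.Analysis" "HOL-Algebra.Left_Coset"
begin

section \<open>Smooth maps between Banach spaces\<close>

text \<open>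
  A \<open>k\<close>-linear map is encoded as a function on lists, of which only the values on lists of
  length \<open>k\<close> matter.
\<close>

definition bounded_multilinear ::
    "nat \<Rightarrow> ('a::real_normed_vector list \<Rightarrow> 'b::real_normed_vector) \<Rightarrow> bool" where
  "bounded_multilinear k T \<longleftrightarrow>
     (\<forall>vs i. length vs = k \<longrightarrow> i < k \<longrightarrow> linear (\<lambda>v. T (vs[i := v]))) \<and>
     (\<exists>B. \<forall>vs. length vs = k \<longrightarrow> norm (T vs) \<le> B * prod_list (map norm vs))"

text \<open>
  Smoothness is \<open>C\<^sup>\<infinity>\<close> in the sense of Frechet. The family \<open>D\<close> collects the iterated derivatives:
  \<open>D k x\<close> is the \<open>k\<close>-th derivative at \<open>x\<close>, a bounded \<open>k\<close>-linear map, and the last clause says that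
  \<open>D k\<close> is Frechet differentiable at \<open>x\<close> with respect to the operator norm of bounded \<open>k\<close>-linear maps,
  with derivative \<open>D (k + 1) x\<close> under the usual identification of bounded linear maps into
  \<open>k\<close>-linear maps with \<open>k + 1\<close>-linear maps. The notion is used only for open \<open>S\<close>.
\<close>

definition smooth_on :: "'a::real_normed_vector set \<Rightarrow> ('a \<Rightarrow> 'b::real_normed_vector) \<Rightarrow> bool" where
  "smooth_on S f \<longleftrightarrow>
     (\<exists>D :: nat \<Rightarrow> 'a \<Rightarrow> 'a list \<Rightarrow> 'b.
        (\<forall>x\<in>S. D 0 x [] = f x) \<and>
        (\<forall>k. \<forall>x\<in>S. bounded_multilinear k (D k x)) \<and>
        (\<forall>k. \<forall>x\<in>S. \<forall>\<epsilon>>0. \<exists>\<delta>>0. \<forall>y\<in>S. norm (y - x) < \<delta> \<longrightarrow>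
           (\<forall>vs. length vs = k \<longrightarrow>
              norm (D k y vs - D k x vs - D (Suc k) x ((y - x) # vs))
                \<le> \<epsilon> * norm (y - x) * prod_list (map norm vs))))"

section \<open>Banach manifolds\<close>

text \<open>
  A manifold is given by an atlas; its set of points is the union of the chart domains.
  A chart is a pair of its domain and its coordinate map, only the restriction of the latter to
  the domain being relevant.
\<close>

type_synonym ('p, 'e) chart = "'p set \<times> ('p \<Rightarrow> 'e)"
type_synonym ('p, 'e) atlas = "('p, 'e) chart set"

definition points :: "('p, 'e) atlas \<Rightarrow> 'p set" where
  "points A = (\<Union>c\<in>A. fst c)"

definition chart_inv :: "('p, 'e) chart \<Rightarrow> 'e \<Rightarrow> 'p" where
  "chart_inv c = inv_into (fst c) (snd c)"

definition manifold_open :: "('p, 'e::real_normed_vector) atlas \<Rightarrow> 'p set \<Rightarrow> bool" where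
  "manifold_open A W \<longleftrightarrow> W \<subseteq> points A \<and> (\<forall>c\<in>A. open (snd c ` (fst c \<inter> W)))"

definition banach_manifold :: "('p, 'e::banach) atlas \<Rightarrow> bool" where
  "banach_manifold A \<longleftrightarrow>
     (\<forall>c\<in>A. inj_on (snd c) (fst c) \<and> open (snd c ` fst c)) \<and>
     (\<forall>c\<in>A. \<forall>d\<in>A. open (snd c ` (fst c \<inter> fst d)) \<and>
        smooth_on (snd c ` (fst c \<inter> fst d)) (snd d \<circ> chart_inv c)) \<and>
     (\<forall>p\<in>points A. \<forall>q\<in>points A. p \<noteq> q \<longrightarrow>
        (\<exists>U V. manifold_open A U \<and> manifold_open A V \<and> p \<in> U \<and> q \<in> V \<and> U \<inter> V = {}))"

text \<open>Openness of the domains of all local representatives amounts to continuity.\<close>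

definition smooth_map ::
    "('p, 'e::banach) atlas \<Rightarrow> ('q, 'f::banach) atlas \<Rightarrow> ('p \<Rightarrow> 'q) \<Rightarrow> bool" where
  "smooth_map A B f \<longleftrightarrow>
     f ` points A \<subseteq> points B \<and>
     (\<forall>c\<in>A. \<forall>d\<in>B. open (snd c ` (fst c \<inter> f -` fst d)) \<and>
        smooth_on (snd c ` (fst c \<inter> f -` fst d)) (snd d \<circ> f \<circ> chart_inv c))"

definition prod_atlas ::
    "('p, 'e) atlas \<Rightarrow> ('q, 'f) atlas \<Rightarrow> ('p \<times> 'q, 'e \<times> 'f) atlas" where
  "prod_atlas A B = {(fst c \<times> fst d, map_prod (snd c) (snd d)) | c d. c \<in> A \<and> d \<in> B}"

subsection \<open>Tangent vectors and differentials\<close>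

text \<open>
  The tangent space at \<open>p\<close> is identified with the model space by means of one fixed chart
  \<open>chart_at A p\<close> around \<open>p\<close>. Thus a tangent vector at \<open>p\<close> is its coordinate vector in that chart,
  and \<open>coord_change A c p\<close> converts it into its coordinate vector in the chart \<open>c\<close>.
\<close>

definition chart_at :: "('p, 'e) atlas \<Rightarrow> 'p \<Rightarrow> ('p, 'e) chart" where
  "chart_at A p = (SOME c. c \<in> A \<and> p \<in> fst c)"

definition coord_change ::
    "('p, 'e::real_normed_vector) atlas \<Rightarrow> ('p, 'e) chart \<Rightarrow> 'p \<Rightarrow> 'e \<Rightarrow> 'e" where
  "coord_change A c p =
     frechet_derivative (snd c \<circ> chart_inv (chart_at A p)) (at (snd (chart_at A p) p))"

definition differential ::
    "('p, 'e::real_normed_vector) atlas \<Rightarrow> ('q, 'f::real_normed_vector) atlas \<Rightarrow>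
      ('p \<Rightarrow> 'q) \<Rightarrow> 'p \<Rightarrow> 'e \<Rightarrow> 'f" where
  "differential A B f p =
     frechet_derivative (snd (chart_at B (f p)) \<circ> f \<circ> chart_inv (chart_at A p))
       (at (snd (chart_at A p) p))"

definition tangent_bundle ::
    "('p, 'e::real_normed_vector) atlas \<Rightarrow> ('p \<times> 'e, 'e \<times> 'e) atlas" where
  "tangent_bundle A =
     (\<lambda>c. (fst c \<times> UNIV, \<lambda>(p, \<xi>). (snd c p, coord_change A c p \<xi>))) ` A"

definition vector_field :: "('p, 'e::banach) atlas \<Rightarrow> ('p \<Rightarrow> 'e) \<Rightarrow> bool" where
  "vector_field A X \<longleftrightarrow> smooth_map A (tangent_bundle A) (\<lambda>p. (p, X p))"

definition bundle_map :: "('p, 'e::banach) atlas \<Rightarrow> ('p \<Rightarrow> 'e \<Rightarrow> 'e) \<Rightarrow> bool" where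
  "bundle_map A \<N> \<longleftrightarrow>
     smooth_map (tangent_bundle A) (tangent_bundle A) (\<lambda>(p, \<xi>). (p, \<N> p \<xi>)) \<and>
     (\<forall>p\<in>points A. bounded_linear (\<N> p))"

subsection \<open>Lie bracket and Nijenhuis torsion\<close>

definition local_rep ::
    "('p, 'e::real_normed_vector) atlas \<Rightarrow> ('p, 'e) chart \<Rightarrow> ('p \<Rightarrow> 'e) \<Rightarrow> 'e \<Rightarrow> 'e" where
  "local_rep A c X x = coord_change A c (chart_inv c x) (X (chart_inv c x))"

definition lie_bracket ::
    "('p, 'e::real_normed_vector) atlas \<Rightarrow> ('p \<Rightarrow> 'e) \<Rightarrow> ('p \<Rightarrow> 'e) \<Rightarrow> 'p \<Rightarrow> 'e" where
  "lie_bracket A X Y p =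
     (let c = chart_at A p; x = snd c p in
        frechet_derivative (local_rep A c Y) (at x) (local_rep A c X x) -
        frechet_derivative (local_rep A c X) (at x) (local_rep A c Y x))"

definition nijenhuis_torsion ::
    "('p, 'e::real_normed_vector) atlas \<Rightarrow> ('p \<Rightarrow> 'e \<Rightarrow> 'e) \<Rightarrow> ('p \<Rightarrow> 'e) \<Rightarrow> ('p \<Rightarrow> 'e) \<Rightarrow> 'p \<Rightarrow> 'e" where
  "nijenhuis_torsion A \<N> X Y p =
     \<N> p (lie_bracket A (\<lambda>q. \<N> q (X q)) Y p)
     + \<N> p (lie_bracket A X (\<lambda>q. \<N> q (Y q)) p)
     - lie_bracket A (\<lambda>q. \<N> q (X q)) (\<lambda>q. \<N> q (Y q)) p
     - \<N> p (\<N> p (lie_bracket A X Y p))"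

definition nijenhuis_operator :: "('p, 'e::banach) atlas \<Rightarrow> ('p \<Rightarrow> 'e \<Rightarrow> 'e) \<Rightarrow> bool" where
  "nijenhuis_operator A \<N> \<longleftrightarrow>
     (\<forall>X Y. vector_field A X \<longrightarrow> vector_field A Y \<longrightarrow>
        (\<forall>p\<in>points A. nijenhuis_torsion A \<N> X Y p = 0))"

section \<open>Banach--Lie groups and homogeneous spaces\<close>

definition banach_lie_group ::
    "('g, 'z) monoid_scheme \<Rightarrow> ('g, 'e::banach) atlas \<Rightarrow> bool" where
  "banach_lie_group G A \<longleftrightarrow>
     group G \<and> banach_manifold A \<and> points A = carrier G \<and>
     smooth_map (prod_atlas A A) A (\<lambda>(g, h). g \<otimes>\<^bsub>G\<^esub> h) \<and>
     smooth_map A A (\<lambda>g. inv\<^bsub>G\<^esub> g)"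

text \<open>The Lie algebra is the tangent space at the identity, i.e. the type of the model space.\<close>

definition left_invariant_field ::
    "('g, 'z) monoid_scheme \<Rightarrow> ('g, 'e::real_normed_vector) atlas \<Rightarrow> 'e \<Rightarrow> 'g \<Rightarrow> 'e" where
  "left_invariant_field G A v g = differential A A (\<lambda>h. g \<otimes>\<^bsub>G\<^esub> h) \<one>\<^bsub>G\<^esub> v"

definition lie_algebra_bracket ::
    "('g, 'z) monoid_scheme \<Rightarrow> ('g, 'e::real_normed_vector) atlas \<Rightarrow> 'e \<Rightarrow> 'e \<Rightarrow> 'e" where
  "lie_algebra_bracket G A v w =
     lie_bracket A (left_invariant_field G A v) (left_invariant_field G A w) \<one>\<^bsub>G\<^esub>"

definition Ad ::
    "('g, 'z) monoid_scheme \<Rightarrow> ('g, 'e::real_normed_vector) atlas \<Rightarrow> 'g \<Rightarrow> 'e \<Rightarrow> 'e" where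
  "Ad G A g = differential A A (\<lambda>h. g \<otimes>\<^bsub>G\<^esub> h \<otimes>\<^bsub>G\<^esub> inv\<^bsub>G\<^esub> g) \<one>\<^bsub>G\<^esub>"

text \<open>
  The subgroup \<open>K\<close> carries its own Lie group structure, given by the atlas \<open>B\<close>; its topology may be
  finer than the one induced from \<open>G\<close>.
\<close>

definition immersed_lie_subgroup ::
    "('g, 'z) monoid_scheme \<Rightarrow> ('g, 'e::banach) atlas \<Rightarrow> 'g set \<Rightarrow> ('g, 'f::banach) atlas \<Rightarrow> bool" where
  "immersed_lie_subgroup G A K B \<longleftrightarrow>
     subgroup K G \<and> banach_lie_group (G\<lparr>carrier := K\<rparr>) B \<and>
     smooth_map B A (\<lambda>k. k) \<and>
     (\<forall>k\<in>K. inj (differential B A (\<lambda>k. k) k) \<and> closed (range (differential B A (\<lambda>k. k) k)))"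

definition lie_subalgebra ::
    "('g, 'z) monoid_scheme \<Rightarrow> ('g, 'e::banach) atlas \<Rightarrow> ('g, 'f::banach) atlas \<Rightarrow> 'e set" where
  "lie_subalgebra G A B = range (differential B A (\<lambda>k. k) \<one>\<^bsub>G\<^esub>)"

abbreviation quot_map :: "('g, 'z) monoid_scheme \<Rightarrow> 'g set \<Rightarrow> 'g \<Rightarrow> 'g set" where
  "quot_map G K g \<equiv> g <#\<^bsub>G\<^esub> K"

definition homogeneous_space ::
    "('g, 'z) monoid_scheme \<Rightarrow> ('g, 'e::banach) atlas \<Rightarrow> 'g set \<Rightarrow> ('g set, 'm::banach) atlas \<Rightarrow> bool" where
  "homogeneous_space G A K M \<longleftrightarrow>
     banach_manifold M \<and> points M = lcosets\<^bsub>G\<^esub> K \<and>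
     smooth_map A M (quot_map G K) \<and>
     (\<forall>g\<in>carrier G. surj (differential A M (quot_map G K) g))"

text \<open>
  Translation of the coset as a set; it satisfies \<open>\<alpha>\<^sub>g (\<pi> h) = \<pi> (g h)\<close> by the lemma below.
\<close>

definition translation :: "('g, 'z) monoid_scheme \<Rightarrow> 'g \<Rightarrow> 'g set \<Rightarrow> 'g set" where
  "translation G g P = g <#\<^bsub>G\<^esub> P"

lemma translation_quot_map:
  assumes "group G" "subgroup K G" "g \<in> carrier G" "h \<in> carrier G"
  shows "translation G g (quot_map G K h) = quot_map G K (g \<otimes>\<^bsub>G\<^esub> h)"
  using assms by (simp add: translation_def group.lcos_m_assoc subgroup.subset)

abbreviation base_point :: "('g, 'z) monoid_scheme \<Rightarrow> 'g set \<Rightarrow> 'g set" where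
  "base_point G K \<equiv> quot_map G K \<one>\<^bsub>G\<^esub>"

definition d_alpha ::
    "('g, 'z) monoid_scheme \<Rightarrow> 'g set \<Rightarrow> ('g set, 'm::real_normed_vector) atlas \<Rightarrow> 'g \<Rightarrow> 'm \<Rightarrow> 'm" where
  "d_alpha G K M g = differential M M (translation G g) (base_point G K)"

definition d_pi ::
    "('g, 'z) monoid_scheme \<Rightarrow> ('g, 'e::real_normed_vector) atlas \<Rightarrow> 'g set \<Rightarrow>
      ('g set, 'm::real_normed_vector) atlas \<Rightarrow> 'e \<Rightarrow> 'm" where
  "d_pi G A K M = differential A M (quot_map G K) \<one>\<^bsub>G\<^esub>"

definition admissible ::
    "('g, 'z) monoid_scheme \<Rightarrow> ('g, 'e::banach) atlas \<Rightarrow> 'g set \<Rightarrow> ('g, 'f::banach) atlas \<Rightarrow>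
      ('e \<Rightarrow>\<^sub>L 'e) set" where
  "admissible G A K B =
     {N. blinfun_apply N ` lie_subalgebra G A B \<subseteq> lie_subalgebra G A B \<and>
         (\<forall>k\<in>K. range (\<lambda>v. Ad G A k (N v) - N (Ad G A k v)) \<subseteq> lie_subalgebra G A B)}"

definition induced_bundle_map ::
    "('g, 'z) monoid_scheme \<Rightarrow> ('g, 'e::banach) atlas \<Rightarrow> 'g set \<Rightarrow> ('g set, 'm::banach) atlas \<Rightarrow>
      ('e \<Rightarrow>\<^sub>L 'e) \<Rightarrow> ('g set \<Rightarrow> 'm \<Rightarrow> 'm) \<Rightarrow> bool" where
  "induced_bundle_map G A K M N \<N> \<longleftrightarrow>
     bundle_map M \<N> \<and>
     (\<forall>v. \<N> (base_point G K) (d_pi G A K M v) = d_pi G A K M (N v)) \<and>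
     (\<forall>g\<in>carrier G. \<N> (quot_map G K g) =
        d_alpha G K M g \<circ> \<N> (base_point G K) \<circ> inv_into UNIV (d_alpha G K M g))"

definition algebraic_torsion ::
    "('g, 'z) monoid_scheme \<Rightarrow> ('g, 'e::real_normed_vector) atlas \<Rightarrow> ('e \<Rightarrow>\<^sub>L 'e) \<Rightarrow> 'e \<Rightarrow> 'e \<Rightarrow> 'e" where
  "algebraic_torsion G A N v w =
     N (lie_algebra_bracket G A v (N w)) + N (lie_algebra_bracket G A (N v) w)
     - lie_algebra_bracket G A (N v) (N w) - N (N (lie_algebra_bracket G A v w))"

end

theory Submission
  imports Defs
begin

text \<open>
  Write \<open>n\<close> for the local representative of \<open>\<N>\<close>, a family of operators, and \<open>D\<close> for its derivative in the
  base point. Expanding the brackets in a chart, the derivatives of the vector fields cancel and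
  \<open>\<Omega>(X, Y) = n (D\<^bsub>X\<^esub> n) Y - n (D\<^bsub>Y\<^esub> n) X - (D\<^bsub>n X\<^esub> n) Y + (D\<^bsub>n Y\<^esub> n) X\<close>, so the torsion is tensorial. To evaluate it
  at \<open>\<pi>(g)\<close>, let \<open>Q\<^bsub>v\<^esub>\<close> be the image of the left-invariant field of \<open>v\<close> under the differential of
  \<open>h \<mapsto> \<pi>(g h)\<close>. Homogeneity of \<open>\<N>\<close> reads \<open>n Q\<^bsub>v\<^esub> = Q\<^bsub>N v\<^esub>\<close>; differentiating this identity at \<open>1\<close> gives \<open>D n\<close>, and
  symmetry of second derivatives turns the result into the bracket of \<open>\<gg>\<close>. No lift of \<open>X\<close> and \<open>Y\<close> to \<open>G\<close>
  is needed.

  For the converse half of the equivalence one needs smooth global fields with prescribed values at the base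
  point. The fundamental fields of the action serve, but their smoothness (and that of the translations) on
  \<open>G/K\<close> is only visible after composition with \<open>\<pi>\<close>, which has no smooth local sections when \<open>\<kk>\<close> is not
  complemented. It descends nevertheless: a submersion between Banach spaces is locally onto with a linear
  estimate (Graves), which makes \<open>w\<close> differentiable as soon as \<open>w \<circ> P\<close> is, and the operator family \<open>w' \<circ> P\<close> is
  determined by \<open>(w' \<circ> P) P' = (w \<circ> P)'\<close>, from which its derivatives of all orders are obtained by division by
  the surjections \<open>P'\<close>.
\<close>

section \<open>Uniformly smooth families of functions\<close>

text \<open>The images Q of left-invariant fields depend on h and not only on \<pi>(g h), so they
  are not vector fields on G/K and have no bracket there; only their values and first derivatives at
  one point enter. Write T for the derivative of the local projection P and q(v, k) for the
  derivative of the image of v in direction k. The second derivative of P is symmetric and drops out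
  of q(w, v) - q(v, w), which leaves T [v, w]. The obstacle in the division is that the operators
  \<phi>(x) are known only on vectors P'(x) h, which move with x. Freezing such a vector at x0 costs
  a correction: the derivative of \<phi> on P'(x0) h is the derivative of \<phi> P' h minus \<phi>
  applied to the derivative of P' h. The correction contains \<phi> undifferentiated, so each order
  of smoothness follows from the previous one. All bounds must be uniform over unit vectors, because
  in infinite dimensions differentiability for each fixed vector does not control operator norms.
  For this reason families instead of single functions are carried through the calculus.\<close>

abbreviation fderiv :: "('a::real_normed_vector \<Rightarrow> 'b::real_normed_vector) \<Rightarrow> 'a \<Rightarrow> 'a \<Rightarrow> 'b" where
  "fderiv f x \<equiv> frechet_derivative f (at x)"

lemma fderiv_works: "f differentiable (at x) \<Longrightarrow> (f has_derivative fderiv f x) (at x)"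
  by (simp add: frechet_derivative_works)

lemma fderiv_eq: "(f has_derivative f') (at x) \<Longrightarrow> fderiv f x = f'"
  by (metis frechet_derivative_at)

lemma bounded_linear_fderiv: "f differentiable (at x) \<Longrightarrow> bounded_linear (fderiv f x)"
  using fderiv_works has_derivative_bounded_linear by blast

lemma differentiable_cong_open:
  assumes "f differentiable (at x)" "open S" "x \<in> S" "\<And>y. y \<in> S \<Longrightarrow> f y = g y"
  shows "g differentiable (at x)"
  using assms by (meson differentiable_def has_derivative_transform_within_open)

lemma fderiv_cong_open:
  assumes "f differentiable (at x)" "open S" "x \<in> S" "\<And>y. y \<in> S \<Longrightarrow> f y = g y"
  shows "fderiv g x = fderiv f x"
  using frechet_derivative_transform_within_open assms by metis

text \<open>One constant serves the whole family near x. For families of directional derivatives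
  this is a local bound of the operator norm, obtained without a type of operators.\<close>

definition locally_bounded :: "'a::real_normed_vector set \<Rightarrow> ('a \<Rightarrow> 'b::real_normed_vector) set \<Rightarrow> bool" where
  "locally_bounded S F \<longleftrightarrow> (\<forall>x\<in>S. \<exists>C. \<forall>\<^sub>F y in nhds x. \<forall>f\<in>F. norm (f y) \<le> C)"

text \<open>An operator valued map enters through its values on the closed unit ball, so uniformity
  over the resulting family is uniformity in operator norm.\<close>

definition evals :: "('a \<Rightarrow> 'm::real_normed_vector \<Rightarrow> 'b) set \<Rightarrow> ('a \<Rightarrow> 'b) set" where
  "evals \<Phi> = {\<lambda>x. \<phi> x m | \<phi> m. \<phi> \<in> \<Phi> \<and> norm m \<le> 1}"

definition derivs :: "('a::real_normed_vector \<Rightarrow> 'b::real_normed_vector) set \<Rightarrow> ('a \<Rightarrow> 'b) set" where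
  "derivs F = evals (fderiv ` F)"

text \<open>
  Taking all directional derivatives in unit directions of all members of a family gives again a family of
  functions between the same two spaces, so smoothness of arbitrary order can be handled by induction without
  leaving the type; spaces of multilinear maps would change the type at each step. A function is smooth iff its
  singleton family is \<open>C_family n\<close> for all \<open>n\<close>.
\<close>

primrec C_family :: "nat \<Rightarrow> 'a::real_normed_vector set \<Rightarrow> ('a \<Rightarrow> 'b::real_normed_vector) set \<Rightarrow> bool" where
  "C_family 0 S F = locally_bounded S F"
| "C_family (Suc n) S F \<longleftrightarrow> locally_bounded S F \<and> (\<forall>f\<in>F. \<forall>x\<in>S. f differentiable (at x)) \<and>
     C_family n S (derivs F)"

lemma derivsI: "f \<in> F \<Longrightarrow> norm h \<le> 1 \<Longrightarrow> (\<lambda>x. fderiv f x h) \<in> derivs F"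
  unfolding derivs_def evals_def by (intro CollectI exI[of _ "fderiv f"] exI[of _ h]) auto

lemma derivsE:
  assumes "g \<in> derivs F"
  obtains f h where "f \<in> F" "norm h \<le> 1" "g = (\<lambda>x. fderiv f x h)"
  using assms by (auto simp: derivs_def evals_def)

lemma evalsI: "\<phi> \<in> \<Phi> \<Longrightarrow> norm m \<le> 1 \<Longrightarrow> (\<lambda>x. \<phi> x m) \<in> evals \<Phi>"
  by (auto simp: evals_def)

lemma evalsE:
  assumes "g \<in> evals \<Phi>"
  obtains \<phi> m where "\<phi> \<in> \<Phi>" "norm m \<le> 1" "g = (\<lambda>x. \<phi> x m)"
  using assms by (auto simp: evals_def)

lemma locally_boundedD:
  assumes "locally_bounded S F" "x \<in> S"
  obtains C where "C > 0" "\<forall>\<^sub>F y in nhds x. \<forall>f\<in>F. norm (f y) \<le> C"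
proof -
  obtain C where C: "\<forall>\<^sub>F y in nhds x. \<forall>f\<in>F. norm (f y) \<le> C"
    using assms by (auto simp: locally_bounded_def)
  have "\<forall>\<^sub>F y in nhds x. \<forall>f\<in>F. norm (f y) \<le> \<bar>C\<bar> + 1"
    using C by eventually_elim force
  then show ?thesis using that[of "\<bar>C\<bar> + 1"] by simp
qed

lemma C_family_locally_bounded: "C_family n S F \<Longrightarrow> locally_bounded S F"
  by (cases n) auto

lemma C_family_differentiable: "C_family (Suc n) S F \<Longrightarrow> f \<in> F \<Longrightarrow> x \<in> S \<Longrightarrow> f differentiable (at x)"
  by auto

text \<open>Derivatives at points of an open set only see the functions there, so
  \<open>fderiv\<close> inherits the agreement and the induction goes through. The rules of calculus
  below compute the derivatives of a family only on S and then appeal to this lemma.\<close>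

lemma C_family_cong:
  assumes "open S" "C_family n S F" "\<And>g. g \<in> G \<Longrightarrow> \<exists>f\<in>F. \<forall>x\<in>S. g x = f x"
  shows "C_family n S G"
  using assms(2,3)
proof (induction n arbitrary: F G)
  have lb: "locally_bounded S G"
    if F: "locally_bounded S F" and G: "\<And>g. g \<in> G \<Longrightarrow> \<exists>f\<in>F. \<forall>x\<in>S. g x = f x"
    for F G :: "('a \<Rightarrow> 'b) set"
    unfolding locally_bounded_def
  proof
    fix x assume x: "x \<in> S"
    obtain C where C: "\<forall>\<^sub>F y in nhds x. \<forall>f\<in>F. norm (f y) \<le> C"
      using F x by (auto simp: locally_bounded_def)
    have "\<forall>\<^sub>F y in nhds x. y \<in> S" using x assms(1) eventually_nhds_in_open by blast
    with C have "\<forall>\<^sub>F y in nhds x. \<forall>f\<in>G. norm (f y) \<le> C"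
      by eventually_elim (metis G)
    then show "\<exists>C. \<forall>\<^sub>F y in nhds x. \<forall>f\<in>G. norm (f y) \<le> C" by blast
  qed
  {
    case 0
    then show ?case using lb by auto
  next
    case (Suc n)
    have "locally_bounded S F" using Suc.prems(1) by simp
    then have "locally_bounded S G" by (rule lb) (rule Suc.prems(2))
    moreover have "g differentiable (at x)" if g: "g \<in> G" and x: "x \<in> S" for g x
    proof -
      obtain f where f: "f \<in> F" "\<forall>x\<in>S. g x = f x" using Suc.prems(2) g by blast
      have "f differentiable (at x)" using Suc.prems(1) f x by auto
      then show ?thesis using differentiable_cong_open[of f x S g] assms(1) x f by auto
    qed
    moreover have "C_family n S (derivs G)"
    proof (rule Suc.IH[of "derivs F"])
      show "C_family n S (derivs F)" using Suc.prems by simp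
      fix g' assume "g' \<in> derivs G"
      then obtain g h where g: "g \<in> G" "norm h \<le> 1" "g' = (\<lambda>x. fderiv g x h)" by (rule derivsE)
      obtain f where f: "f \<in> F" "\<forall>x\<in>S. g x = f x" using Suc.prems(2) g by blast
      have "fderiv g x = fderiv f x" if "x \<in> S" for x
        using fderiv_cong_open[of f x S g] Suc.prems(1) f assms(1) that by auto
      then show "\<exists>f'\<in>derivs F. \<forall>x\<in>S. g' x = f' x"
        using derivsI[of f F h] f g by (intro bexI[of _ "\<lambda>x. fderiv f x h"]) auto
    qed
    ultimately show ?case by simp
  }
qed

lemma C_family_mono: "open S \<Longrightarrow> C_family n S F \<Longrightarrow> G \<subseteq> F \<Longrightarrow> C_family n S G"
  by (rule C_family_cong) auto

lemma C_family_SucD: "C_family (Suc n) S F \<Longrightarrow> C_family n S F"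
  by (induction n arbitrary: F) auto

lemma C_family_le: "C_family m S F \<Longrightarrow> n \<le> m \<Longrightarrow> C_family n S F"
  by (induction m) (auto simp: le_Suc_eq dest: C_family_SucD simp del: C_family.simps(2))

text \<open>The sets T may be arbitrary: boundedness and differentiability are stated with full
  neighbourhoods of each point, so the whole condition is a conjunction over the points of
  S.\<close>

lemma C_family_local:
  assumes "\<And>x. x \<in> S \<Longrightarrow> \<exists>T. x \<in> T \<and> C_family n T F"
  shows "C_family n S F"
  using assms
proof (induction n arbitrary: F)
  case 0
  then show ?case by (auto simp: locally_bounded_def)
next
  case (Suc n)
  have "C_family n S (derivs F)" by (rule Suc.IH) (use Suc.prems in force)
  moreover have "locally_bounded S F"
    using Suc.prems by (fastforce simp: locally_bounded_def)
  ultimately show ?case using Suc.prems by fastforce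
qed

lemma C_family_subset: "C_family n S F \<Longrightarrow> T \<subseteq> S \<Longrightarrow> C_family n T F"
  by (rule C_family_local) auto

section \<open>Sums, linear images and constants of smooth families\<close>

lemma C_family_sum:
  assumes "open S"
  shows "C_family n S F \<Longrightarrow> C_family n S G \<Longrightarrow> C_family n S {\<lambda>x. f x + g x | f g. f \<in> F \<and> g \<in> G}"
proof (induction n arbitrary: F G)
  have lb: "locally_bounded S {\<lambda>x. f x + g x | f g. f \<in> F \<and> g \<in> G}"
    if FG: "locally_bounded S F" "locally_bounded S G" for F G :: "('a \<Rightarrow> 'b) set"
    unfolding locally_bounded_def
  proof
    fix x assume x: "x \<in> S"
    obtain C where C: "\<forall>\<^sub>F y in nhds x. \<forall>f\<in>F. norm (f y) \<le> C"
      using FG x by (auto simp: locally_bounded_def)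
    obtain D where D: "\<forall>\<^sub>F y in nhds x. \<forall>f\<in>G. norm (f y) \<le> D"
      using FG x by (auto simp: locally_bounded_def)
    have "\<forall>\<^sub>F y in nhds x. \<forall>f\<in>{\<lambda>x. f x + g x | f g. f \<in> F \<and> g \<in> G}. norm (f y) \<le> C + D"
      using C D by eventually_elim (auto intro: norm_triangle_mono)
    then show "\<exists>C. \<forall>\<^sub>F y in nhds x. \<forall>f\<in>{\<lambda>x. f x + g x | f g. f \<in> F \<and> g \<in> G}. norm (f y) \<le> C"
      by blast
  qed
  {
    case 0
    then show ?case using lb by simp
  next
    case (Suc n)
    have "C_family n S (derivs {\<lambda>x. f x + g x | f g. f \<in> F \<and> g \<in> G})"
    proof (rule C_family_cong[OF assms])
      show "C_family n S {\<lambda>x. f x + g x | f g. f \<in> derivs F \<and> g \<in> derivs G}"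
        using Suc by simp
      fix k assume "k \<in> derivs {\<lambda>x. f x + g x | f g. f \<in> F \<and> g \<in> G}"
      then obtain f g h where *: "f \<in> F" "g \<in> G" "norm h \<le> 1" "k = (\<lambda>x. fderiv (\<lambda>x. f x + g x) x h)"
        by (auto elim!: derivsE)
      have "fderiv (\<lambda>x. f x + g x) x = (\<lambda>h. fderiv f x h + fderiv g x h)" if "x \<in> S" for x
        using that Suc.prems * by (intro fderiv_eq has_derivative_add fderiv_works) auto
      then show "\<exists>k'\<in>{\<lambda>x. f x + g x | f g. f \<in> derivs F \<and> g \<in> derivs G}. \<forall>x\<in>S. k x = k' x"
        using * derivsI[of f F h] derivsI[of g G h]
        by (intro bexI[of _ "\<lambda>x. fderiv f x h + fderiv g x h"]) auto
    qed
    then show ?case using Suc.prems lb by auto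
  }
qed

lemma C_family_linear:
  assumes "open S" and L: "\<And>l. l \<in> L \<Longrightarrow> linear l" "\<And>l x. l \<in> L \<Longrightarrow> norm (l x) \<le> B * norm x"
  shows "C_family n S F \<Longrightarrow> C_family n S {\<lambda>x. l (f x) | l f. l \<in> L \<and> f \<in> F}"
proof (induction n arbitrary: F)
  have lb: "locally_bounded S {\<lambda>x. l (f x) | l f. l \<in> L \<and> f \<in> F}"
    if F: "locally_bounded S F" for F :: "('a \<Rightarrow> 'b) set"
    unfolding locally_bounded_def
  proof
    fix x assume x: "x \<in> S"
    obtain C where C: "C > 0" "\<forall>\<^sub>F y in nhds x. \<forall>f\<in>F. norm (f y) \<le> C"
      using F x by (rule locally_boundedD)
    have "norm (l z) \<le> \<bar>B\<bar> * C" if "l \<in> L" "norm z \<le> C" for l z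
    proof -
      have "norm (l z) \<le> \<bar>B\<bar> * norm z"
        using L(2)[OF that(1), of z] by (smt (verit) mult_right_mono norm_ge_zero)
      also have "\<dots> \<le> \<bar>B\<bar> * C" using that by (intro mult_left_mono) auto
      finally show ?thesis .
    qed
    then have "\<forall>\<^sub>F y in nhds x. \<forall>f\<in>{\<lambda>x. l (f x) | l f. l \<in> L \<and> f \<in> F}. norm (f y) \<le> \<bar>B\<bar> * C"
      by (intro eventually_mono[OF C(2)]) auto
    then show "\<exists>C. \<forall>\<^sub>F y in nhds x. \<forall>f\<in>{\<lambda>x. l (f x) | l f. l \<in> L \<and> f \<in> F}. norm (f y) \<le> C" by blast
  qed
  {
    case 0
    then show ?case using lb by simp
  next
    case (Suc n)
    have bl: "bounded_linear l" if "l \<in> L" for l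
      using L[OF that] by (auto intro!: bounded_linear.intro bounded_linear_axioms.intro exI[of _ B] simp: mult.commute)
    have d: "((\<lambda>x. l (f x)) has_derivative (\<lambda>h. l (fderiv f x h))) (at x)" if "x \<in> S" "l \<in> L" "f \<in> F" for x l f
      using that Suc.prems bl by (intro bounded_linear.has_derivative[of l] fderiv_works) auto
    have "C_family n S (derivs {\<lambda>x. l (f x) | l f. l \<in> L \<and> f \<in> F})"
    proof (rule C_family_cong[OF assms(1)])
      show "C_family n S {\<lambda>x. l (f x) | l f. l \<in> L \<and> f \<in> derivs F}" using Suc by simp
      fix k assume "k \<in> derivs {\<lambda>x. l (f x) | l f. l \<in> L \<and> f \<in> F}"
      then obtain l f h where *: "l \<in> L" "f \<in> F" "norm h \<le> 1" "k = (\<lambda>x. fderiv (\<lambda>x. l (f x)) x h)"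
        by (auto elim!: derivsE)
      then show "\<exists>k'\<in>{\<lambda>x. l (f x) | l f. l \<in> L \<and> f \<in> derivs F}. \<forall>x\<in>S. k x = k' x"
        using * derivsI[of f F h] fderiv_eq[OF d]
        by (intro bexI[of _ "\<lambda>x. l (fderiv f x h)"]) auto
    qed
    moreover have "\<forall>f\<in>{\<lambda>x. l (f x) | l f. l \<in> L \<and> f \<in> F}. \<forall>x\<in>S. f differentiable (at x)"
      using d differentiableI by blast
    ultimately show ?case using Suc.prems lb by auto
  }
qed

lemma C_family_const:
  assumes "open S"
  shows "C_family n S {\<lambda>x. c | c. norm c \<le> B}"
proof (induction n arbitrary: B)
  have lb: "locally_bounded S {\<lambda>x. c | c. norm c \<le> B}" for B
    unfolding locally_bounded_def by (intro ballI exI[of _ B] always_eventually) auto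
  {
    case 0
    then show ?case using lb by simp
  next
    case (Suc n)
    have "derivs {\<lambda>x. c | c. norm c \<le> B} \<subseteq> {\<lambda>x::'a. c | c. norm (c::'b) \<le> \<bar>B\<bar>}"
      by (auto elim!: derivsE)
    then show ?case
      using lb[of B] C_family_mono[OF assms Suc.IH[of "\<bar>B\<bar>"]] by auto
  }
qed

section \<open>Mean value estimates uniform over a family\<close>

lemma linear_bound_from_unit_ball:
  assumes "linear l" "\<And>h. norm h \<le> 1 \<Longrightarrow> norm (l h) \<le> B"
  shows "norm (l h) \<le> B * norm h"
proof (cases "h = 0")
  case True
  then show ?thesis using linear_0[OF assms(1)] by simp
next
  case False
  have "norm (l ((1 / norm h) *\<^sub>R h)) \<le> B" using False by (intro assms(2)) simp
  then show ?thesis using False linear_scale[OF assms(1)] by (simp add: field_simps)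
qed

lemma C_family_deriv_bound:
  assumes "open S" "C_family (Suc 0) S F" "x \<in> S"
  shows "\<exists>B>0. \<exists>\<delta>>0. ball x \<delta> \<subseteq> S \<and> (\<forall>f\<in>F. \<forall>y\<in>ball x \<delta>. \<forall>h. norm (fderiv f y h) \<le> B * norm h)"
proof -
  have "locally_bounded S (derivs F)" using assms(2) by simp
  then obtain B where B: "B > 0" "\<forall>\<^sub>F y in nhds x. \<forall>f\<in>derivs F. norm (f y) \<le> B"
    using assms(3) by (rule locally_boundedD)
  have "\<forall>\<^sub>F y in nhds x. y \<in> S" using assms eventually_nhds_in_open by blast
  with B(2) have "\<forall>\<^sub>F y in nhds x. y \<in> S \<and> (\<forall>f\<in>derivs F. norm (f y) \<le> B)"
    by eventually_elim auto
  then obtain \<delta> where \<delta>: "\<delta> > 0" "\<And>y. dist y x < \<delta> \<Longrightarrow> y \<in> S \<and> (\<forall>f\<in>derivs F. norm (f y) \<le> B)"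
    unfolding eventually_nhds_metric by blast
  show ?thesis
  proof (intro exI conjI ballI allI)
    show "B > 0" "\<delta> > 0" by fact+
    show "ball x \<delta> \<subseteq> S" using \<delta>(2) by (auto simp: dist_commute)
    fix f y h assume f: "f \<in> F" and y: "y \<in> ball x \<delta>"
    have "y \<in> S" using \<delta>(2) y by (auto simp: dist_commute)
    then have "linear (fderiv f y)" using assms(2) f by (intro linear_frechet_derivative) auto
    moreover have "norm (fderiv f y k) \<le> B" if "norm k \<le> 1" for k
      using derivsI[OF f that] \<delta>(2)[of y] y by (auto simp: dist_commute)
    ultimately show "norm (fderiv f y h) \<le> B * norm h"
      by (rule linear_bound_from_unit_ball)
  qed
qed

lemma C_family_Lipschitz:
  assumes "open S" "C_family (Suc 0) S F" "x \<in> S"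
  shows "\<exists>L>0. \<exists>\<delta>>0. ball x \<delta> \<subseteq> S \<and>
    (\<forall>f\<in>F. \<forall>y\<in>ball x \<delta>. \<forall>z\<in>ball x \<delta>. norm (f y - f z) \<le> L * norm (y - z))"
proof -
  obtain B \<delta> where B: "B > 0" "\<delta> > 0" "ball x \<delta> \<subseteq> S"
    "\<forall>f\<in>F. \<forall>y\<in>ball x \<delta>. \<forall>h. norm (fderiv f y h) \<le> B * norm h"
    using C_family_deriv_bound[OF assms] by blast
  have "norm (f y - f z) \<le> B * norm (y - z)" if f: "f \<in> F" and yz: "y \<in> ball x \<delta>" "z \<in> ball x \<delta>" for f y z
  proof (rule differentiable_bound[OF convex_ball[of x \<delta>] _ _ yz(1,2)])
    fix w assume w: "w \<in> ball x \<delta>"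
    then have "w \<in> S" using B by auto
    then have "f differentiable (at w)" using assms(2) f by auto
    then show "(f has_derivative fderiv f w) (at w within ball x \<delta>)"
      using fderiv_works has_derivative_at_withinI by blast
    show "onorm (fderiv f w) \<le> B" using B(1) B(4) f w by (intro onorm_bound) auto
  qed
  with B(1-3) show ?thesis by blast
qed

text \<open>The derivatives form a locally Lipschitz family, so on a ball of radius r they differ
  from the one at x by at most L r in operator norm, and the mean value inequality does the rest.
  The explicit factor r is the point: it yields the contraction for submersions, the remainder
  estimate of \<open>smooth_on\<close> and the cubic error of second differences.\<close>

lemma C_family_strict_derivative:
  assumes "open S" "C_family (Suc (Suc 0)) S F" "x \<in> S"
  shows "\<exists>L>0. \<exists>\<delta>>0. ball x \<delta> \<subseteq> S \<and>
    (\<forall>f\<in>F. \<forall>r y z. 0 < r \<longrightarrow> r \<le> \<delta> \<longrightarrow> y \<in> ball x r \<longrightarrow> z \<in> ball x r \<longrightarrow>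
       norm (f y - f z - fderiv f x (y - z)) \<le> L * r * norm (y - z))"
proof -
  have "C_family (Suc 0) S (derivs F)" using assms(2) by simp
  then obtain L \<delta> where L: "L > 0" "\<delta> > 0" "ball x \<delta> \<subseteq> S"
    "\<forall>f\<in>derivs F. \<forall>y\<in>ball x \<delta>. \<forall>z\<in>ball x \<delta>. norm (f y - f z) \<le> L * norm (y - z)"
    using C_family_Lipschitz[OF assms(1) _ assms(3)] by blast
  have "norm (f y - f z - fderiv f x (y - z)) \<le> L * r * norm (y - z)"
    if f: "f \<in> F" and r: "0 < r" "r \<le> \<delta>" and yz: "y \<in> ball x r" "z \<in> ball x r" for f r y z
  proof -
    have sub: "ball x r \<subseteq> S" using L(3) subset_ball[OF r(2), of x] by blast
    have diff: "f differentiable (at w)" if "w \<in> ball x r" for w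
      using that assms(2) f sub by auto
    have "norm (f y - f z - fderiv f x (y - z)) \<le> norm (y - z) * (L * r)"
    proof (rule differentiable_bound_linearization[where S="ball x r"])
      fix t :: real assume "t \<in> {0..1}"
      then have "(1 - t) *\<^sub>R z + t *\<^sub>R y \<in> ball x r"
        using convexD_alt[OF convex_ball[of x r] yz(2,1), of t] by auto
      then show "z + t *\<^sub>R (y - z) \<in> ball x r" by (simp add: algebra_simps)
    next
      fix w assume w: "w \<in> ball x r"
      show "(f has_derivative fderiv f w) (at w within ball x r)"
        using fderiv_works[OF diff[OF w]] has_derivative_at_withinI by blast
      have lin: "linear (fderiv f w - fderiv f x)"
        using linear_frechet_derivative[OF diff[OF w]] linear_frechet_derivative[OF diff[of x]] r
        by (auto simp: linear_iff algebra_simps)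
      have "norm (fderiv f w h - fderiv f x h) \<le> L * r" if h: "norm h \<le> 1" for h
      proof -
        have "norm (fderiv f w h - fderiv f x h) \<le> L * norm (w - x)"
          using L(4)[rule_format, OF derivsI[OF f h], of w x] w r L(2) by auto
        also have "\<dots> \<le> L * r" using w L(1) by (auto simp: dist_norm norm_minus_commute)
        finally show ?thesis .
      qed
      then have "norm ((fderiv f w - fderiv f x) h) \<le> L * r * norm h" for h
        by (intro linear_bound_from_unit_ball[OF lin]) auto
      then show "onorm (fderiv f w - fderiv f x) \<le> L * r" using L(1) r by (intro onorm_bound) auto
    next
      show "x \<in> ball x r" using r by simp
    qed
    then show ?thesis by (simp add: mult.commute)
  qed
  with L(1-3) show ?thesis by blast
qed

section \<open>Operator families, product rule and chain rule\<close>

lemma evals_scaled: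
  assumes "\<phi> \<in> \<Phi>" "\<And>x. x \<in> S \<Longrightarrow> linear (\<phi> x)"
  shows "\<exists>f\<in>evals \<Phi>. \<forall>x\<in>S. \<phi> x m = (norm m + 1) *\<^sub>R f x"
proof (intro bexI ballI)
  \<comment> \<open>Adding 1 to the norm spares a separate case for m = 0.\<close>
  have pos: "norm m + 1 > 0" using norm_ge_zero[of m] by linarith
  show "(\<lambda>x. \<phi> x ((1 / (norm m + 1)) *\<^sub>R m)) \<in> evals \<Phi>"
    using assms(1) by (rule evalsI) (use pos in \<open>simp add: divide_simps\<close>)
  fix x assume "x \<in> S"
  then show "\<phi> x m = (norm m + 1) *\<^sub>R \<phi> x ((1 / (norm m + 1)) *\<^sub>R m)"
    using assms(2)[OF \<open>x \<in> S\<close>] pos by (simp add: linear_scale)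
qed

lemma linear_family_differentiable:
  assumes "open S" "C_family (Suc n) S (evals \<Phi>)" "\<phi> \<in> \<Phi>" "\<And>x. x \<in> S \<Longrightarrow> linear (\<phi> x)" "x \<in> S"
  shows "(\<lambda>x. \<phi> x m) differentiable (at x)"
proof -
  obtain f where f: "f \<in> evals \<Phi>" "\<forall>x\<in>S. \<phi> x m = (norm m + 1) *\<^sub>R f x"
    using evals_scaled[of \<phi> \<Phi> S m] assms(3,4) by blast
  have "(\<lambda>x. (norm m + 1) *\<^sub>R f x) differentiable (at x)"
    by (intro differentiable_scaleR differentiable_const C_family_differentiable[OF assms(2) f(1) assms(5)])
  then show ?thesis
    by (rule differentiable_cong_open[OF _ assms(1,5)]) (use f(2) in simp)
qed

lemma linear_fderiv_of_linear:
  fixes \<phi> :: "'a::real_normed_vector \<Rightarrow> 'm::real_normed_vector \<Rightarrow> 'b::real_normed_vector"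
  assumes "open S" "x \<in> S" "\<And>x. x \<in> S \<Longrightarrow> linear (\<phi> x)" and d: "\<And>m. (\<lambda>x. \<phi> x m) differentiable (at x)"
  shows "linear (\<lambda>m. fderiv (\<lambda>x. \<phi> x m) x k)"
proof
  fix a b :: 'm and c :: real
  have "fderiv (\<lambda>x. \<phi> x (a + b)) x = fderiv (\<lambda>x. \<phi> x a + \<phi> x b) x"
    by (rule fderiv_cong_open[OF _ assms(1,2)])
       (simp_all add: linear_add assms(3) differentiable_add d)
  also have "\<dots> = (\<lambda>k. fderiv (\<lambda>x. \<phi> x a) x k + fderiv (\<lambda>x. \<phi> x b) x k)"
    by (intro fderiv_eq has_derivative_add fderiv_works d)
  finally show "fderiv (\<lambda>x. \<phi> x (a + b)) x k = fderiv (\<lambda>x. \<phi> x a) x k + fderiv (\<lambda>x. \<phi> x b) x k"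
    by simp
  have "fderiv (\<lambda>x. \<phi> x (c *\<^sub>R a)) x = fderiv (\<lambda>x. c *\<^sub>R \<phi> x a) x"
    by (rule fderiv_cong_open[OF _ assms(1,2)])
       (simp_all add: linear_scale assms(3) d)
  also have "\<dots> = (\<lambda>k. c *\<^sub>R fderiv (\<lambda>x. \<phi> x a) x k)"
    by (intro fderiv_eq has_derivative_scaleR_right fderiv_works d)
  finally show "fderiv (\<lambda>x. \<phi> x (c *\<^sub>R a)) x k = c *\<^sub>R fderiv (\<lambda>x. \<phi> x a) x k"
    by simp
qed

lemma linear_family_fderiv:
  assumes "open S" "C_family (Suc n) S (evals \<Phi>)" "\<phi> \<in> \<Phi>" "\<And>x. x \<in> S \<Longrightarrow> linear (\<phi> x)" "x \<in> S"
  shows "linear (\<lambda>m. fderiv (\<lambda>x. \<phi> x m) x k)"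
  by (rule linear_fderiv_of_linear[OF assms(1,5,4) linear_family_differentiable[OF assms]])

lemma linear_family_Lipschitz:
  assumes "open S" "C_family (Suc 0) S (evals \<Phi>)" "\<And>\<phi> x. \<phi> \<in> \<Phi> \<Longrightarrow> x \<in> S \<Longrightarrow> linear (\<phi> x)" "x \<in> S"
  shows "\<exists>L>0. \<exists>\<delta>>0. ball x \<delta> \<subseteq> S \<and>
    (\<forall>\<phi>\<in>\<Phi>. \<forall>y\<in>ball x \<delta>. \<forall>z\<in>ball x \<delta>. \<forall>m. norm (\<phi> y m - \<phi> z m) \<le> L * norm (y - z) * norm m)"
proof -
  obtain L \<delta> where L: "L > 0" "\<delta> > 0" "ball x \<delta> \<subseteq> S"
    "\<forall>f\<in>evals \<Phi>. \<forall>y\<in>ball x \<delta>. \<forall>z\<in>ball x \<delta>. norm (f y - f z) \<le> L * norm (y - z)"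
    using C_family_Lipschitz[OF assms(1,2,4)] by blast
  have "norm (\<phi> y m - \<phi> z m) \<le> L * norm (y - z) * norm m"
    if "\<phi> \<in> \<Phi>" "y \<in> ball x \<delta>" "z \<in> ball x \<delta>" for \<phi> y z m
  proof (rule linear_bound_from_unit_ball[where l="\<lambda>m. \<phi> y m - \<phi> z m"])
    have "y \<in> S" "z \<in> S" using that L(3) by auto
    then show "linear (\<lambda>m. \<phi> y m - \<phi> z m)"
      by (intro linear_compose_sub assms(3)[OF that(1)])
    show "norm (\<phi> y h - \<phi> z h) \<le> L * norm (y - z)" if h: "norm h \<le> 1" for h
      by (rule L(4)[rule_format, OF evalsI[OF \<open>\<phi> \<in> \<Phi>\<close> h] \<open>y \<in> ball x \<delta>\<close> \<open>z \<in> ball x \<delta>\<close>])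
  qed
  with L(1-3) show ?thesis by blast
qed

lemma linear_family_bound:
  assumes "locally_bounded S (evals \<Phi>)" "\<And>\<phi> x. \<phi> \<in> \<Phi> \<Longrightarrow> x \<in> S \<Longrightarrow> linear (\<phi> x)" "open S" "x \<in> S"
  shows "\<exists>B>0. \<forall>\<^sub>F y in nhds x. \<forall>\<phi>\<in>\<Phi>. \<forall>m. norm (\<phi> y m) \<le> B * norm m"
proof -
  obtain B where B: "B > 0" "\<forall>\<^sub>F y in nhds x. \<forall>f\<in>evals \<Phi>. norm (f y) \<le> B"
    using assms(1,4) by (rule locally_boundedD)
  have "\<forall>\<^sub>F y in nhds x. y \<in> S" using assms eventually_nhds_in_open by blast
  with B(2) have "\<forall>\<^sub>F y in nhds x. \<forall>\<phi>\<in>\<Phi>. \<forall>m. norm (\<phi> y m) \<le> B * norm m"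
  proof eventually_elim
    case (elim y)
    show ?case
    proof (intro ballI allI)
      fix \<phi> m assume \<phi>: "\<phi> \<in> \<Phi>"
      show "norm (\<phi> y m) \<le> B * norm m"
        using elim evalsI[OF \<phi>] by (intro linear_bound_from_unit_ball assms(2) \<phi>) auto
    qed
  qed
  with B(1) show ?thesis by blast
qed

lemma has_derivative_zero_of_superlinear:
  assumes "\<forall>\<^sub>F y in at x. norm (e y) \<le> norm (y - x) * g y" "(g \<longlongrightarrow> 0) (at x)" "e x = 0"
  shows "(e has_derivative (\<lambda>_. 0)) (at x)"
proof -
  have "((\<lambda>y. norm (e y) / norm (y - x)) \<longlongrightarrow> 0) (at x)"
  proof (rule real_tendsto_sandwich[OF _ _ tendsto_const assms(2)])
    show "\<forall>\<^sub>F y in at x. 0 \<le> norm (e y) / norm (y - x)" by (auto intro: always_eventually)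
    have "\<forall>\<^sub>F y in at x. y \<noteq> x" by (simp add: eventually_at_filter)
    with assms(1) show "\<forall>\<^sub>F y in at x. norm (e y) / norm (y - x) \<le> g y"
      by eventually_elim (simp add: field_simps)
  qed
  then show ?thesis
    by (simp add: has_derivative_iff_norm assms(3))
qed

text \<open>The value at y is the sum of \<open>\<phi> y (r x)\<close>,
  \<open>\<phi> x (r y - r x)\<close> and a mixed term \<open>e y\<close>, in which a Lipschitz
  difference of operators meets an argument that tends to 0. Hence only the first two terms
  contribute to the derivative.\<close>

lemma pairing_has_derivative:
  assumes S: "open S" "x \<in> S" and C: "C_family (Suc 0) S (evals \<Phi>)"
    and \<Phi>: "\<phi> \<in> \<Phi>" "\<And>x. x \<in> S \<Longrightarrow> linear (\<phi> x)"
    and r: "r differentiable (at x)"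
  shows "((\<lambda>y. \<phi> y (r y)) has_derivative
           (\<lambda>k. fderiv (\<lambda>y. \<phi> y (r x)) x k + \<phi> x (fderiv r x k))) (at x)"
proof -
  have C1: "C_family (Suc 0) S (evals {\<phi>})"
  proof (rule C_family_mono[OF S(1) C], rule subsetI)
    fix f assume "f \<in> evals {\<phi>}"
    then obtain \<psi> m where *: "\<psi> \<in> {\<phi>}" "norm m \<le> 1" "f = (\<lambda>x. \<psi> x m)" by (rule evalsE)
    then show "f \<in> evals \<Phi>" using evalsI[OF \<Phi>(1) *(2)] by simp
  qed
  have lin: "\<And>\<psi> x. \<psi> \<in> {\<phi>} \<Longrightarrow> x \<in> S \<Longrightarrow> linear (\<psi> x)" using \<Phi>(2) by simp
  obtain L \<delta> where L: "L > 0" "\<delta> > 0" "ball x \<delta> \<subseteq> S"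
    "\<forall>\<psi>\<in>{\<phi>}. \<forall>y\<in>ball x \<delta>. \<forall>z\<in>ball x \<delta>. \<forall>m. norm (\<psi> y m - \<psi> z m) \<le> L * norm (y - z) * norm m"
    using linear_family_Lipschitz[of S "{\<phi>}" x] S C1 lin by blast
  define e where "e y = \<phi> y (r y - r x) - \<phi> x (r y - r x)" for y
  have ev: "\<forall>\<^sub>F y in nhds x. y \<in> ball x \<delta>" using L(2) by (intro eventually_nhds_in_open) auto
  obtain B where B: "B > 0" "\<forall>\<^sub>F y in nhds x. \<forall>\<psi>\<in>{\<phi>}. \<forall>m. norm (\<psi> y m) \<le> B * norm m"
    using linear_family_bound[of S "{\<phi>}" x] C_family_locally_bounded[OF C1] S lin by blast
  have "\<forall>m. norm (\<phi> x m) \<le> norm m * B"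
    using eventually_nhds_x_imp_x[OF B(2)] by (simp add: mult.commute)
  then have bl: "bounded_linear (\<phi> x)"
    by (intro bounded_linear.intro bounded_linear_axioms.intro \<Phi>(2)[OF S(2)] exI[of _ B])
  have "(e has_derivative (\<lambda>_. 0)) (at x)"
  proof (rule has_derivative_zero_of_superlinear[where g="\<lambda>y. L * norm (r y - r x)"])
    show "\<forall>\<^sub>F y in at x. norm (e y) \<le> norm (y - x) * (L * norm (r y - r x))"
      using ev unfolding eventually_at_filter
    proof eventually_elim
      case (elim y)
      then have "norm (e y) \<le> L * norm (y - x) * norm (r y - r x)"
        using L(2,4) by (simp add: e_def)
      then show ?case by (simp add: mult_ac)
    qed
    have "(r \<longlongrightarrow> r x) (at x)"
      using differentiable_imp_continuous_within[OF r] by (simp add: continuous_within)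
    then show "((\<lambda>y. L * norm (r y - r x)) \<longlongrightarrow> 0) (at x)"
      by (auto intro!: tendsto_eq_intros)
    show "e x = 0" using \<Phi>(2)[OF S(2)] by (simp add: e_def linear_0)
  qed
  moreover have "((\<lambda>y. \<phi> y (r x)) has_derivative fderiv (\<lambda>y. \<phi> y (r x)) x) (at x)"
    by (intro fderiv_works linear_family_differentiable[OF S(1) C \<Phi> S(2)])
  moreover have "((\<lambda>y. \<phi> x (r y - r x)) has_derivative (\<lambda>k. \<phi> x (fderiv r x k - 0))) (at x)"
    by (intro bounded_linear.has_derivative[OF bl] has_derivative_diff fderiv_works[OF r] has_derivative_const)
  ultimately have "((\<lambda>y. \<phi> y (r x) + \<phi> x (r y - r x) + e y) has_derivative
      (\<lambda>k. fderiv (\<lambda>y. \<phi> y (r x)) x k + \<phi> x (fderiv r x k - 0) + 0)) (at x)"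
    by (intro has_derivative_add)
  then have "((\<lambda>y. \<phi> y (r x) + \<phi> x (r y - r x) + e y) has_derivative
      (\<lambda>k. fderiv (\<lambda>y. \<phi> y (r x)) x k + \<phi> x (fderiv r x k))) (at x)"
    by simp
  then show ?thesis
  proof (rule has_derivative_transform_within_open[OF _ S])
    fix y assume "y \<in> S"
    then show "\<phi> y (r x) + \<phi> x (r y - r x) + e y = \<phi> y (r y)"
      using \<Phi>(2) by (simp add: e_def linear_diff)
  qed
qed

definition fderiv_family :: "('a::real_normed_vector \<Rightarrow> 'm::real_normed_vector \<Rightarrow> 'b::real_normed_vector) set \<Rightarrow> ('a \<Rightarrow> 'm \<Rightarrow> 'b) set" where
  "fderiv_family \<Phi> = {\<lambda>x m. fderiv (\<lambda>x. \<phi> x m) x k | \<phi> k. \<phi> \<in> \<Phi> \<and> norm k \<le> 1}"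

text \<open>This identity transfers a hypothesis of order \<open>Suc n\<close> on an operator family
  to order n for the differentiated operators, the shape in which inductions over operator families
  need it.\<close>

lemma evals_fderiv_family: "evals (fderiv_family \<Phi>) = derivs (evals \<Phi>)"
proof
  show "evals (fderiv_family \<Phi>) \<subseteq> derivs (evals \<Phi>)"
  proof
    fix g assume "g \<in> evals (fderiv_family \<Phi>)"
    then obtain \<psi> m where \<psi>: "\<psi> \<in> fderiv_family \<Phi>" "norm m \<le> 1" "g = (\<lambda>x. \<psi> x m)" by (rule evalsE)
    then obtain \<phi> k where *: "\<phi> \<in> \<Phi>" "norm k \<le> 1" "\<psi> = (\<lambda>x m. fderiv (\<lambda>x. \<phi> x m) x k)"
      unfolding fderiv_family_def by blast
    show "g \<in> derivs (evals \<Phi>)"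
      using derivsI[OF evalsI[OF *(1) \<psi>(2)] *(2)] \<psi>(3) *(3) by simp
  qed
  show "derivs (evals \<Phi>) \<subseteq> evals (fderiv_family \<Phi>)"
  proof
    fix g assume "g \<in> derivs (evals \<Phi>)"
    then obtain \<phi> m k where *: "\<phi> \<in> \<Phi>" "norm m \<le> 1" "norm k \<le> 1" "g = (\<lambda>x. fderiv (\<lambda>x. \<phi> x m) x k)"
      by (auto elim!: derivsE evalsE)
    then have "(\<lambda>x m. fderiv (\<lambda>x. \<phi> x m) x k) \<in> fderiv_family \<Phi>"
      by (auto simp: fderiv_family_def)
    from evalsI[OF this *(2)] show "g \<in> evals (fderiv_family \<Phi>)" using * by simp
  qed
qed

lemma fderiv_family_linear:
  assumes "open S" "C_family (Suc n) S (evals \<Phi>)" "\<And>\<phi> x. \<phi> \<in> \<Phi> \<Longrightarrow> x \<in> S \<Longrightarrow> linear (\<phi> x)"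
    "\<phi> \<in> fderiv_family \<Phi>" "x \<in> S"
  shows "linear (\<phi> x)"
proof -
  obtain \<psi> k where *: "\<psi> \<in> \<Phi>" "\<phi> = (\<lambda>x m. fderiv (\<lambda>x. \<psi> x m) x k)"
    using assms(4) unfolding fderiv_family_def by blast
  show ?thesis
    unfolding *(2) by (rule linear_family_fderiv[OF assms(1,2) *(1) _ assms(5)]) (rule assms(3)[OF *(1)])
qed

lemma pairing_memI: "\<phi> \<in> \<Phi> \<Longrightarrow> r \<in> R \<Longrightarrow> (\<lambda>x. \<phi> x (r x)) \<in> {\<lambda>x. \<phi> x (r x) | \<phi> r. \<phi> \<in> \<Phi> \<and> r \<in> R}"
  by blast

lemma sum_memI: "f \<in> F \<Longrightarrow> g \<in> G \<Longrightarrow> (\<lambda>x. f x + g x) \<in> {\<lambda>x. f x + g x | f g. f \<in> F \<and> g \<in> G}"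
  by blast

text \<open>By the product rule a derivative is a sum of two pairings, one with a differentiated
  operator and one with a differentiated argument. Both have the original form, so the induction has
  to vary \<open>\<Phi>\<close> and \<open>R\<close> together.\<close>

lemma C_family_pairing:
  assumes "open S"
  shows "C_family n S (evals \<Phi>) \<Longrightarrow> (\<And>\<phi> x. \<phi> \<in> \<Phi> \<Longrightarrow> x \<in> S \<Longrightarrow> linear (\<phi> x)) \<Longrightarrow> C_family n S R \<Longrightarrow>
    C_family n S {\<lambda>x. \<phi> x (r x) | \<phi> r. \<phi> \<in> \<Phi> \<and> r \<in> R}"
proof (induction n arbitrary: \<Phi> R)
  have lb: "locally_bounded S {\<lambda>x. \<phi> x (r x) | \<phi> r. \<phi> \<in> \<Phi> \<and> r \<in> R}"
    if \<Phi>: "locally_bounded S (evals \<Phi>)" "\<And>\<phi> x. \<phi> \<in> \<Phi> \<Longrightarrow> x \<in> S \<Longrightarrow> linear (\<phi> x)" and R: "locally_bounded S R"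
    for \<Phi> :: "('a \<Rightarrow> 'c \<Rightarrow> 'b) set" and R
    unfolding locally_bounded_def
  proof
    fix x assume x: "x \<in> S"
    have "\<exists>B>0. \<forall>\<^sub>F y in nhds x. \<forall>\<phi>\<in>\<Phi>. \<forall>m. norm (\<phi> y m) \<le> B * norm m"
      by (rule linear_family_bound[OF \<Phi>(1) _ assms x]) (rule \<Phi>(2))
    then obtain B where B: "B > 0" "\<forall>\<^sub>F y in nhds x. \<forall>\<phi>\<in>\<Phi>. \<forall>m. norm (\<phi> y m) \<le> B * norm m"
      by (elim exE conjE) (rule that)
    obtain C where C: "C > 0" "\<forall>\<^sub>F y in nhds x. \<forall>r\<in>R. norm (r y) \<le> C"
      using R x by (rule locally_boundedD)
    have "\<forall>\<^sub>F y in nhds x. \<forall>f\<in>{\<lambda>x. \<phi> x (r x) | \<phi> r. \<phi> \<in> \<Phi> \<and> r \<in> R}. norm (f y) \<le> B * C"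
      using B(2) C(2)
    proof eventually_elim
      case (elim y)
      have "norm (\<phi> y (r y)) \<le> B * C" if "\<phi> \<in> \<Phi>" "r \<in> R" for \<phi> r
      proof -
        have "norm (\<phi> y (r y)) \<le> B * norm (r y)" using elim that by blast
        also have "\<dots> \<le> B * C" using elim that B(1) by (intro mult_left_mono) auto
        finally show ?thesis .
      qed
      then show ?case by auto
    qed
    then show "\<exists>C. \<forall>\<^sub>F y in nhds x. \<forall>f\<in>{\<lambda>x. \<phi> x (r x) | \<phi> r. \<phi> \<in> \<Phi> \<and> r \<in> R}. norm (f y) \<le> C" by blast
  qed
  {
    case 0
    then show ?case using lb[of \<Phi> R] by simp
  next
    case (Suc n)
    let ?F = "{\<lambda>x. \<phi> x (r x) | \<phi> r. \<phi> \<in> \<Phi> \<and> r \<in> R}"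
    note lin = Suc.prems(2)
    have C1: "C_family (Suc 0) S (evals \<Phi>)" by (rule C_family_le[OF Suc.prems(1)]) simp
    have der: "((\<lambda>y. \<phi> y (r y)) has_derivative
           (\<lambda>k. fderiv (\<lambda>y. \<phi> y (r x)) x k + \<phi> x (fderiv r x k))) (at x)"
      if "\<phi> \<in> \<Phi>" "r \<in> R" "x \<in> S" for \<phi> r x
      by (rule pairing_has_derivative[OF assms that(3) C1 that(1) lin[OF that(1)]
            C_family_differentiable[OF Suc.prems(3) that(2,3)]])
    have lin': "linear (\<phi> x)" if "\<phi> \<in> fderiv_family \<Phi>" "x \<in> S" for \<phi> x
      by (rule fderiv_family_linear[OF assms C1 _ that]) (rule lin)
    let ?P = "{\<lambda>x. \<phi> x (r x) | \<phi> r. \<phi> \<in> fderiv_family \<Phi> \<and> r \<in> R}"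
    let ?Q = "{\<lambda>x. \<phi> x (r x) | \<phi> r. \<phi> \<in> \<Phi> \<and> r \<in> derivs R}"
    have "C_family n S (evals (fderiv_family \<Phi>))" using Suc.prems(1) by (simp add: evals_fderiv_family)
    then have "C_family n S ?P"
      by (rule Suc.IH[OF _ _ C_family_SucD[OF Suc.prems(3)]]) (rule lin')
    moreover have "C_family n S (derivs R)" using Suc.prems(3) by simp
    then have "C_family n S ?Q"
      by (rule Suc.IH[OF C_family_SucD[OF Suc.prems(1)], rotated]) (rule lin)
    ultimately have PQ: "C_family n S {\<lambda>x. f x + g x | f g. f \<in> ?P \<and> g \<in> ?Q}"
      by (rule C_family_sum[OF assms])
    have "C_family n S (derivs ?F)"
    proof (rule C_family_cong[OF assms PQ])
      fix g assume "g \<in> derivs ?F"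
      then obtain \<phi> r k where *: "\<phi> \<in> \<Phi>" "r \<in> R" "norm k \<le> 1" "g = (\<lambda>x. fderiv (\<lambda>x. \<phi> x (r x)) x k)"
        by (auto elim!: derivsE)
      have "(\<lambda>x m. fderiv (\<lambda>x. \<phi> x m) x k) \<in> fderiv_family \<Phi>"
        using * by (auto simp: fderiv_family_def)
      from pairing_memI[OF this *(2)]
      have 1: "(\<lambda>x. fderiv (\<lambda>y. \<phi> y (r x)) x k) \<in> ?P" .
      have 2: "(\<lambda>x. \<phi> x (fderiv r x k)) \<in> ?Q" by (rule pairing_memI[OF *(1) derivsI[OF *(2,3)]])
      show "\<exists>f\<in>{\<lambda>x. f x + g x | f g. f \<in> ?P \<and> g \<in> ?Q}. \<forall>x\<in>S. g x = f x"
      proof (rule bexI)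
        show "(\<lambda>x. fderiv (\<lambda>y. \<phi> y (r x)) x k + \<phi> x (fderiv r x k)) \<in> {\<lambda>x. f x + g x | f g. f \<in> ?P \<and> g \<in> ?Q}"
          by (rule sum_memI[OF 1 2])
      qed (simp add: fderiv_eq[OF der[OF *(1,2)]] *(4))
    qed
    moreover have "\<forall>f\<in>?F. \<forall>x\<in>S. f differentiable (at x)"
    proof (intro ballI)
      fix f x assume "f \<in> ?F" and x: "x \<in> S"
      then obtain \<phi> r where *: "\<phi> \<in> \<Phi>" "r \<in> R" "f = (\<lambda>x. \<phi> x (r x))" by auto
      show "f differentiable (at x)" unfolding *(3) by (rule differentiableI[OF der[OF *(1,2) x]])
    qed
    moreover have "locally_bounded S ?F"
      by (rule lb[OF C_family_locally_bounded[OF Suc.prems(1)] _ C_family_locally_bounded[OF Suc.prems(3)]])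
         (rule lin)
    ultimately show ?case by simp
  }
qed

lemma evals_fderiv_compose: "evals {\<lambda>x. fderiv f (\<rho> x) | f. f \<in> F} = {\<lambda>x. f (\<rho> x) | f. f \<in> derivs F}"
  (is "evals ?\<Phi> = _")
proof
  show "{\<lambda>x. f (\<rho> x) | f. f \<in> derivs F} \<subseteq> evals ?\<Phi>"
  proof
    fix g assume "g \<in> {\<lambda>x. f (\<rho> x) | f. f \<in> derivs F}"
    then obtain f h where *: "f \<in> F" "norm h \<le> 1" "g = (\<lambda>x. fderiv f (\<rho> x) h)"
      by (auto elim!: derivsE)
    then have "(\<lambda>x. fderiv f (\<rho> x)) \<in> ?\<Phi>" by blast
    from evalsI[OF this *(2)] show "g \<in> evals ?\<Phi>" using * by simp
  qed
  show "evals ?\<Phi> \<subseteq> {\<lambda>x. f (\<rho> x) | f. f \<in> derivs F}"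
  proof
    fix g assume "g \<in> evals ?\<Phi>"
    then obtain \<psi> m where \<psi>: "\<psi> \<in> ?\<Phi>" "norm m \<le> 1" "g = (\<lambda>x. \<psi> x m)" by (rule evalsE)
    then obtain f where f: "f \<in> F" "\<psi> = (\<lambda>x. fderiv f (\<rho> x))" by auto
    show "g \<in> {\<lambda>x. f (\<rho> x) | f. f \<in> derivs F}"
      unfolding \<psi>(3) f(2) using derivsI[OF f(1) \<psi>(2)]
      by (intro CollectI exI[of _ "\<lambda>x. fderiv f x m"]) simp
  qed
qed

text \<open>The derivative of the composite pairs the operators \<open>fderiv f (\<rho> x)\<close>
  with \<open>fderiv \<rho> x k\<close>; the induction hypothesis for \<open>derivs F\<close>
  supplies the former. Continuity of \<open>\<rho>\<close> is a separate assumption because at order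
  0 a family is merely locally bounded.\<close>

lemma C_family_compose:
  assumes "open U" "open V" "\<And>x. x \<in> U \<Longrightarrow> \<rho> x \<in> V" "continuous_on U \<rho>"
  shows "C_family n V F \<Longrightarrow> C_family n U {\<rho>} \<Longrightarrow> C_family n U {\<lambda>x. f (\<rho> x) | f. f \<in> F}"
proof (induction n arbitrary: F)
  have lb: "locally_bounded U {\<lambda>x. f (\<rho> x) | f. f \<in> F}" if F: "locally_bounded V F" for F :: "('b \<Rightarrow> 'c) set"
    unfolding locally_bounded_def
  proof
    fix x assume x: "x \<in> U"
    obtain C where C: "C > 0" "\<forall>\<^sub>F y in nhds (\<rho> x). \<forall>f\<in>F. norm (f y) \<le> C"
      using F assms(3)[OF x] by (rule locally_boundedD)
    have "continuous (at x) \<rho>"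
      using assms(1,4) x continuous_on_eq_continuous_at by blast
    then have "filterlim \<rho> (nhds (\<rho> x)) (nhds x)"
      by (simp add: continuous_at tendsto_at_iff_tendsto_nhds)
    with C(2) have "\<forall>\<^sub>F y in nhds x. \<forall>f\<in>F. norm (f (\<rho> y)) \<le> C"
      by (rule eventually_compose_filterlim)
    then have "\<forall>\<^sub>F y in nhds x. \<forall>f\<in>{\<lambda>x. f (\<rho> x) | f. f \<in> F}. norm (f y) \<le> C"
      by eventually_elim auto
    then show "\<exists>C. \<forall>\<^sub>F y in nhds x. \<forall>f\<in>{\<lambda>x. f (\<rho> x) | f. f \<in> F}. norm (f y) \<le> C" by blast
  qed
  {
    case 0
    then show ?case using lb by simp
  next
    case (Suc n)
    let ?F = "{\<lambda>x. f (\<rho> x) | f. f \<in> F}"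
    let ?\<Phi> = "{\<lambda>x. fderiv f (\<rho> x) | f. f \<in> F}"
    have der: "((\<lambda>x. f (\<rho> x)) has_derivative (\<lambda>k. fderiv f (\<rho> x) (fderiv \<rho> x k))) (at x)"
      if "f \<in> F" "x \<in> U" for f x
      using that Suc.prems assms(3) by (intro has_derivative_compose[of \<rho> _ x UNIV f] fderiv_works) auto
    have "{\<lambda>x. f (\<rho> x) | f. f \<in> derivs F} = evals ?\<Phi>" by (rule evals_fderiv_compose[symmetric])
    moreover have "C_family n U {\<lambda>x. f (\<rho> x) | f. f \<in> derivs F}"
      using Suc.prems(1) by (intro Suc.IH C_family_SucD[OF Suc.prems(2)]) simp
    ultimately have \<Phi>: "C_family n U (evals ?\<Phi>)" by simp
    have "C_family n U {\<lambda>x. \<phi> x (r x) | \<phi> r. \<phi> \<in> ?\<Phi> \<and> r \<in> derivs {\<rho>}}"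
    proof (rule C_family_pairing[OF assms(1) \<Phi>])
      show "linear (\<phi> x)" if "\<phi> \<in> ?\<Phi>" "x \<in> U" for \<phi> x
        using that Suc.prems(1) assms(3) by (auto intro!: linear_frechet_derivative)
      show "C_family n U (derivs {\<rho>})" using Suc.prems(2) by simp
    qed
    then have "C_family n U (derivs ?F)"
    proof (rule C_family_cong[OF assms(1)])
      fix g assume "g \<in> derivs ?F"
      then obtain f k where *: "f \<in> F" "norm k \<le> 1" "g = (\<lambda>x. fderiv (\<lambda>x. f (\<rho> x)) x k)"
        by (auto elim!: derivsE)
      show "\<exists>f\<in>{\<lambda>x. \<phi> x (r x) | \<phi> r. \<phi> \<in> ?\<Phi> \<and> r \<in> derivs {\<rho>}}. \<forall>x\<in>U. g x = f x"
      proof (rule bexI)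
        have "(\<lambda>x. fderiv f (\<rho> x)) \<in> ?\<Phi>" using * by blast
        moreover have "(\<lambda>x. fderiv \<rho> x k) \<in> derivs {\<rho>}" using * by (intro derivsI) auto
        ultimately show "(\<lambda>x. fderiv f (\<rho> x) (fderiv \<rho> x k)) \<in> {\<lambda>x. \<phi> x (r x) | \<phi> r. \<phi> \<in> ?\<Phi> \<and> r \<in> derivs {\<rho>}}"
          by (rule pairing_memI)
      qed (simp add: fderiv_eq[OF der[OF *(1)]] *)
    qed
    moreover have "\<forall>f\<in>?F. \<forall>x\<in>U. f differentiable (at x)"
    proof (intro ballI)
      fix g x assume "g \<in> ?F" and x: "x \<in> U"
      then obtain f where *: "f \<in> F" "g = (\<lambda>x. f (\<rho> x))" by auto
      show "g differentiable (at x)" unfolding *(2) by (rule differentiableI[OF der[OF *(1) x]])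
    qed
    ultimately show ?case using Suc.prems lb by auto
  }
qed

section \<open>Submersions of Banach spaces\<close>

lemma halving_iteration:
  fixes P :: "'a::banach \<Rightarrow> 'm::real_normed_vector"
  assumes C: "C > 0" and cont: "continuous_on (cball x (2 * C * norm (y - P x))) P"
    and step: "\<And>z. norm (z - x) + 2 * C * norm (y - P z) \<le> 2 * C * norm (y - P x) \<Longrightarrow>
      \<exists>z'. norm (z' - z) \<le> C * norm (y - P z) \<and> norm (y - P z') \<le> norm (y - P z) / 2"
  shows "\<exists>x'. P x' = y \<and> norm (x' - x) \<le> 2 * C * norm (y - P x)"
proof -
  define e where "e = norm (y - P x)"
  \<comment> \<open>The invariant balances path length against residual: a step of length at most C
    times the residual is paid for by halving the residual, which releases 2 * C times half of it.
    The iterates thus stay in the ball on which P is continuous.\<close>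
  define I where "I z \<longleftrightarrow> norm (z - x) + 2 * C * norm (y - P z) \<le> 2 * C * e" for z
  obtain N where N: "\<And>z. I z \<Longrightarrow> norm (N z - z) \<le> C * norm (y - P z) \<and> norm (y - P (N z)) \<le> norm (y - P z) / 2"
    using step unfolding I_def e_def by metis
  define z where "z n = (N ^^ n) x" for n
  have z_Suc: "z (Suc n) = N (z n)" for n by (simp add: z_def)
  have I: "I (z n)" for n
  proof (induction n)
    case 0
    then show ?case by (simp add: z_def I_def e_def)
  next
    case (Suc n)
    have "norm (N (z n) - x) \<le> norm (N (z n) - z n) + norm (z n - x)"
      using norm_triangle_ineq[of "N (z n) - z n" "z n - x"] by simp
    moreover have "2 * C * norm (y - P (N (z n))) \<le> C * norm (y - P (z n))"
      using N[OF Suc] C mult_left_mono[of "norm (y - P (N (z n)))" "norm (y - P (z n)) / 2" "2 * C"] by simp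
    ultimately show ?case
      using N[OF Suc] Suc unfolding I_def z_Suc by linarith
  qed
  have res: "norm (y - P (z n)) \<le> e * (1/2)^n" for n
  proof (induction n)
    case 0
    then show ?case by (simp add: z_def e_def)
  next
    case (Suc n)
    then show ?case using N[OF I[of n]] unfolding z_Suc by simp
  qed
  have "summable (\<lambda>n. z (Suc n) - z n)"
  proof (rule summable_comparison_test')
    show "summable (\<lambda>n. C * e * (1/2::real)^n)"
      by (intro summable_mult summable_geometric) simp
    fix n
    have "norm (z (Suc n) - z n) \<le> C * norm (y - P (z n))"
      using N[OF I[of n]] unfolding z_Suc by simp
    also have "\<dots> \<le> C * (e * (1/2)^n)" using res[of n] C by (intro mult_left_mono) auto
    finally show "norm (z (Suc n) - z n) \<le> C * e * (1/2)^n" by (simp add: mult.assoc)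
  qed
  then have "convergent (\<lambda>n. z n - z 0)"
    unfolding summable_iff_convergent by (simp add: sum_lessThan_telescope)
  then obtain l where "(\<lambda>n. z n - z 0) \<longlonglongrightarrow> l" by (auto simp: convergent_def)
  then have "(\<lambda>n. (z n - z 0) + z 0) \<longlonglongrightarrow> l + z 0" by (intro tendsto_intros)
  then obtain x' where x': "z \<longlonglongrightarrow> x'" by auto
  have z_in: "z n \<in> cball x (2 * C * e)" for n
  proof -
    have "0 \<le> 2 * C * norm (y - P (z n))" using C by simp
    then have "norm (z n - x) \<le> 2 * C * e" using I[of n] unfolding I_def by linarith
    then show ?thesis by (simp add: dist_norm norm_minus_commute)
  qed
  have x'_in: "x' \<in> cball x (2 * C * e)"
    using z_in x' closed_sequentially[OF closed_cball] by blast
  have "(\<lambda>n. P (z n)) \<longlonglongrightarrow> P x'"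
    using continuous_on_tendsto_compose[OF cont x'] x'_in z_in by (simp add: e_def)
  moreover have "(\<lambda>n. P (z n)) \<longlonglongrightarrow> y"
  proof (rule LIM_zero_cancel, rule Lim_null_comparison)
    show "\<forall>\<^sub>F n in sequentially. norm (P (z n) - y) \<le> e * (1/2)^n"
      using res by (intro always_eventually allI) (simp add: norm_minus_commute)
    show "(\<lambda>n. e * (1/2)^n) \<longlonglongrightarrow> 0"
      by (intro tendsto_mult_right_zero LIMSEQ_power_zero) simp
  qed
  ultimately have "P x' = y" by (rule LIMSEQ_unique)
  then show ?thesis using x'_in unfolding e_def by (auto simp: dist_norm norm_minus_commute)
qed

text \<open>Open mapping theorem. Baire's theorem gives a ball inside the closure of the image of
  some ball, hence preimages up to half of the norm, and the iteration makes them exact. The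
  preimage is bounded by a multiple of the norm of m but need not depend linearly on m, so no
  complement of the kernel is involved.\<close>

lemma bounded_right_inverse:
  fixes T :: "'a::banach \<Rightarrow> 'm::banach"
  assumes T: "bounded_linear T" "surj T"
  shows "\<exists>C>0. \<forall>m. \<exists>h. T h = m \<and> norm h \<le> C * norm m"
proof -
  interpret bounded_linear T by fact
  let ?F = "range (\<lambda>n::nat. closure (T ` cball 0 (real n)))"
  have "\<Union>?F = UNIV"
  proof -
    have "y \<in> \<Union>?F" for y
    proof -
      obtain x where x: "y = T x" using T(2) by blast
      obtain n :: nat where "norm x \<le> real n" using real_arch_simple by blast
      then have "y \<in> closure (T ` cball 0 (real n))" using x closure_subset by fastforce
      then show ?thesis by blast
    qed
    then show ?thesis by blast
  qed
  have mc: "Met_TC.mcomplete TYPE('m)"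
    using complete_UNIV by simp
  have "\<exists>n::nat. interior (closure (T ` cball 0 (real n))) \<noteq> {}"
  proof (rule ccontr)
    assume *: "\<nexists>n::nat. interior (closure (T ` cball 0 (real n))) \<noteq> {}"
    have "Met_TC.mtopology interior_of (\<Union>?F) = {}"
    proof (rule Met_TC.metric_Baire_category_alt[OF mc])
      show "countable ?F" by simp
      fix X assume "X \<in> ?F"
      then show "closedin Met_TC.mtopology X \<and> Met_TC.mtopology interior_of X = {}"
        using * by auto
    qed
    then show False unfolding \<open>\<Union>?F = UNIV\<close> by simp
  qed
  then obtain n :: nat where "interior (closure (T ` cball 0 (real n))) \<noteq> {}" ..
  then obtain y0 where "y0 \<in> interior (closure (T ` cball 0 (real n)))" by blast
  then obtain r where r: "r > 0" "cball y0 r \<subseteq> closure (T ` cball 0 (real n))"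
    unfolding mem_interior_cball by blast
  \<comment> \<open>Two points of the ball of radius n differ by at most 2 n; the added 1 keeps C
    positive when n = 0.\<close>
  define C where "C = (2 * real n + 1) / r"
  have C: "C > 0" using r by (simp add: C_def add_pos_nonneg)
  have approx: "\<exists>h. norm h \<le> C * norm m \<and> norm (m - T h) \<le> norm m / 2" for m
  proof (cases "m = 0")
    case True
    then show ?thesis by (intro exI[of _ 0]) (simp add: zero)
  next
    case False
    define k where "k = r / norm m"
    have k: "k > 0" using False r by (simp add: k_def)
    \<comment> \<open>Both y0 and y0 + k m are approximated within \<epsilon>. After division by k =
      r / norm m the total error 2 * \<epsilon> becomes norm m / 2.\<close>
    define \<epsilon> where "\<epsilon> = r / 4"
    have \<epsilon>: "\<epsilon> > 0" using r by (simp add: \<epsilon>_def)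
    have "y0 + k *\<^sub>R m \<in> cball y0 r" using False r by (simp add: k_def dist_norm)
    then have "y0 + k *\<^sub>R m \<in> closure (T ` cball 0 (real n))" using r by blast
    then obtain a where a: "norm a \<le> real n" "norm (T a - (y0 + k *\<^sub>R m)) < \<epsilon>"
      unfolding closure_approachable using \<epsilon> by (fastforce simp: dist_norm)
    have "y0 \<in> closure (T ` cball 0 (real n))" using r by auto
    then obtain b where b: "norm b \<le> real n" "norm (T b - y0) < \<epsilon>"
      unfolding closure_approachable using \<epsilon> by (fastforce simp: dist_norm)
    define h where "h = (1 / k) *\<^sub>R (a - b)"
    have "norm (a - b) \<le> 2 * real n + 1" using a(1) b(1) norm_triangle_ineq4[of a b] by linarith
    then have "norm h \<le> (2 * real n + 1) / k" using k by (simp add: h_def divide_right_mono)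
    also have "\<dots> = C * norm m" by (simp add: C_def k_def)
    finally have 1: "norm h \<le> C * norm m" .
    have "k *\<^sub>R (m - T h) = (T b - y0) - (T a - (y0 + k *\<^sub>R m))"
      using k by (simp add: h_def diff scaleR algebra_simps)
    then have "norm (k *\<^sub>R (m - T h)) \<le> norm (T b - y0) + norm (T a - (y0 + k *\<^sub>R m))"
      using norm_triangle_ineq4 by metis
    then have "k * norm (m - T h) \<le> 2 * \<epsilon>" using a b k by simp
    then have "norm (m - T h) \<le> 2 * \<epsilon> / k" using k by (simp add: field_simps)
    also have "\<dots> = norm m / 2" using r by (simp add: k_def \<epsilon>_def)
    finally show ?thesis using 1 by blast
  qed
  have "\<exists>h. T h = m \<and> norm (h - 0) \<le> 2 * C * norm (m - T 0)" for m
  proof (rule halving_iteration[OF C])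
    show "continuous_on (cball 0 (2 * C * norm (m - T 0))) T"
      using linear_continuous_on[OF T(1)] by blast
    fix z
    obtain h where h: "norm h \<le> C * norm (m - T z)" "norm (m - T z - T h) \<le> norm (m - T z) / 2"
      using approx by blast
    then show "\<exists>z'. norm (z' - z) \<le> C * norm (m - T z) \<and> norm (m - T z') \<le> norm (m - T z) / 2"
      by (intro exI[of _ "z + h"]) (simp add: add diff_diff_add)
  qed
  then show ?thesis using C by (intro exI[of _ "2 * C"]) (simp add: zero)
qed

text \<open>Graves' theorem. The correction h solves the equation linearised at the fixed point x0.
  Strict differentiability there leaves a residual of at most norm h / (2 * C), which is half the
  previous one since norm h is at most C times it. Letting the starting point x vary as well gives a
  linear estimate near x0 and not only openness.\<close>

lemma metric_regularity:
  fixes P :: "'a::banach \<Rightarrow> 'm::banach"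
  assumes "open U" "C_family (Suc (Suc 0)) U {P}" "x0 \<in> U" "surj (fderiv P x0)"
  shows "\<exists>C>0. \<exists>r>0. \<forall>x\<in>ball x0 r. \<forall>y\<in>ball (P x0) r. \<exists>x'\<in>U. P x' = y \<and> norm (x' - x) \<le> C * norm (y - P x)"
proof -
  have diff: "P differentiable (at x)" if "x \<in> U" for x
    using assms(2) that by simp
  note bl = bounded_linear_fderiv[OF diff[OF assms(3)]]
  obtain C where C: "C > 0" "\<forall>m. \<exists>h. fderiv P x0 h = m \<and> norm h \<le> C * norm m"
    using bounded_right_inverse[OF bl assms(4)] by blast
  obtain L \<delta> where L: "L > 0" "\<delta> > 0" "ball x0 \<delta> \<subseteq> U"
    "\<forall>f\<in>{P}. \<forall>r y z. 0 < r \<longrightarrow> r \<le> \<delta> \<longrightarrow> y \<in> ball x0 r \<longrightarrow> z \<in> ball x0 r \<longrightarrow>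
       norm (f y - f z - fderiv f x0 (y - z)) \<le> L * r * norm (y - z)"
    using C_family_strict_derivative[OF assms(1,2,3)] by blast
  define R where "R = min \<delta> (1 / (2 * C * L))"
  have R: "R > 0" "R \<le> \<delta>" "L * R \<le> 1 / (2 * C)"
    using L C by (auto simp: R_def min_def field_simps)
  have est: "norm (P y - P z - fderiv P x0 (y - z)) \<le> norm (y - z) / (2 * C)"
    if "y \<in> ball x0 R" "z \<in> ball x0 R" for y z
  proof -
    have "norm (P y - P z - fderiv P x0 (y - z)) \<le> L * R * norm (y - z)"
      using L(4) R that by blast
    also have "\<dots> \<le> 1 / (2 * C) * norm (y - z)" using R by (intro mult_right_mono) auto
    finally show ?thesis by simp
  qed
  have "isCont P x0" using diff[OF assms(3)] by (rule differentiable_imp_continuous_within)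
  moreover have "R / (8 * C) > 0" using R C by simp
  ultimately obtain d where d: "d > 0" "\<And>x. norm (x - x0) < d \<Longrightarrow> norm (P x - P x0) < R / (8 * C)"
    unfolding continuous_at_eps_delta by (metis dist_norm)
  \<comment> \<open>The choice keeps the initial residual below R / (4 * C). The iteration then
    moves by less than R / 2 from a point within R / 2 of x0, hence stays where \<open>est\<close>
    applies.\<close>
  define r where "r = min d (min (R / 2) (R / (8 * C)))"
  have r: "r > 0" "r \<le> d" "r \<le> R / 2" "r \<le> R / (8 * C)" using d R C by (auto simp: r_def)
  have "\<exists>x'\<in>U. P x' = y \<and> norm (x' - x) \<le> 2 * C * norm (y - P x)"
    if x: "x \<in> ball x0 r" and y: "y \<in> ball (P x0) r" for x y
  proof -
    have xr: "norm (x - x0) < r" using x by (simp add: dist_norm norm_minus_commute)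
    have "norm (y - P x) \<le> norm (y - P x0) + norm (P x - P x0)"
      using norm_triangle_ineq4[of "y - P x0" "P x - P x0"] by simp
    also have "\<dots> < R / (8 * C) + R / (8 * C)"
    proof (rule add_strict_mono)
      show "norm (y - P x0) < R / (8 * C)" using y r by (simp add: dist_norm norm_minus_commute)
      show "norm (P x - P x0) < R / (8 * C)" using xr r by (intro d) simp
    qed
    finally have e: "2 * C * norm (y - P x) < R / 2" using C by (simp add: field_simps)
    have sub: "z \<in> ball x0 R" if "norm (z - x) \<le> 2 * C * norm (y - P x)" for z
    proof -
      have "norm (z - x0) \<le> norm (z - x) + norm (x - x0)"
        using norm_triangle_ineq[of "z - x" "x - x0"] by simp
      then show ?thesis using that e xr r by (simp add: dist_norm norm_minus_commute)
    qed
    have subU: "ball x0 R \<subseteq> U" using L(3) subset_ball[OF R(2), of x0] by blast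
    have "\<exists>x'. P x' = y \<and> norm (x' - x) \<le> 2 * C * norm (y - P x)"
    proof (rule halving_iteration[OF C(1)])
      have "continuous_on U P"
        using diff differentiable_imp_continuous_within continuous_at_imp_continuous_on by blast
      moreover have "cball x (2 * C * norm (y - P x)) \<subseteq> U"
        using sub subU by (auto simp: dist_norm norm_minus_commute)
      ultimately show "continuous_on (cball x (2 * C * norm (y - P x))) P"
        by (rule continuous_on_subset)
      fix z assume z: "norm (z - x) + 2 * C * norm (y - P z) \<le> 2 * C * norm (y - P x)"
      obtain h where h: "fderiv P x0 h = y - P z" "norm h \<le> C * norm (y - P z)"
        using C(2) by blast
      have pos: "0 \<le> C * norm (y - P z)" using C by simp
      have 1: "z \<in> ball x0 R" using pos z by (intro sub) linarith
      have "norm (z + h - x) \<le> norm (z - x) + norm h"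
        using norm_triangle_ineq[of "z - x" h] by (simp add: algebra_simps)
      then have 2: "z + h \<in> ball x0 R" using pos z h(2) by (intro sub) linarith
      have "norm (y - P (z + h)) = norm (P (z + h) - P z - fderiv P x0 (z + h - z))"
        by (simp add: h(1) norm_minus_commute)
      also have "\<dots> \<le> norm h / (2 * C)" using est[OF 2 1] by simp
      also have "\<dots> \<le> norm (y - P z) / 2" using h(2) C(1) by (simp add: field_simps)
      finally show "\<exists>z'. norm (z' - z) \<le> C * norm (y - P z) \<and> norm (y - P z') \<le> norm (y - P z) / 2"
        using h(2) by (intro exI[of _ "z + h"]) simp
    qed
    then show ?thesis using sub subU by blast
  qed
  then show ?thesis using r(1) C(1) by (intro exI[of _ "2 * C"] conjI exI[of _ r] ballI) auto
qed

text \<open>With T and D the derivatives of P and of w composed with P, the derivative of w is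
  forced to be D after a right inverse of T. This is independent of the chosen preimages only if D
  vanishes on the kernel of T, which is shown by moving along the fibre of P, where w after P is
  constant. The estimate for w then follows by testing with preimages of y whose distance from x0 is
  at most C times that of y from P x0.\<close>

lemma differentiable_descent:
  fixes P :: "'a::banach \<Rightarrow> 'm::banach" and w :: "'m \<Rightarrow> 'b::real_normed_vector"
  assumes "open U" "C_family (Suc (Suc 0)) U {P}" "x0 \<in> U" "surj (fderiv P x0)"
    and S: "(\<lambda>x. w (P x)) differentiable (at x0)"
  shows "w differentiable (at (P x0))"
proof -
  define T where "T = fderiv P x0"
  define D where "D = fderiv (\<lambda>x. w (P x)) x0"
  have "P differentiable (at x0)" using assms(2,3) by simp
  then have T: "(P has_derivative T) (at x0)" unfolding T_def by (rule fderiv_works)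
  have D: "((\<lambda>x. w (P x)) has_derivative D) (at x0)" unfolding D_def by (rule fderiv_works[OF S])
  interpret T: bounded_linear T using T by (rule has_derivative_bounded_linear)
  interpret D: bounded_linear D using D by (rule has_derivative_bounded_linear)
  obtain K where K: "K > 0" "\<And>x. norm (D x) \<le> norm x * K" using D.pos_bounded by blast
  obtain C r where C: "C > 0" "r > 0" and
    Cr: "\<forall>x\<in>ball x0 r. \<forall>y\<in>ball (P x0) r. \<exists>x'\<in>U. P x' = y \<and> norm (x' - x) \<le> C * norm (y - P x)"
    using metric_regularity[OF assms(1-4)] by blast
  obtain E where E: "E > 0" "\<forall>m. \<exists>h. T h = m \<and> norm h \<le> E * norm m"
    using bounded_right_inverse[OF T.bounded_linear_axioms] assms(4) unfolding T_def by blast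
  have Talt: "\<exists>d>0. \<forall>y. norm (y - x0) < d \<longrightarrow> norm (P y - P x0 - T (y - x0)) \<le> e * norm (y - x0)"
    if "e > 0" for e using T that unfolding has_derivative_at_alt by blast
  have Dalt: "\<exists>d>0. \<forall>y. norm (y - x0) < d \<longrightarrow> norm (w (P y) - w (P x0) - D (y - x0)) \<le> e * norm (y - x0)"
    if "e > 0" for e using D that unfolding has_derivative_at_alt by blast
  \<comment> \<open>The point x0 + t v is within o(t) of the fibre through x0, and metric regularity
    yields x' on that fibre. Then w (P x') = w (P x0) gives D (x' - x0) = o(t), while x' - x0
    differs from t v by o(t).\<close>
  have ker: "D v = 0" if v: "T v = 0" for v
  proof -
    have bound: "norm (D v) \<le> e * (norm v + C * norm v + K * C * norm v)" if e: "0 < e" "e \<le> 1" for e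
    proof -
      obtain d1 where d1: "d1 > 0" "\<And>y. norm (y - x0) < d1 \<Longrightarrow> norm (P y - P x0 - T (y - x0)) \<le> e * norm (y - x0)"
        using Talt[OF e(1)] by blast
      obtain d2 where d2: "d2 > 0" "\<And>y. norm (y - x0) < d2 \<Longrightarrow> norm (w (P y) - w (P x0) - D (y - x0)) \<le> e * norm (y - x0)"
        using Dalt[OF e(1)] by blast
      define d where "d = min r (min d1 d2)"
      have d: "d > 0" using C d1 d2 by (simp add: d_def)
      \<comment> \<open>This scale puts both x0 + t v and the corrected point x' within d of x0; the
        added 1 allows v = 0.\<close>
      define t where "t = d / (2 * ((1 + C) * norm v + 1))"
      have pos: "(1 + C) * norm v \<ge> 0" using C by simp
      have t: "t > 0" unfolding t_def using d pos by (intro divide_pos_pos) auto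
      have "t * ((1 + C) * norm v) \<le> t * ((1 + C) * norm v + 1)" using t by (intro mult_left_mono) auto
      also have "\<dots> = d / 2" using pos by (simp add: t_def field_simps)
      finally have tv: "t * ((1 + C) * norm v) < d" using d by simp
      have "t * norm v \<le> t * ((1 + C) * norm v)" using t C by (intro mult_left_mono mult_left_le) (auto simp: mult_le_cancel_right1 algebra_simps)
      then have tv1: "t * norm v < d" using tv by simp
      let ?x = "x0 + t *\<^sub>R v"
      have nx: "norm (?x - x0) = t * norm v" using t by simp
      have "?x \<in> ball x0 r" using tv1 t by (simp add: dist_norm d_def)
      moreover have "P x0 \<in> ball (P x0) r" using C by simp
      ultimately obtain x' where x': "P x' = P x0" "norm (x' - ?x) \<le> C * norm (P x0 - P ?x)"
        using Cr by blast
      have "norm (P ?x - P x0 - T (?x - x0)) \<le> e * norm (?x - x0)" using tv1 by (intro d1, unfold nx) (simp add: d_def)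
      then have "norm (P x0 - P ?x) \<le> e * (t * norm v)"
        using nx v t by (simp add: T.scaleR norm_minus_commute)
      then have 1: "norm (x' - ?x) \<le> C * (e * (t * norm v))"
        using x'(2) C(1) by (meson order_trans mult_le_cancel_left_pos)
      also have "\<dots> \<le> C * (1 * (t * norm v))" using C e t by (intro mult_left_mono mult_right_mono) auto
      finally have 2: "norm (x' - ?x) \<le> t * (C * norm v)" by (simp add: mult_ac)
      have "norm (x' - x0) \<le> norm (x' - ?x) + norm (?x - x0)"
        using norm_triangle_ineq[of "x' - ?x" "?x - x0"] by simp
      then have 3: "norm (x' - x0) \<le> t * ((1 + C) * norm v)" using 2 nx t by (simp add: algebra_simps)
      then have "norm (w (P x') - w (P x0) - D (x' - x0)) \<le> e * norm (x' - x0)"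
        using tv by (intro d2) (simp add: d_def)
      then have 4: "norm (D (x' - x0)) \<le> e * (t * ((1 + C) * norm v))"
        using x'(1) 3 e(1) by (smt (verit) diff_self mult_left_mono norm_minus_cancel diff_0)
      have "t *\<^sub>R D v = D (x' - x0) - D (x' - ?x)"
        by (simp add: D.diff D.add D.scaleR)
      then have "t * norm (D v) \<le> norm (D (x' - x0)) + norm (D (x' - ?x))"
        using norm_triangle_ineq4[of "D (x' - x0)" "D (x' - ?x)"] t by (metis norm_scaleR abs_of_pos)
      also have "norm (D (x' - ?x)) \<le> C * (e * (t * norm v)) * K"
        using K(2)[of "x' - ?x"] 1 K(1) by (smt (verit) mult_right_mono)
      finally have "t * norm (D v) \<le> t * (e * (norm v + C * norm v + K * C * norm v))"
        using 4 by (simp add: algebra_simps)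
      then show ?thesis using t by simp
    qed
    show ?thesis
    proof (rule ccontr)
      assume "D v \<noteq> 0"
      define A where "A = norm v + C * norm v + K * C * norm v"
      have A: "A \<ge> 0" unfolding A_def using C K by simp
      define e where "e = min 1 (norm (D v) / (2 * (A + 1)))"
      have "norm (D v) / (2 * (A + 1)) > 0" using \<open>D v \<noteq> 0\<close> A by simp
      then have e: "0 < e" "e \<le> 1" "e \<le> norm (D v) / (2 * (A + 1))" by (auto simp: e_def)
      have "norm (D v) \<le> e * A" using bound[OF e(1,2)] by (simp add: A_def)
      also have "\<dots> \<le> e * (A + 1)" using e by simp
      also have "\<dots> \<le> norm (D v) / 2" using e(3) A by (simp add: field_simps)
      finally show False using \<open>D v \<noteq> 0\<close> by simp
    qed
  qed
  \<comment> \<open>The right inverse \<open>\<sigma>\<close> need not be linear; linearity of L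
    comes from \<open>LT\<close>, that is from L (T h) = D h for every h.\<close>
  obtain \<sigma> where \<sigma>: "\<And>m. T (\<sigma> m) = m" "\<And>m. norm (\<sigma> m) \<le> E * norm m" using E by metis
  have eq: "D a = D b" if "T a = T b" for a b
    using ker[of "a - b"] that by (simp add: T.diff D.diff)
  define L where "L m = D (\<sigma> m)" for m
  have LT: "L (T h) = D h" for h unfolding L_def by (rule eq) (simp add: \<sigma>)
  have Lb: "norm (L m) \<le> norm m * (E * K)" for m
  proof -
    have "norm (L m) \<le> norm (\<sigma> m) * K" unfolding L_def by (rule K)
    also have "\<dots> \<le> E * norm m * K" using \<sigma>(2) K by (intro mult_right_mono) auto
    finally show ?thesis by (simp add: mult_ac)
  qed
  have bl: "bounded_linear L"
  proof
    show "L (a + b) = L a + L b" for a b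
      using LT[of "\<sigma> a + \<sigma> b"] by (simp add: T.add \<sigma> D.add L_def)
    show "L (c *\<^sub>R a) = c *\<^sub>R L a" for c a
      using LT[of "c *\<^sub>R \<sigma> a"] by (simp add: T.scaleR \<sigma> D.scaleR L_def)
    show "\<exists>K. \<forall>x. norm (L x) \<le> norm x * K" using Lb by blast
  qed
  interpret L: bounded_linear L by fact
  have "(w has_derivative L) (at (P x0))"
    unfolding has_derivative_at_alt
  proof (intro conjI bl allI impI)
    fix e :: real assume e: "e > 0"
    \<comment> \<open>The remainders of w after P and of P contribute e' and e' * E * K times norm
      (x' - x0), and norm (x' - x0) is at most C * norm (y - P x0).\<close>
    define e' where "e' = e / (C * (1 + E * K))"
    have pos: "C * (1 + E * K) > 0" using C E K by (simp add: add_pos_pos)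
    have e': "e' > 0" using e pos by (simp add: e'_def)
    obtain d1 where d1: "d1 > 0" "\<And>y. norm (y - x0) < d1 \<Longrightarrow> norm (P y - P x0 - T (y - x0)) \<le> e' * norm (y - x0)"
      using Talt[OF e'] by blast
    obtain d2 where d2: "d2 > 0" "\<And>y. norm (y - x0) < d2 \<Longrightarrow> norm (w (P y) - w (P x0) - D (y - x0)) \<le> e' * norm (y - x0)"
      using Dalt[OF e'] by blast
    define d where "d = min r (min d1 d2 / C)"
    have d: "d > 0" using C d1 d2 by (simp add: d_def)
    show "\<exists>d>0. \<forall>y. norm (y - P x0) < d \<longrightarrow> norm (w y - w (P x0) - L (y - P x0)) \<le> e * norm (y - P x0)"
    proof (intro exI conjI allI impI)
      show "d > 0" by fact
      fix y assume y: "norm (y - P x0) < d"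
      have "y \<in> ball (P x0) r" using y by (simp add: d_def dist_norm norm_minus_commute)
      moreover have "x0 \<in> ball x0 r" using C by simp
      ultimately obtain x' where x': "P x' = y" "norm (x' - x0) \<le> C * norm (y - P x0)"
        using Cr by blast
      have "C * norm (y - P x0) < min d1 d2" using y C by (simp add: d_def field_simps)
      then have n: "norm (x' - x0) < d1" "norm (x' - x0) < d2" using x' by auto
      have "w y - w (P x0) - L (y - P x0) =
          (w (P x') - w (P x0) - D (x' - x0)) - L (P x' - P x0 - T (x' - x0))"
        by (simp add: L.diff L.add LT x'(1) algebra_simps)
      then have "norm (w y - w (P x0) - L (y - P x0)) \<le>
          norm (w (P x') - w (P x0) - D (x' - x0)) + norm (L (P x' - P x0 - T (x' - x0)))"
        using norm_triangle_ineq4 by metis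
      also have "\<dots> \<le> e' * norm (x' - x0) + e' * norm (x' - x0) * (E * K)"
      proof (rule add_mono)
        show "norm (w (P x') - w (P x0) - D (x' - x0)) \<le> e' * norm (x' - x0)" by (rule d2(2)[OF n(2)])
        have "norm (L (P x' - P x0 - T (x' - x0))) \<le> norm (P x' - P x0 - T (x' - x0)) * (E * K)"
          by (rule Lb)
        also have "\<dots> \<le> e' * norm (x' - x0) * (E * K)"
          using d1(2)[OF n(1)] E K by (intro mult_right_mono) auto
        finally show "norm (L (P x' - P x0 - T (x' - x0))) \<le> e' * norm (x' - x0) * (E * K)" .
      qed
      also have "\<dots> = e' * (1 + E * K) * norm (x' - x0)" by (simp add: algebra_simps)
      also have "\<dots> \<le> e' * (1 + E * K) * (C * norm (y - P x0))"
        using x'(2) e' E K by (intro mult_left_mono) (auto simp: add_nonneg_nonneg)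
      also have "\<dots> = e' * (C * (1 + E * K)) * norm (y - P x0)" by (simp only: mult_ac)
      also have "e' * (C * (1 + E * K)) = e" unfolding e'_def using pos by (intro nonzero_eq_divide_eq[THEN iffD1]) auto
      finally show "norm (w y - w (P x0) - L (y - P x0)) \<le> e * norm (y - P x0)" .
    qed
  qed
  then show ?thesis by (rule differentiableI)
qed

section \<open>Division of operator families by surjections\<close>

lemma derivs_singleton: "derivs {f} = evals {fderiv f}"
  by (simp add: derivs_def)

text \<open>The known quantity in a division: \<open>\<Phi>\<close> consists of the operators to be
  recovered from their products with the surjections \<open>fderiv P x\<close>.\<close>

definition precompose_fderiv :: "('a::real_normed_vector \<Rightarrow> 'm::real_normed_vector) \<Rightarrow> ('a \<Rightarrow> 'm \<Rightarrow> 'b) set \<Rightarrow> ('a \<Rightarrow> 'a \<Rightarrow> 'b) set" where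
  "precompose_fderiv P \<Phi> = (\<lambda>\<phi> x h. \<phi> x (fderiv P x h)) ` \<Phi>"

text \<open>A preimage of q under the derivative at x0 is bounded by C * norm q with C independent
  of y, and for y near x0 the derivative at y maps it to within norm q / 2 of q. Hence the operator
  norm K of \<open>\<phi> y\<close> satisfies K \<le> B * C + K / 2, which bounds K.\<close>

lemma division_locally_bounded:
  fixes P :: "'a::banach \<Rightarrow> 'm::banach"
  assumes "open U" "C_family (Suc (Suc 0)) U {P}" "\<And>x. x \<in> U \<Longrightarrow> surj (fderiv P x)"
    and lin: "\<And>\<phi> x. \<phi> \<in> \<Phi> \<Longrightarrow> x \<in> U \<Longrightarrow> linear (\<phi> x)"
    and Q: "locally_bounded U (evals (precompose_fderiv P \<Phi>))"
  shows "locally_bounded U (evals \<Phi>)"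
  unfolding locally_bounded_def
proof
  fix x0 assume x0: "x0 \<in> U"
  have diff: "P differentiable (at x)" if "x \<in> U" for x using assms(2) that by simp
  have bl: "bounded_linear (fderiv P x)" if "x \<in> U" for x by (rule bounded_linear_fderiv[OF diff[OF that]])
  have linP: "linear (fderiv P x)" if "x \<in> U" for x using bl[OF that] bounded_linear.linear by blast
  have linQ: "linear (\<psi> x)" if \<psi>: "\<psi> \<in> precompose_fderiv P \<Phi>" and x: "x \<in> U" for \<psi> x
  proof -
    obtain \<phi> where \<phi>: "\<phi> \<in> \<Phi>" "\<psi> = (\<lambda>x h. \<phi> x (fderiv P x h))"
      using \<psi> unfolding precompose_fderiv_def by blast
    show ?thesis
      unfolding \<phi>(2) using linear_compose[OF linP[OF x] lin[OF \<phi>(1) x]] by (simp add: o_def)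
  qed
  obtain C where C: "C > 0" "\<forall>m. \<exists>h. fderiv P x0 h = m \<and> norm h \<le> C * norm m"
    using bounded_right_inverse[OF bl[OF x0] assms(3)[OF x0]] by blast
  have "\<exists>B>0. \<forall>\<^sub>F y in nhds x0. \<forall>\<psi>\<in>precompose_fderiv P \<Phi>. \<forall>m. norm (\<psi> y m) \<le> B * norm m"
    by (rule linear_family_bound[OF Q _ assms(1) x0]) (rule linQ)
  then obtain B where B: "B > 0" "\<forall>\<^sub>F y in nhds x0. \<forall>\<psi>\<in>precompose_fderiv P \<Phi>. \<forall>m. norm (\<psi> y m) \<le> B * norm m"
    by blast
  have "C_family (Suc 0) U (evals {fderiv P})" using assms(2) by (simp add: derivs_singleton)
  then have "\<exists>L>0. \<exists>\<delta>>0. ball x0 \<delta> \<subseteq> U \<and>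
    (\<forall>\<phi>\<in>{fderiv P}. \<forall>y\<in>ball x0 \<delta>. \<forall>z\<in>ball x0 \<delta>. \<forall>m. norm (\<phi> y m - \<phi> z m) \<le> L * norm (y - z) * norm m)"
    by (rule linear_family_Lipschitz[OF assms(1) _ _ x0]) (simp add: linP)
  then obtain L \<delta> where L: "L > 0" "\<delta> > 0" "ball x0 \<delta> \<subseteq> U"
    "\<forall>y\<in>ball x0 \<delta>. \<forall>z\<in>ball x0 \<delta>. \<forall>m. norm (fderiv P y m - fderiv P z m) \<le> L * norm (y - z) * norm m"
    by auto
  define \<rho> where "\<rho> = min \<delta> (1 / (2 * C * L))"
  have \<rho>: "\<rho> > 0" "\<rho> \<le> \<delta>" "L * \<rho> \<le> 1 / (2 * C)" using L C by (auto simp: \<rho>_def min_def field_simps)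
  have "\<forall>\<^sub>F y in nhds x0. y \<in> ball x0 \<rho>" using \<rho> by (intro eventually_nhds_in_open) auto
  with B(2) have "\<forall>\<^sub>F y in nhds x0. \<forall>f\<in>evals \<Phi>. norm (f y) \<le> 2 * B * C"
  proof eventually_elim
    case (elim y)
    have yU: "y \<in> U" using elim(2) L(3) \<rho>(2) by (auto simp: subset_iff)
    have y\<delta>: "y \<in> ball x0 \<delta>" using elim(2) \<rho>(2) by simp
    show ?case
    proof
      fix f assume "f \<in> evals \<Phi>"
      then obtain \<phi> m where *: "\<phi> \<in> \<Phi>" "norm m \<le> 1" "f = (\<lambda>x. \<phi> x m)" by (rule evalsE)
      have B': "norm (\<phi> y (fderiv P y h)) \<le> B * norm h" for h
        using elim(1) *(1) unfolding precompose_fderiv_def by fast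
      \<comment> \<open>The constant C' depends on y. It makes the operator norm of
        \<open>\<phi> y\<close> finite, without which K / 2 could not be absorbed.\<close>
      obtain C' where C': "C' > 0" "\<forall>m. \<exists>h. fderiv P y h = m \<and> norm h \<le> C' * norm m"
        using bounded_right_inverse[OF bl[OF yU] assms(3)[OF yU]] by blast
      note l = lin[OF *(1) yU]
      have bl\<phi>: "bounded_linear (\<phi> y)"
      proof (intro bounded_linear.intro bounded_linear_axioms.intro l exI allI)
        fix q
        obtain h where h: "fderiv P y h = q" "norm h \<le> C' * norm q" using C' by blast
        have "norm (\<phi> y q) \<le> B * norm h" using B'[of h] h(1) by simp
        also have "\<dots> \<le> B * (C' * norm q)" using h(2) B(1) by (intro mult_left_mono) auto
        finally show "norm (\<phi> y q) \<le> norm q * (B * C')" by (simp add: mult_ac)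
      qed
      define K where "K = onorm (\<phi> y)"
      have K: "K \<ge> 0" unfolding K_def by (rule onorm_pos_le[OF bl\<phi>])
      have "norm (\<phi> y q) \<le> (B * C + K / 2) * norm q" for q
      proof -
        obtain h where h: "fderiv P x0 h = q" "norm h \<le> C * norm q" using C by blast
        have "norm (fderiv P y h - q) \<le> L * norm (y - x0) * norm h"
          using L(4)[rule_format, OF y\<delta>, of x0 h] L(2) h(1) by simp
        also have "\<dots> \<le> 1 / (2 * C) * (C * norm q)"
        proof (rule mult_mono[OF _ h(2)])
          have "L * norm (y - x0) \<le> L * \<rho>" using elim(2) L(1) by (simp add: dist_norm norm_minus_commute)
          then show "L * norm (y - x0) \<le> 1 / (2 * C)" using \<rho>(3) by simp
        qed (use C in auto)
        finally have 1: "norm (fderiv P y h - q) \<le> norm q / 2" using C by simp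
        have "\<phi> y q = \<phi> y (fderiv P y h) - \<phi> y (fderiv P y h - q)"
          by (simp add: linear_diff[OF l])
        then have "norm (\<phi> y q) \<le> norm (\<phi> y (fderiv P y h)) + norm (\<phi> y (fderiv P y h - q))"
          using norm_triangle_ineq4 by metis
        also have "\<dots> \<le> B * (C * norm q) + K * (norm q / 2)"
        proof (rule add_mono)
          show "norm (\<phi> y (fderiv P y h)) \<le> B * (C * norm q)"
            using B'[of h] mult_left_mono[OF h(2), of B] B(1) by linarith
          have "norm (\<phi> y (fderiv P y h - q)) \<le> K * norm (fderiv P y h - q)"
            unfolding K_def by (rule onorm[OF bl\<phi>])
          also have "\<dots> \<le> K * (norm q / 2)" using 1 K by (rule mult_left_mono)
          finally show "norm (\<phi> y (fderiv P y h - q)) \<le> K * (norm q / 2)" .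
        qed
        finally show ?thesis by (simp add: algebra_simps)
      qed
      then have "K \<le> B * C + K / 2"
        unfolding K_def using B(1) C(1) K by (intro onorm_bound) (auto simp: K_def)
      then have "K \<le> 2 * B * C" by simp
      moreover have "norm (\<phi> y m) \<le> K * norm m" unfolding K_def by (rule onorm[OF bl\<phi>])
      moreover have "K * norm m \<le> K" using K *(2) by (simp add: mult_left_le)
      ultimately show "norm (f y) \<le> 2 * B * C" unfolding *(3) by linarith
    qed
  qed
  then show "\<exists>C. \<forall>\<^sub>F y in nhds x0. \<forall>f\<in>evals \<Phi>. norm (f y) \<le> C" ..
qed

text \<open>Put p x = \<open>fderiv P x h\<close>. The vector p x0 stays fixed while
  \<open>\<phi> x\<close> is known on p x, so \<open>\<phi> x (p x0)\<close> is rewritten as the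
  known \<open>\<phi> x (p x)\<close> minus \<open>\<phi> x0 (p x - p x0)\<close> plus an error e x.
  The error applies the difference of \<open>\<phi> x0\<close> and \<open>\<phi> x\<close> to p x -
  p x0 and is negligible once \<phi> is Lipschitz at x0.\<close>

lemma division_has_derivative:
  fixes P :: "'a::banach \<Rightarrow> 'm::banach"
  assumes U: "open U" "x0 \<in> U" and P: "C_family (Suc (Suc 0)) U {P}" and surj: "\<And>x. x \<in> U \<Longrightarrow> surj (fderiv P x)"
    and lin: "\<And>x. x \<in> U \<Longrightarrow> linear (\<phi> x)"
    and Q: "C_family (Suc 0) U (evals (precompose_fderiv P {\<phi>}))"
  shows "((\<lambda>x. \<phi> x (fderiv P x0 h)) has_derivative
    (\<lambda>k. fderiv (\<lambda>x. \<phi> x (fderiv P x h)) x0 k - \<phi> x0 (fderiv (\<lambda>x. fderiv P x h) x0 k))) (at x0)"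
proof -
  have diff: "P differentiable (at x)" if "x \<in> U" for x using P that by simp
  have bl: "bounded_linear (fderiv P x)" if "x \<in> U" for x by (rule bounded_linear_fderiv[OF diff[OF that]])
  have linP: "linear (fderiv P x)" if "x \<in> U" for x using bl[OF that] bounded_linear.linear by blast
  have lin1: "linear (\<psi> x)" if "\<psi> \<in> {\<phi>}" "x \<in> U" for \<psi> x using that lin by simp
  have lb: "locally_bounded U (evals {\<phi>})"
    by (rule division_locally_bounded[OF U(1) P surj _ C_family_locally_bounded[OF Q]])
       (assumption | rule lin1)+
  define \<psi> where "\<psi> x h = \<phi> x (fderiv P x h)" for x h
  have Q\<psi>: "precompose_fderiv P {\<phi>} = {\<psi>}" by (simp add: precompose_fderiv_def \<psi>_def[abs_def])
  have lin\<psi>: "linear (\<psi> x)" if "x \<in> U" for x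
    unfolding \<psi>_def using linear_compose[OF linP[OF that] lin[OF that]] by (simp add: o_def)
  have CP: "C_family (Suc 0) U (evals {fderiv P})" using P by (simp add: derivs_singleton)
  have C\<psi>: "C_family (Suc 0) U (evals {\<psi>})" using Q unfolding Q\<psi> .
  obtain C where C: "C > 0" "\<forall>m. \<exists>h. fderiv P x0 h = m \<and> norm h \<le> C * norm m"
    using bounded_right_inverse[OF bl[OF U(2)] surj[OF U(2)]] by blast
  have "\<exists>B>0. \<forall>\<^sub>F y in nhds x0. \<forall>\<psi>\<in>{\<phi>}. \<forall>m. norm (\<psi> y m) \<le> B * norm m"
    by (rule linear_family_bound[OF lb _ U]) (rule lin1)
  then obtain B where B: "B > 0" "\<forall>\<^sub>F y in nhds x0. \<forall>m. norm (\<phi> y m) \<le> B * norm m"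
    by auto
  have "\<exists>L>0. \<exists>\<delta>>0. ball x0 \<delta> \<subseteq> U \<and>
    (\<forall>\<phi>\<in>{fderiv P}. \<forall>y\<in>ball x0 \<delta>. \<forall>z\<in>ball x0 \<delta>. \<forall>m. norm (\<phi> y m - \<phi> z m) \<le> L * norm (y - z) * norm m)"
    by (rule linear_family_Lipschitz[OF U(1) CP _ U(2)]) (simp add: linP)
  then obtain L \<delta> where L: "L > 0" "\<delta> > 0" "ball x0 \<delta> \<subseteq> U"
    "\<forall>y\<in>ball x0 \<delta>. \<forall>z\<in>ball x0 \<delta>. \<forall>m. norm (fderiv P y m - fderiv P z m) \<le> L * norm (y - z) * norm m"
    by auto
  have "\<exists>L>0. \<exists>\<delta>>0. ball x0 \<delta> \<subseteq> U \<and>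
    (\<forall>\<phi>\<in>{\<psi>}. \<forall>y\<in>ball x0 \<delta>. \<forall>z\<in>ball x0 \<delta>. \<forall>m. norm (\<phi> y m - \<phi> z m) \<le> L * norm (y - z) * norm m)"
    by (rule linear_family_Lipschitz[OF U(1) C\<psi> _ U(2)]) (simp add: lin\<psi>)
  then obtain M \<eta> where M: "M > 0" "\<eta> > 0" "ball x0 \<eta> \<subseteq> U"
    "\<forall>y\<in>ball x0 \<eta>. \<forall>z\<in>ball x0 \<eta>. \<forall>m. norm (\<psi> y m - \<psi> z m) \<le> M * norm (y - z) * norm m"
    by auto
  define p where "p x = fderiv P x h" for x
  define e where "e x = \<phi> x0 (p x - p x0) - \<phi> x (p x - p x0)" for x
  define A where "A = (M + B * L) * C"
  have p: "p differentiable (at x0)"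
    unfolding p_def by (rule linear_family_differentiable[OF U(1) CP _ _ U(2)]) (auto simp: linP)
  have "\<forall>\<^sub>F y in nhds x0. y \<in> ball x0 \<delta>" "\<forall>\<^sub>F y in nhds x0. y \<in> ball x0 \<eta>"
    using L M by (intro eventually_nhds_in_open; simp)+
  with B(2) have ev: "\<forall>\<^sub>F y in nhds x0. norm (e y) \<le> norm (y - x0) * (A * norm (p y - p x0))"
  proof eventually_elim
    case (elim y)
    have yU: "y \<in> U" using elim(2) L(3) by blast
    define q where "q = p y - p x0"
    obtain h' where h': "fderiv P x0 h' = q" "norm h' \<le> C * norm q" using C by blast
    \<comment> \<open>Writing q as the derivative of P at x0 applied to h' turns the difference of
      \<phi> into differences of \<psi> and of the derivative of P. Both are Lipschitz, so \<phi> is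
      Lipschitz at x0 before anything is known about its differentiability.\<close>
    have "\<phi> x0 q - \<phi> y q = \<phi> y (fderiv P y h' - fderiv P x0 h') - (\<psi> y h' - \<psi> x0 h')"
      by (simp add: linear_diff[OF lin[OF yU]] \<psi>_def h'(1))
    then have "norm (\<phi> x0 q - \<phi> y q) \<le> norm (\<phi> y (fderiv P y h' - fderiv P x0 h')) + norm (\<psi> y h' - \<psi> x0 h')"
      using norm_triangle_ineq4 by metis
    also have "\<dots> \<le> B * (L * norm (y - x0) * norm h') + M * norm (y - x0) * norm h'"
    proof (rule add_mono)
      have "norm (\<phi> y (fderiv P y h' - fderiv P x0 h')) \<le> B * norm (fderiv P y h' - fderiv P x0 h')"
        using elim(1) by blast
      also have "\<dots> \<le> B * (L * norm (y - x0) * norm h')"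
        using L(4)[rule_format, OF elim(2), of x0 h'] L(2) B(1) by (intro mult_left_mono) auto
      finally show "norm (\<phi> y (fderiv P y h' - fderiv P x0 h')) \<le> B * (L * norm (y - x0) * norm h')" .
      show "norm (\<psi> y h' - \<psi> x0 h') \<le> M * norm (y - x0) * norm h'"
        using M(4)[rule_format, OF elim(3), of x0 h'] M(2) by simp
    qed
    also have "\<dots> = (M + B * L) * norm (y - x0) * norm h'" by (simp add: algebra_simps)
    also have "\<dots> \<le> (M + B * L) * norm (y - x0) * (C * norm q)"
      using h'(2) M(1) B(1) L(1) by (intro mult_left_mono mult_nonneg_nonneg add_nonneg_nonneg) auto
    finally show ?case by (simp add: e_def q_def A_def mult_ac)
  qed
  have "(e has_derivative (\<lambda>_. 0)) (at x0)"
  proof (rule has_derivative_zero_of_superlinear[where g="\<lambda>y. A * norm (p y - p x0)"])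
    show "\<forall>\<^sub>F y in at x0. norm (e y) \<le> norm (y - x0) * (A * norm (p y - p x0))"
      using ev unfolding eventually_at_filter by eventually_elim simp
    have "(p \<longlongrightarrow> p x0) (at x0)"
      using differentiable_imp_continuous_within[OF p] by (simp add: continuous_within)
    then show "((\<lambda>y. A * norm (p y - p x0)) \<longlongrightarrow> 0) (at x0)"
      by (auto intro!: tendsto_eq_intros)
    show "e x0 = 0" by (simp add: e_def)
  qed
  moreover have "((\<lambda>x. \<psi> x h) has_derivative fderiv (\<lambda>x. \<psi> x h) x0) (at x0)"
    by (intro fderiv_works linear_family_differentiable[OF U(1) C\<psi> _ _ U(2)]) (auto simp: lin\<psi>)
  moreover have "((\<lambda>x. \<phi> x0 (p x)) has_derivative (\<lambda>k. \<phi> x0 (fderiv p x0 k))) (at x0)"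
  proof (rule bounded_linear.has_derivative[OF _ fderiv_works[OF p]])
    have "\<forall>m. norm (\<phi> x0 m) \<le> norm m * B"
      using eventually_nhds_x_imp_x[OF B(2)] by (simp add: mult.commute)
    then show "bounded_linear (\<phi> x0)"
      by (intro bounded_linear.intro bounded_linear_axioms.intro lin[OF U(2)] exI[of _ B])
  qed
  ultimately have "((\<lambda>x. \<psi> x h - \<phi> x0 (p x) + e x + \<phi> x0 (p x0)) has_derivative
      (\<lambda>k. fderiv (\<lambda>x. \<psi> x h) x0 k - \<phi> x0 (fderiv p x0 k) + 0 + 0)) (at x0)"
    by (intro has_derivative_add has_derivative_diff has_derivative_const)
  then have "((\<lambda>x. \<psi> x h - \<phi> x0 (p x) + e x + \<phi> x0 (p x0)) has_derivative
      (\<lambda>k. fderiv (\<lambda>x. \<psi> x h) x0 k - \<phi> x0 (fderiv p x0 k))) (at x0)"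
    by simp
  then have "((\<lambda>x. \<phi> x (p x0)) has_derivative
      (\<lambda>k. fderiv (\<lambda>x. \<psi> x h) x0 k - \<phi> x0 (fderiv p x0 k))) (at x0)"
  proof (rule has_derivative_transform_within_open[OF _ U])
    fix x assume "x \<in> U"
    then show "\<psi> x h - \<phi> x0 (p x) + e x + \<phi> x0 (p x0) = \<phi> x (p x0)"
      by (simp add: e_def \<psi>_def p_def linear_diff[OF lin] U(2))
  qed
  then show ?thesis unfolding p_def \<psi>_def .
qed

text \<open>The formula of \<open>division_has_derivative\<close> exhibits the products of the
  differentiated operators with \<open>fderiv P x\<close> as known derivatives minus pairings of
  \<open>\<Phi>\<close> with second derivatives of P. The latter contain \<open>\<Phi>\<close>
  undifferentiated, hence at order n by the induction hypothesis, which is then applied a second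
  time, to \<open>fderiv_family \<Phi>\<close>.\<close>

lemma C_family_division:
  fixes P :: "'a::banach \<Rightarrow> 'm::banach" and \<Phi> :: "('a \<Rightarrow> 'm \<Rightarrow> 'b::real_normed_vector) set"
  assumes U: "open U" and P: "\<And>n. C_family n U {P}" and surj: "\<And>x. x \<in> U \<Longrightarrow> surj (fderiv P x)"
  shows "(\<And>\<phi> x. \<phi> \<in> \<Phi> \<Longrightarrow> x \<in> U \<Longrightarrow> linear (\<phi> x)) \<Longrightarrow>
    C_family n U (evals (precompose_fderiv P \<Phi>)) \<Longrightarrow> C_family n U (evals \<Phi>)"
proof (induction n arbitrary: \<Phi>)
  case 0
  have "locally_bounded U (evals \<Phi>)"
    by (rule division_locally_bounded[OF U P surj]) (use 0 in auto)
  then show ?case by simp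
next
  case (Suc n)
  note lin = Suc.prems(1)
  have E: "C_family n U (evals \<Phi>)"
    by (rule Suc.IH[OF _ C_family_SucD[OF Suc.prems(2)]]) (rule lin)
  have Q1: "C_family (Suc 0) U (evals (precompose_fderiv P {\<phi>}))" if "\<phi> \<in> \<Phi>" for \<phi>
  proof (rule C_family_mono[OF U C_family_le[OF Suc.prems(2)]])
    show "evals (precompose_fderiv P {\<phi>}) \<subseteq> evals (precompose_fderiv P \<Phi>)"
    proof
      fix f assume "f \<in> evals (precompose_fderiv P {\<phi>})"
      then obtain \<psi> m where *: "\<psi> \<in> precompose_fderiv P {\<phi>}" "norm m \<le> 1" "f = (\<lambda>x. \<psi> x m)"
        by (rule evalsE)
      have "\<psi> \<in> precompose_fderiv P \<Phi>" using *(1) that unfolding precompose_fderiv_def by blast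
      from evalsI[OF this *(2)] show "f \<in> evals (precompose_fderiv P \<Phi>)" unfolding *(3) .
    qed
  qed simp
  have der: "((\<lambda>x. \<phi> x (fderiv P x0 h)) has_derivative
    (\<lambda>k. fderiv (\<lambda>x. \<phi> x (fderiv P x h)) x0 k - \<phi> x0 (fderiv (\<lambda>x. fderiv P x h) x0 k))) (at x0)"
    if \<phi>: "\<phi> \<in> \<Phi>" and x0: "x0 \<in> U" for \<phi> x0 h
    by (rule division_has_derivative[OF U x0 P surj lin[OF \<phi>] Q1[OF \<phi>]])
  have diff: "(\<lambda>x. \<phi> x m) differentiable (at x0)" if \<phi>: "\<phi> \<in> \<Phi>" and x0: "x0 \<in> U" for \<phi> x0 m
  proof -
    \<comment> \<open>The preimage h is taken at x0 alone: the vector m is constant, and only its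
      representation uses the base point.\<close>
    obtain h where h: "m = fderiv P x0 h" using surj[OF x0] by (rule surjE)
    show ?thesis unfolding h by (rule differentiableI[OF der[OF \<phi> x0]])
  qed
  have lin': "linear (\<phi>' x)" if \<phi>': "\<phi>' \<in> fderiv_family \<Phi>" and x: "x \<in> U" for \<phi>' x
  proof -
    obtain \<phi> k where *: "\<phi> \<in> \<Phi>" "\<phi>' = (\<lambda>x m. fderiv (\<lambda>x. \<phi> x m) x k)"
      using \<phi>' unfolding fderiv_family_def by blast
    show ?thesis unfolding *(2)
      by (rule linear_fderiv_of_linear[OF U x lin[OF *(1)] diff[OF *(1) x]])
  qed
  let ?G = "{\<lambda>x. \<phi> x (r x) | \<phi> r. \<phi> \<in> \<Phi> \<and> r \<in> derivs (derivs {P})}"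
  let ?H = "{\<lambda>x. l (f x) | l f. l \<in> {uminus} \<and> f \<in> ?G}"
  have "C_family n U ?G"
  proof (rule C_family_pairing[OF U E])
    show "C_family n U (derivs (derivs {P}))" using P[of "Suc (Suc n)"] by simp
  qed (rule lin)
  then have "C_family n U ?H"
    by (rule C_family_linear[OF U, rotated 2, where B=1]) (auto simp: linear_uminus)
  moreover have "C_family n U (derivs (evals (precompose_fderiv P \<Phi>)))" using Suc.prems(2) by simp
  ultimately have S: "C_family n U {\<lambda>x. f x + g x | f g. f \<in> derivs (evals (precompose_fderiv P \<Phi>)) \<and> g \<in> ?H}"
    using C_family_sum[OF U] by blast
  have "C_family n U (evals (fderiv_family \<Phi>))"
  proof (rule Suc.IH)
    show "C_family n U (evals (precompose_fderiv P (fderiv_family \<Phi>)))"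
    proof (rule C_family_cong[OF U S])
      fix g assume "g \<in> evals (precompose_fderiv P (fderiv_family \<Phi>))"
      then obtain \<psi> h where 1: "\<psi> \<in> precompose_fderiv P (fderiv_family \<Phi>)" "norm h \<le> 1" "g = (\<lambda>x. \<psi> x h)"
        by (rule evalsE)
      then obtain \<phi>' where 2: "\<phi>' \<in> fderiv_family \<Phi>" "\<psi> = (\<lambda>x h. \<phi>' x (fderiv P x h))"
        unfolding precompose_fderiv_def by blast
      then obtain \<phi> k where 3: "\<phi> \<in> \<Phi>" "norm k \<le> 1" "\<phi>' = (\<lambda>x m. fderiv (\<lambda>x. \<phi> x m) x k)"
        unfolding fderiv_family_def by blast
      have g: "g = (\<lambda>x. fderiv (\<lambda>y. \<phi> y (fderiv P x h)) x k)" unfolding 1(3) 2(2) 3(3) ..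
      let ?a = "\<lambda>x. fderiv (\<lambda>x. \<phi> x (fderiv P x h)) x k"
      let ?b = "\<lambda>x. \<phi> x (fderiv (\<lambda>x. fderiv P x h) x k)"
      have "(\<lambda>x h. \<phi> x (fderiv P x h)) \<in> precompose_fderiv P \<Phi>"
        unfolding precompose_fderiv_def using 3(1) by blast
      from derivsI[OF evalsI[OF this 1(2)] 3(2)]
      have a: "?a \<in> derivs (evals (precompose_fderiv P \<Phi>))" .
      have "?b \<in> ?G"
        by (rule pairing_memI[OF 3(1) derivsI[OF derivsI[OF _ 1(2)] 3(2)]]) simp
      then have b: "(\<lambda>x. - ?b x) \<in> ?H" by (intro CollectI exI[of _ uminus] exI[of _ ?b]) simp
      show "\<exists>f\<in>{\<lambda>x. f x + g x | f g. f \<in> derivs (evals (precompose_fderiv P \<Phi>)) \<and> g \<in> ?H}. \<forall>x\<in>U. g x = f x"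
      proof (rule bexI[OF _ sum_memI[OF a b]], rule ballI)
        fix x assume x: "x \<in> U"
        show "g x = ?a x + - ?b x" unfolding g fderiv_eq[OF der[OF 3(1) x]] by simp
      qed
    qed
  qed (rule lin')
  moreover have "\<forall>f\<in>evals \<Phi>. \<forall>x\<in>U. f differentiable (at x)"
  proof (intro ballI)
    fix f x assume f: "f \<in> evals \<Phi>" and x: "x \<in> U"
    obtain \<phi> m where *: "\<phi> \<in> \<Phi>" "f = (\<lambda>x. \<phi> x m)" using f by (rule evalsE)
    show "f differentiable (at x)" unfolding *(2) by (rule diff[OF *(1) x])
  qed
  ultimately show ?case
    using C_family_locally_bounded[OF E] by (simp add: evals_fderiv_family)
qed

text \<open>Differentiability of each w comes from \<open>differentiable_descent\<close>. The
  derivatives composed with P are recovered by division and are again a family pulled back along P,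
  so quantifying over whole families W lets the induction pass to \<open>derivs W\<close>.\<close>

lemma C_family_descent:
  fixes P :: "'a::banach \<Rightarrow> 'm::banach" and W :: "('m \<Rightarrow> 'b::real_normed_vector) set"
  assumes U: "open U" and P: "\<And>n. C_family n U {P}" and surj: "\<And>x. x \<in> U \<Longrightarrow> surj (fderiv P x)"
  shows "C_family n U {\<lambda>x. w (P x) | w. w \<in> W} \<Longrightarrow> C_family n (P ` U) W"
proof (induction n arbitrary: W)
  have lb: "locally_bounded (P ` U) W" if W: "locally_bounded U {\<lambda>x. w (P x) | w. w \<in> W}" for W :: "('m \<Rightarrow> 'b) set"
    unfolding locally_bounded_def
  proof
    fix y0 assume "y0 \<in> P ` U"
    then obtain x0 where x0: "x0 \<in> U" "y0 = P x0" by blast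
    obtain C r where C: "C > 0" "r > 0" and
      Cr: "\<forall>x\<in>ball x0 r. \<forall>y\<in>ball (P x0) r. \<exists>x'\<in>U. P x' = y \<and> norm (x' - x) \<le> C * norm (y - P x)"
      using metric_regularity[OF U P x0(1) surj[OF x0(1)]] by blast
    obtain B where B: "\<forall>\<^sub>F y in nhds x0. \<forall>f\<in>{\<lambda>x. w (P x) | w. w \<in> W}. norm (f y) \<le> B"
      using W x0(1) unfolding locally_bounded_def by blast
    then obtain d where d: "d > 0" "\<And>x. dist x x0 < d \<Longrightarrow> \<forall>f\<in>{\<lambda>x. w (P x) | w. w \<in> W}. norm (f x) \<le> B"
      unfolding eventually_nhds_metric by blast
    \<comment> \<open>Points near y0 have preimages near x0 by metric regularity, so a bound near x0
      descends without a local section.\<close>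
    have "\<forall>\<^sub>F y in nhds y0. y \<in> ball y0 (min r (d / C))"
      using C d by (intro eventually_nhds_in_open) auto
    then have "\<forall>\<^sub>F y in nhds y0. \<forall>w\<in>W. norm (w y) \<le> B"
    proof eventually_elim
      case (elim y)
      have "y \<in> ball (P x0) r" "x0 \<in> ball x0 r" using elim C x0 by auto
      then obtain x' where x': "P x' = y" "norm (x' - x0) \<le> C * norm (y - P x0)" using Cr by blast
      have "C * norm (y - P x0) < d" using elim C x0 by (simp add: dist_norm norm_minus_commute field_simps)
      then have "dist x' x0 < d" using x' by (simp add: dist_norm)
      from d(2)[OF this] show ?case using x'(1) by auto
    qed
    then show "\<exists>C. \<forall>\<^sub>F y in nhds y0. \<forall>f\<in>W. norm (f y) \<le> C" ..
  qed
  {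
    case 0
    then show ?case using lb by simp
  next
    case (Suc n)
    have dW: "w differentiable (at (P x))" if w: "w \<in> W" and x: "x \<in> U" for w x
    proof (rule differentiable_descent[OF U P x surj[OF x]])
      show "(\<lambda>x. w (P x)) differentiable (at x)"
        using w x by (intro C_family_differentiable[OF Suc.prems]) auto
    qed
    have dP: "P differentiable (at x)" if "x \<in> U" for x using P[of "Suc 0"] that by simp
    define \<Phi> where "\<Phi> = {\<lambda>x. fderiv w (P x) | w. w \<in> W}"
    have "C_family n U (evals \<Phi>)"
    proof (rule C_family_division[OF U P surj])
      fix \<phi> x assume \<phi>: "\<phi> \<in> \<Phi>" and x: "x \<in> U"
      obtain w where w: "w \<in> W" "\<phi> = (\<lambda>x. fderiv w (P x))" using \<phi> unfolding \<Phi>_def by blast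
      show "linear (\<phi> x)" unfolding w(2) by (rule linear_frechet_derivative[OF dW[OF w(1) x]])
    next
      have *: "C_family n U (derivs {\<lambda>x. w (P x) | w. w \<in> W})" using Suc.prems by simp
      show "C_family n U (evals (precompose_fderiv P \<Phi>))"
      proof (rule C_family_cong[OF U *])
        fix g assume "g \<in> evals (precompose_fderiv P \<Phi>)"
        then obtain \<psi> h where 1: "\<psi> \<in> precompose_fderiv P \<Phi>" "norm h \<le> 1" "g = (\<lambda>x. \<psi> x h)"
          by (rule evalsE)
        then obtain w where w: "w \<in> W" "\<psi> = (\<lambda>x h. fderiv w (P x) (fderiv P x h))"
          unfolding precompose_fderiv_def \<Phi>_def by blast
        have "(\<lambda>x. w (P x)) \<in> {\<lambda>x. w (P x) | w. w \<in> W}" using w(1) by blast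
        note m = derivsI[OF this 1(2)]
        show "\<exists>f\<in>derivs {\<lambda>x. w (P x) | w. w \<in> W}. \<forall>x\<in>U. g x = f x"
        proof (rule bexI[OF _ m], rule ballI)
          fix x assume x: "x \<in> U"
          have "((\<lambda>x. w (P x)) has_derivative (\<lambda>h. fderiv w (P x) (fderiv P x h))) (at x)"
            by (rule has_derivative_compose[OF fderiv_works[OF dP[OF x]] fderiv_works[OF dW[OF w(1) x]]])
          then show "g x = fderiv (\<lambda>x. w (P x)) x h" unfolding 1(3) w(2) by (simp add: fderiv_eq)
        qed
      qed
    qed
    moreover have "evals \<Phi> = {\<lambda>x. w' (P x) | w'. w' \<in> derivs W}"
      unfolding \<Phi>_def by (rule evals_fderiv_compose)
    ultimately have "C_family n (P ` U) (derivs W)" by (intro Suc.IH) simp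
    then show ?case using dW lb[OF C_family_locally_bounded[OF Suc.prems]] by auto
  }
qed

section \<open>Smooth maps\<close>

lemma C_family_scaleR:
  assumes "open S" "C_family n S {f}"
  shows "C_family n S {\<lambda>x. c *\<^sub>R f x}"
proof (rule C_family_mono[OF assms(1)])
  show "C_family n S {\<lambda>x. l (g x) | l g. l \<in> {(*\<^sub>R) c} \<and> g \<in> {f}}"
    by (rule C_family_linear[OF assms(1) _ _ assms(2), where B="\<bar>c\<bar>"]) auto
qed blast

lemma C_family_fderiv:
  assumes "open S" "C_family (Suc n) S {f}"
  shows "C_family n S {\<lambda>x. fderiv f x h}"
proof -
  have "norm h + 1 > 0" using norm_ge_zero[of h] by linarith
  let ?g = "\<lambda>x. fderiv f x ((1 / (norm h + 1)) *\<^sub>R h)"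
  have "?g \<in> derivs {f}"
    using \<open>norm h + 1 > 0\<close> by (intro derivsI) (auto simp: divide_simps)
  then have "C_family n S {?g}"
    using C_family_mono[OF assms(1), of n "derivs {f}" "{?g}"] assms(2) by simp
  then have "C_family n S {\<lambda>x. (norm h + 1) *\<^sub>R ?g x}" by (rule C_family_scaleR[OF assms(1)])
  then show ?thesis
  proof (rule C_family_cong[OF assms(1)])
    fix g assume g: "g \<in> {\<lambda>x. fderiv f x h}"
    have "fderiv f x h = (norm h + 1) *\<^sub>R ?g x" if "x \<in> S" for x
    proof -
      have "linear (fderiv f x)" using assms(2) that by (intro linear_frechet_derivative) simp
      then show ?thesis using \<open>norm h + 1 > 0\<close> by (simp add: linear_scale)
    qed
    then show "\<exists>f\<in>{\<lambda>x. (norm h + 1) *\<^sub>R ?g x}. \<forall>x\<in>S. g x = f x" using g by simp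
  qed
qed

text \<open>The head of the list is the direction of the last differentiation, in accordance with
  the clause of \<open>smooth_on\<close> that relates \<open>D k\<close> to
  \<open>D (Suc k)\<close>.\<close>

primrec iterated_fderiv :: "('a::real_normed_vector \<Rightarrow> 'b::real_normed_vector) \<Rightarrow> 'a list \<Rightarrow> 'a \<Rightarrow> 'b" where
  "iterated_fderiv f [] = f"
| "iterated_fderiv f (h # vs) = (\<lambda>x. fderiv (iterated_fderiv f vs) x h)"

context
  fixes S :: "'a::real_normed_vector set" and f :: "'a \<Rightarrow> 'b::real_normed_vector"
  assumes S: "open S" and smooth: "\<And>n. C_family n S {f}"
begin

lemma C_family_iterated_fderiv: "C_family n S {iterated_fderiv f vs}"
proof (induction vs arbitrary: n)
  case Nil
  then show ?case using smooth by simp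
next
  case (Cons h vs)
  then show ?case using C_family_fderiv[OF S Cons] by simp
qed

lemma iterated_fderiv_differentiable: "x \<in> S \<Longrightarrow> iterated_fderiv f vs differentiable (at x)"
  using C_family_iterated_fderiv[of "Suc 0" vs] by simp

lemma linear_iterated_fderiv:
  "i < length vs \<Longrightarrow> x \<in> S \<Longrightarrow> linear (\<lambda>v. iterated_fderiv f (vs[i := v]) x)"
proof (induction vs arbitrary: i x)
  case Nil
  then show ?case by simp
next
  case (Cons h vs)
  show ?case
  proof (cases i)
    case 0
    then show ?thesis
      using linear_frechet_derivative[OF iterated_fderiv_differentiable[OF Cons.prems(2), of vs]] by simp
  next
    case (Suc j)
    have "linear (\<lambda>v. fderiv (\<lambda>x. iterated_fderiv f (vs[j := v]) x) x h)"
      using Cons.prems Suc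
      by (intro linear_fderiv_of_linear[OF S Cons.prems(2), where \<phi>="\<lambda>x v. iterated_fderiv f (vs[j := v]) x"] Cons.IH
          iterated_fderiv_differentiable[OF Cons.prems(2)]) auto
    then show ?thesis using Suc by simp
  qed
qed

text \<open>Homogeneity in every slot. Replacing the vectors by their \<open>sgn\<close> brings the
  list into the unit ball, where the bounds of smooth families are uniform; \<open>sgn 0 = 0\<close>
  covers zero entries.\<close>

lemma iterated_fderiv_normalize:
  "x \<in> S \<Longrightarrow> iterated_fderiv f vs x = prod_list (map norm vs) *\<^sub>R iterated_fderiv f (map sgn vs) x"
proof (induction vs arbitrary: x)
  case Nil
  then show ?case by simp
next
  case (Cons h vs)
  let ?p = "prod_list (map norm vs)"
  let ?g = "iterated_fderiv f (map sgn vs)"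
  note d = iterated_fderiv_differentiable[OF Cons.prems]
  have "fderiv (iterated_fderiv f vs) x = fderiv (\<lambda>x. ?p *\<^sub>R ?g x) x"
    by (rule fderiv_cong_open[OF _ S Cons.prems]) (use d Cons.IH in \<open>auto intro!: differentiable_scaleR\<close>)
  also have "\<dots> = (\<lambda>k. ?p *\<^sub>R fderiv ?g x k)"
    by (intro fderiv_eq has_derivative_scaleR_right fderiv_works d)
  finally have "iterated_fderiv f (h # vs) x = ?p *\<^sub>R fderiv ?g x h" by simp
  moreover have h: "norm h *\<^sub>R sgn h = h" by (cases "h = 0") (auto simp: sgn_div_norm)
  have "fderiv ?g x h = norm h *\<^sub>R fderiv ?g x (sgn h)"
    using linear_scale[OF linear_frechet_derivative[OF d[of "map sgn vs"]], of "norm h" "sgn h"]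
      h by simp
  ultimately show ?case by (simp add: mult.commute)
qed

lemma fderiv_iterated_fderiv_normalize:
  assumes "x \<in> S"
  shows "fderiv (iterated_fderiv f vs) x k = prod_list (map norm vs) *\<^sub>R fderiv (iterated_fderiv f (map sgn vs)) x k"
proof -
  let ?p = "prod_list (map norm vs)"
  let ?g = "iterated_fderiv f (map sgn vs)"
  note d = iterated_fderiv_differentiable[OF assms]
  have "fderiv (iterated_fderiv f vs) x = fderiv (\<lambda>x. ?p *\<^sub>R ?g x) x"
    by (rule fderiv_cong_open[OF _ S assms]) (simp_all add: d iterated_fderiv_normalize[of _ vs, symmetric])
  also have "\<dots> = (\<lambda>k. ?p *\<^sub>R fderiv ?g x k)"
    by (intro fderiv_eq has_derivative_scaleR_right fderiv_works d)
  finally show ?thesis by simp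
qed

definition unit_derivs :: "nat \<Rightarrow> ('a \<Rightarrow> 'b) set" where
  "unit_derivs k = {iterated_fderiv f vs | vs. length vs = k \<and> (\<forall>v\<in>set vs. norm v \<le> 1)}"

lemma C_family_unit_derivs: "C_family n S (unit_derivs k)"
proof (induction k arbitrary: n)
  case 0
  then show ?case using smooth[of n] by (simp add: unit_derivs_def)
next
  case (Suc k)
  have "unit_derivs (Suc k) \<subseteq> derivs (unit_derivs k)"
  proof
    fix g assume "g \<in> unit_derivs (Suc k)"
    then obtain vs where vs: "g = iterated_fderiv f vs" "length vs = Suc k" "\<forall>v\<in>set vs. norm v \<le> 1"
      unfolding unit_derivs_def by blast
    then obtain h us where us: "vs = h # us" "length us = k" by (metis length_Suc_conv)
    then have "iterated_fderiv f us \<in> unit_derivs k" using vs unfolding unit_derivs_def by auto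
    from derivsI[OF this, of h] show "g \<in> derivs (unit_derivs k)" using vs us by simp
  qed
  moreover have "C_family n S (derivs (unit_derivs k))" using Suc[of "Suc n"] by simp
  ultimately show ?case using C_family_mono[OF S] by blast
qed

lemma normalized_in_unit_derivs: "length vs = k \<Longrightarrow> iterated_fderiv f (map sgn vs) \<in> unit_derivs k"
  unfolding unit_derivs_def by (intro CollectI exI[of _ "map sgn vs"]) (auto simp: norm_sgn)

lemma prod_list_norm_nonneg: "0 \<le> prod_list (map norm vs)"
  by (induction vs) auto

text \<open>The derivatives of order k in unit directions form a smooth family, so
  \<open>C_family_strict_derivative\<close> gives one remainder bound for all of them. Homogeneity
  turns it into the estimate in the norm of k-linear maps that \<open>smooth_on\<close>
  demands.\<close>

lemma smooth_onI_C_family: "smooth_on S f"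
  unfolding smooth_on_def
proof (rule exI[of _ "\<lambda>k x vs. iterated_fderiv f vs x"], intro conjI allI ballI impI)
  show "iterated_fderiv f [] x = f x" for x by simp
  show "bounded_multilinear k (\<lambda>vs. iterated_fderiv f vs x)" if x: "x \<in> S" for k x
    unfolding bounded_multilinear_def
  proof (intro conjI allI impI)
    show "linear (\<lambda>v. iterated_fderiv f (vs[i := v]) x)" if "length vs = k" "i < k" for vs i
      using that x by (intro linear_iterated_fderiv) auto
    obtain B where B: "\<forall>\<^sub>F y in nhds x. \<forall>g\<in>unit_derivs k. norm (g y) \<le> B"
      using C_family_unit_derivs[of 0 k] x unfolding C_family.simps locally_bounded_def by blast
    show "\<exists>B. \<forall>vs. length vs = k \<longrightarrow> norm (iterated_fderiv f vs x) \<le> B * prod_list (map norm vs)"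
    proof (intro exI allI impI)
      fix vs :: "'a list" assume l: "length vs = k"
      have *: "norm (iterated_fderiv f (map sgn vs) x) \<le> B"
        using eventually_nhds_x_imp_x[OF B] normalized_in_unit_derivs[OF l] by blast
      show "norm (iterated_fderiv f vs x) \<le> B * prod_list (map norm vs)"
        using iterated_fderiv_normalize[OF x, of vs] prod_list_norm_nonneg[of vs]
          mult_right_mono[OF * prod_list_norm_nonneg[of vs]] by (simp add: mult.commute)
    qed
  qed
  show "\<exists>\<delta>>0. \<forall>y\<in>S. norm (y - x) < \<delta> \<longrightarrow>
           (\<forall>vs. length vs = k \<longrightarrow>
              norm (iterated_fderiv f vs y - iterated_fderiv f vs x - iterated_fderiv f ((y - x) # vs) x)
                \<le> \<epsilon> * norm (y - x) * prod_list (map norm vs))"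
    if x: "x \<in> S" and e: "\<epsilon> > 0" for k x \<epsilon>
  proof -
    obtain L \<delta> where L: "L > 0" "\<delta> > 0" "ball x \<delta> \<subseteq> S"
      "\<forall>g\<in>unit_derivs k. \<forall>r y z. 0 < r \<longrightarrow> r \<le> \<delta> \<longrightarrow> y \<in> ball x r \<longrightarrow> z \<in> ball x r \<longrightarrow>
       norm (g y - g z - fderiv g x (y - z)) \<le> L * r * norm (y - z)"
      using C_family_strict_derivative[OF S C_family_unit_derivs x, of k] by blast
    define r where "r = min \<delta> (\<epsilon> / L)"
    have r: "r > 0" "r \<le> \<delta>" "L * r \<le> \<epsilon>" using L e by (auto simp: r_def min_def field_simps)
    show ?thesis
    proof (intro exI conjI ballI impI allI)
      show "r > 0" by fact
      fix y and vs :: "'a list" assume y: "y \<in> S" "norm (y - x) < r" and l: "length vs = k"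
      let ?g = "iterated_fderiv f (map sgn vs)" and ?p = "prod_list (map norm vs)"
      have "norm (?g y - ?g x - fderiv ?g x (y - x)) \<le> L * r * norm (y - x)"
        using L(4)[rule_format, OF normalized_in_unit_derivs[OF l] r(1,2), of y x] y(2) r(1)
        by (simp add: dist_norm norm_minus_commute)
      also have "\<dots> \<le> \<epsilon> * norm (y - x)" using r(3) by (intro mult_right_mono) auto
      finally have *: "norm (?g y - ?g x - fderiv ?g x (y - x)) \<le> \<epsilon> * norm (y - x)" .
      have "iterated_fderiv f vs y - iterated_fderiv f vs x - iterated_fderiv f ((y - x) # vs) x =
          ?p *\<^sub>R (?g y - ?g x - fderiv ?g x (y - x))"
        using iterated_fderiv_normalize[OF y(1), of vs] iterated_fderiv_normalize[OF x, of vs]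
          fderiv_iterated_fderiv_normalize[OF x, of vs "y - x"] by (simp add: algebra_simps)
      then show "norm (iterated_fderiv f vs y - iterated_fderiv f vs x - iterated_fderiv f ((y - x) # vs) x)
                \<le> \<epsilon> * norm (y - x) * prod_list (map norm vs)"
        using mult_right_mono[OF * prod_list_norm_nonneg[of vs]] prod_list_norm_nonneg[of vs]
        by (simp add: mult.commute)
    qed
  qed
qed

end

text \<open>The family at level k consists of the evaluations of \<open>D k\<close> on unit vectors;
  its derivatives agree on S with members of level k + 1. The local bounds come from the
  differentiability clause with \<epsilon> = 1: near x, \<open>D k y\<close> is controlled by
  \<open>D k\<close> and \<open>D (Suc k)\<close> at the single point x.\<close>

lemma smooth_on_imp_C_family:
  fixes f :: "'a::real_normed_vector \<Rightarrow> 'b::real_normed_vector"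
  assumes S: "open S" and sm: "smooth_on S f"
  shows "C_family n S {f}"
proof -
  obtain D :: "nat \<Rightarrow> 'a \<Rightarrow> 'a list \<Rightarrow> 'b" where D0: "\<forall>x\<in>S. D 0 x [] = f x"
    and Dm: "\<forall>k. \<forall>x\<in>S. bounded_multilinear k (D k x)"
    and Dd: "\<forall>k. \<forall>x\<in>S. \<forall>\<epsilon>>0. \<exists>\<delta>>0. \<forall>y\<in>S. norm (y - x) < \<delta> \<longrightarrow>
           (\<forall>vs. length vs = k \<longrightarrow>
              norm (D k y vs - D k x vs - D (Suc k) x ((y - x) # vs))
                \<le> \<epsilon> * norm (y - x) * prod_list (map norm vs))"
    using sm unfolding smooth_on_def by blast
  have p0: "0 \<le> prod_list (map norm vs)" for vs :: "'a list" by (induction vs) auto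
  have der: "((\<lambda>y. D k y vs) has_derivative (\<lambda>h. D (Suc k) x (h # vs))) (at x)"
    if x: "x \<in> S" and l: "length vs = k" for k x vs
    unfolding has_derivative_at_alt
  proof (intro conjI allI impI)
    have m: "bounded_multilinear (Suc k) (D (Suc k) x)" using Dm x by blast
    have "linear (\<lambda>v. D (Suc k) x ((0 # vs)[0 := v]))"
      using m l unfolding bounded_multilinear_def by (metis length_Cons zero_less_Suc)
    then have lin: "linear (\<lambda>v. D (Suc k) x (v # vs))" by simp
    obtain B where B: "\<forall>vs. length vs = Suc k \<longrightarrow> norm (D (Suc k) x vs) \<le> B * prod_list (map norm vs)"
      using m unfolding bounded_multilinear_def by blast
    show "bounded_linear (\<lambda>h. D (Suc k) x (h # vs))"
    proof (intro bounded_linear.intro bounded_linear_axioms.intro exI[of _ "B * prod_list (map norm vs)"] allI lin)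
      fix h
      show "norm (D (Suc k) x (h # vs)) \<le> norm h * (B * prod_list (map norm vs))"
        using B[rule_format, of "h # vs"] l by (simp add: mult_ac)
    qed
    fix e :: real assume e: "e > 0"
    define p where "p = prod_list (map norm vs)"
    have p: "p \<ge> 0" unfolding p_def by (rule p0)
    \<comment> \<open>The factor p may vanish, hence the denominator p + 1.\<close>
    have "e / (p + 1) > 0" using e p by simp
    then obtain \<delta> where \<delta>: "\<delta> > 0" "\<forall>y\<in>S. norm (y - x) < \<delta> \<longrightarrow>
           (\<forall>vs. length vs = k \<longrightarrow>
              norm (D k y vs - D k x vs - D (Suc k) x ((y - x) # vs))
                \<le> e / (p + 1) * norm (y - x) * prod_list (map norm vs))"
      using Dd x by blast
    obtain d where d: "d > 0" "ball x d \<subseteq> S" using S x by (auto simp: open_contains_ball)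
    show "\<exists>d>0. \<forall>y. norm (y - x) < d \<longrightarrow>
        norm (D k y vs - D k x vs - D (Suc k) x ((y - x) # vs)) \<le> e * norm (y - x)"
    proof (intro exI conjI allI impI)
      show "min d \<delta> > 0" using d \<delta> by simp
      fix y assume y: "norm (y - x) < min d \<delta>"
      have "y \<in> S" using y d by (auto simp: dist_norm norm_minus_commute)
      then have "norm (D k y vs - D k x vs - D (Suc k) x ((y - x) # vs)) \<le> e / (p + 1) * norm (y - x) * p"
        using \<delta>(2) y l unfolding p_def by auto
      also have "\<dots> = e * norm (y - x) * (p / (p + 1))" by simp
      also have "\<dots> \<le> e * norm (y - x)" using e p by (intro mult_left_le) auto
      finally show "norm (D k y vs - D k x vs - D (Suc k) x ((y - x) # vs)) \<le> e * norm (y - x)" .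
    qed
  qed
  define F where "F k = {\<lambda>x. D k x vs | vs. length vs = k \<and> (\<forall>v\<in>set vs. norm v \<le> 1)}" for k
  have p1: "prod_list (map norm vs) \<le> 1" if "\<forall>v\<in>set vs. norm v \<le> 1" for vs :: "'a list"
    using that by (induction vs) (auto intro!: mult_le_one p0)
  have lb: "locally_bounded S (F k)" for k
    unfolding locally_bounded_def
  proof
    fix x assume x: "x \<in> S"
    obtain B where B: "\<forall>vs. length vs = k \<longrightarrow> norm (D k x vs) \<le> B * prod_list (map norm vs)"
      using Dm x unfolding bounded_multilinear_def by blast
    obtain B' where B': "\<forall>vs. length vs = Suc k \<longrightarrow> norm (D (Suc k) x vs) \<le> B' * prod_list (map norm vs)"
      using Dm x unfolding bounded_multilinear_def by blast
    obtain \<delta> where \<delta>: "\<delta> > 0" "\<forall>y\<in>S. norm (y - x) < \<delta> \<longrightarrow>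
           (\<forall>vs. length vs = k \<longrightarrow>
              norm (D k y vs - D k x vs - D (Suc k) x ((y - x) # vs))
                \<le> 1 * norm (y - x) * prod_list (map norm vs))"
      using Dd x zero_less_one by blast
    have bd: "b * q \<le> \<bar>b\<bar>" if "0 \<le> q" "q \<le> 1" for b q :: real
    proof -
      have "b * q \<le> \<bar>b\<bar> * q" using that by (intro mult_right_mono) auto
      also have "\<dots> \<le> \<bar>b\<bar>" using that by (intro mult_left_le) auto
      finally show ?thesis .
    qed
    have "\<forall>\<^sub>F y in nhds x. y \<in> S" by (rule eventually_nhds_in_open[OF S x])
    moreover have "\<forall>\<^sub>F y in nhds x. y \<in> ball x (min \<delta> 1)"
      using \<delta>(1) by (intro eventually_nhds_in_open) auto
    ultimately have "\<forall>\<^sub>F y in nhds x. \<forall>f\<in>F k. norm (f y) \<le> \<bar>B\<bar> + \<bar>B'\<bar> + 1"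
    proof eventually_elim
      case (elim y)
      have ny: "norm (y - x) < \<delta>" "norm (y - x) \<le> 1" using elim by (auto simp: dist_norm norm_minus_commute)
      have "norm (D k y vs) \<le> \<bar>B\<bar> + \<bar>B'\<bar> + 1" if l: "length vs = k" and u: "\<forall>v\<in>set vs. norm v \<le> 1" for vs
      proof -
        have "norm (D k y vs - D k x vs - D (Suc k) x ((y - x) # vs)) \<le> 1 * norm (y - x) * prod_list (map norm vs)"
          using \<delta>(2) elim(1) ny(1) l by blast
        also have "\<dots> \<le> 1" using p1[OF u] p0[of vs] ny by (simp add: mult_le_one)
        finally have 1: "norm (D k y vs - D k x vs - D (Suc k) x ((y - x) # vs)) \<le> 1" .
        have "norm (D k x vs) \<le> B * prod_list (map norm vs)" using B l by blast
        also have "\<dots> \<le> \<bar>B\<bar>" by (rule bd[OF p0 p1[OF u]])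
        finally have 2: "norm (D k x vs) \<le> \<bar>B\<bar>" .
        have "norm (D (Suc k) x ((y - x) # vs)) \<le> B' * prod_list (map norm ((y - x) # vs))" using B'[rule_format, of "(y - x) # vs"] l by simp
        also have "\<dots> \<le> \<bar>B'\<bar>" by (rule bd[OF p0 p1]) (use u ny in auto)
        finally have 3: "norm (D (Suc k) x ((y - x) # vs)) \<le> \<bar>B'\<bar>" .
        have "norm (D k y vs) \<le> norm (D k y vs - D k x vs - D (Suc k) x ((y - x) # vs)) +
            norm (D k x vs + D (Suc k) x ((y - x) # vs))"
          using norm_triangle_ineq[of "D k y vs - D k x vs - D (Suc k) x ((y - x) # vs)"
              "D k x vs + D (Suc k) x ((y - x) # vs)"] by simp
        moreover have "norm (D k x vs + D (Suc k) x ((y - x) # vs)) \<le>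
            norm (D k x vs) + norm (D (Suc k) x ((y - x) # vs))" by (rule norm_triangle_ineq)
        ultimately show ?thesis using 1 2 3 by linarith
      qed
      then show ?case unfolding F_def by auto
    qed
    then show "\<exists>C. \<forall>\<^sub>F y in nhds x. \<forall>f\<in>F k. norm (f y) \<le> C" ..
  qed
  have "C_family n S (F k)" for n k
  proof (induction n arbitrary: k)
    case 0
    then show ?case using lb by simp
  next
    case (Suc n)
    have "C_family n S (derivs (F k))"
    proof (rule C_family_cong[OF S Suc[of "Suc k"]])
      fix g assume "g \<in> derivs (F k)"
      then obtain g' h where g: "g' \<in> F k" "norm h \<le> 1" "g = (\<lambda>x. fderiv g' x h)" by (rule derivsE)
      then obtain vs where vs: "length vs = k" "\<forall>v\<in>set vs. norm v \<le> 1" "g' = (\<lambda>x. D k x vs)"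
        unfolding F_def by blast
      have "(\<lambda>x. D (Suc k) x (h # vs)) \<in> F (Suc k)"
        unfolding F_def using vs g by (intro CollectI exI[of _ "h # vs"]) auto
      then show "\<exists>f\<in>F (Suc k). \<forall>x\<in>S. g x = f x"
      proof (rule bexI[rotated], intro ballI)
        fix x assume x: "x \<in> S"
        show "g x = D (Suc k) x (h # vs)"
          unfolding g(3) vs(3) fderiv_eq[OF der[OF x vs(1)]] ..
      qed
    qed
    moreover have "g differentiable (at x)" if g: "g \<in> F k" and x: "x \<in> S" for g x
    proof -
      obtain vs where vs: "length vs = k" "g = (\<lambda>x. D k x vs)" using g unfolding F_def by blast
      show ?thesis unfolding vs(2) by (rule differentiableI[OF der[OF x vs(1)]])
    qed
    ultimately show ?case using lb by simp
  qed
  from this[of n 0] show ?thesis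
  proof (rule C_family_cong[OF S])
    fix g assume g: "g \<in> {f}"
    have "(\<lambda>x. D 0 x []) \<in> F 0" unfolding F_def by (intro CollectI exI[of _ "[]"]) auto
    then show "\<exists>f\<in>F 0. \<forall>x\<in>S. g x = f x"
    proof (rule bexI[rotated], intro ballI)
      fix x assume "x \<in> S"
      then show "g x = D 0 x []" using g D0 by simp
    qed
  qed
qed

lemma smooth_on_iff_C_family:
  assumes "open S"
  shows "smooth_on S f \<longleftrightarrow> (\<forall>n. C_family n S {f})"
proof
  assume "smooth_on S f"
  then show "\<forall>n. C_family n S {f}" by (intro allI smooth_on_imp_C_family assms)
next
  assume "\<forall>n. C_family n S {f}"
  then show "smooth_on S f" by (intro smooth_onI_C_family assms) simp
qed

section \<open>Calculus of smooth functions\<close>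

lemma smooth_on_cong:
  assumes "open S" "smooth_on S f" "\<And>x. x \<in> S \<Longrightarrow> g x = f x"
  shows "smooth_on S g"
  unfolding smooth_on_iff_C_family[OF assms(1)]
proof
  fix n
  have "C_family n S {f}" by (rule smooth_on_imp_C_family[OF assms(1,2)])
  then show "C_family n S {g}" by (rule C_family_cong[OF assms(1)]) (use assms(3) in simp)
qed

lemma smooth_on_subset:
  assumes "open S" "smooth_on S f" "open T" "T \<subseteq> S"
  shows "smooth_on T f"
  unfolding smooth_on_iff_C_family[OF assms(3)]
  using C_family_subset[OF smooth_on_imp_C_family[OF assms(1,2)] assms(4)] by (rule allI)

lemma smooth_on_local:
  assumes "open S" "\<And>x. x \<in> S \<Longrightarrow> \<exists>T. open T \<and> x \<in> T \<and> smooth_on T f"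
  shows "smooth_on S f"
  unfolding smooth_on_iff_C_family[OF assms(1)]
proof (intro allI C_family_local)
  fix n x assume "x \<in> S"
  then obtain T where T: "open T" "x \<in> T" "smooth_on T f" using assms(2) by blast
  then show "\<exists>T. x \<in> T \<and> C_family n T {f}" using smooth_on_imp_C_family[OF T(1,3)] by blast
qed

lemma smooth_on_differentiable: "open S \<Longrightarrow> smooth_on S f \<Longrightarrow> x \<in> S \<Longrightarrow> f differentiable (at x)"
  using smooth_on_imp_C_family[of S f "Suc 0"] by simp

lemma smooth_on_continuous_on:
  assumes "open S" "smooth_on S f"
  shows "continuous_on S f"
  using smooth_on_differentiable[OF assms] differentiable_imp_continuous_within continuous_at_imp_continuous_on
  by blast

lemma smooth_on_compose:
  assumes "open U" "open V" "smooth_on V g" "smooth_on U f" "\<And>x. x \<in> U \<Longrightarrow> f x \<in> V"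
  shows "smooth_on U (\<lambda>x. g (f x))"
  unfolding smooth_on_iff_C_family[OF assms(1)]
proof
  fix n
  have "C_family n U {\<lambda>x. h (f x) | h. h \<in> {g}}"
    by (rule C_family_compose[OF assms(1,2,5) smooth_on_continuous_on[OF assms(1,4)]
          smooth_on_imp_C_family[OF assms(2,3)] smooth_on_imp_C_family[OF assms(1,4)]])
  then show "C_family n U {\<lambda>x. g (f x)}" by simp
qed

lemma smooth_on_linear:
  assumes "open S" "bounded_linear l"
  shows "smooth_on S l"
  unfolding smooth_on_iff_C_family[OF assms(1)]
proof
  interpret bounded_linear l by fact
  obtain K where K: "K > 0" "\<And>x. norm (l x) \<le> norm x * K" using pos_bounded by blast
  have lb: "locally_bounded S {l}"
    unfolding locally_bounded_def
  proof
    fix x assume "x \<in> S"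
    have "\<forall>\<^sub>F y in nhds x. y \<in> ball x 1" by (intro eventually_nhds_in_open) auto
    then have "\<forall>\<^sub>F y in nhds x. \<forall>f\<in>{l}. norm (f y) \<le> (norm x + 1) * K"
    proof eventually_elim
      case (elim y)
      have "norm y \<le> norm x + 1"
        using elim norm_triangle_ineq2[of y x] by (simp add: dist_norm norm_minus_commute)
      then have "norm y * K \<le> (norm x + 1) * K" using K by (intro mult_right_mono) auto
      then show ?case using K(2)[of y] by simp
    qed
    then show "\<exists>C. \<forall>\<^sub>F y in nhds x. \<forall>f\<in>{l}. norm (f y) \<le> C" ..
  qed
  have d: "fderiv l x = l" for x by (rule fderiv_eq[OF has_derivative[OF has_derivative_ident]])
  fix n
  show "C_family n S {l}"
  proof (cases n)
    case 0
    then show ?thesis using lb by simp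
  next
    case (Suc m)
    have "derivs {l} \<subseteq> {\<lambda>x. c | c. norm c \<le> K}"
    proof
      fix g assume "g \<in> derivs {l}"
      then obtain f h where *: "f \<in> {l}" "norm h \<le> 1" "g = (\<lambda>x. fderiv f x h)" by (rule derivsE)
      have "norm (l h) \<le> norm h * K" by (rule K)
      also have "\<dots> \<le> K" using *(2) K(1) by (simp add: mult_left_le_one_le)
      finally have "norm (l h) \<le> K" .
      moreover have "g = (\<lambda>x. l h)" using *(1,3) by (simp add: d)
      ultimately show "g \<in> {\<lambda>x. c | c. norm c \<le> K}" by blast
    qed
    then have "C_family m S (derivs {l})" by (rule C_family_mono[OF assms(1) C_family_const[OF assms(1)]])
    moreover have "l differentiable (at x)" for x
      by (rule differentiableI[OF has_derivative[OF has_derivative_ident]])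
    ultimately show ?thesis using lb Suc by simp
  qed
qed

lemma smooth_on_const: "open S \<Longrightarrow> smooth_on S (\<lambda>x. c)"
  unfolding smooth_on_iff_C_family
proof
  fix n assume "open S"
  show "C_family n S {\<lambda>x. c}"
    by (rule C_family_mono[OF \<open>open S\<close> C_family_const[OF \<open>open S\<close>, of n "norm c"]]) auto
qed

lemma smooth_on_add:
  assumes "open S" "smooth_on S f" "smooth_on S g"
  shows "smooth_on S (\<lambda>x. f x + g x)"
  unfolding smooth_on_iff_C_family[OF assms(1)]
proof
  fix n
  have "C_family n S {\<lambda>x. f' x + g' x | f' g'. f' \<in> {f} \<and> g' \<in> {g}}"
    by (rule C_family_sum[OF assms(1) smooth_on_imp_C_family[OF assms(1,2)] smooth_on_imp_C_family[OF assms(1,3)]])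
  then show "C_family n S {\<lambda>x. f x + g x}" by simp
qed

lemma smooth_on_bounded_linear:
  assumes "open S" "bounded_linear l" "smooth_on S f"
  shows "smooth_on S (\<lambda>x. l (f x))"
  by (rule smooth_on_compose[OF assms(1) open_UNIV smooth_on_linear[OF open_UNIV assms(2)] assms(3)]) simp

lemma smooth_on_Pair:
  assumes "open S" "smooth_on S f" "smooth_on S g"
  shows "smooth_on S (\<lambda>x. (f x, g x))"
proof -
  have l: "bounded_linear (\<lambda>x::'b. (x, 0::'c))" "bounded_linear (\<lambda>x::'c. (0::'b, x))"
    by (intro bounded_linear_Pair bounded_linear_ident bounded_linear_zero)+
  have "smooth_on S (\<lambda>x. (f x, 0) + (0, g x))"
    by (intro smooth_on_add smooth_on_bounded_linear[OF assms(1) l(1)] smooth_on_bounded_linear[OF assms(1) l(2)] assms)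
  then show ?thesis by simp
qed

lemma smooth_on_fderiv_apply:
  assumes "open S" "smooth_on S f" "smooth_on S r"
  shows "smooth_on S (\<lambda>x. fderiv f x (r x))"
  unfolding smooth_on_iff_C_family[OF assms(1)]
proof
  fix n
  have "C_family n S {\<lambda>x. \<phi> x (r' x) | \<phi> r'. \<phi> \<in> {fderiv f} \<and> r' \<in> {r}}"
  proof (rule C_family_pairing[OF assms(1) _ _ smooth_on_imp_C_family[OF assms(1,3)]])
    show "C_family n S (evals {fderiv f})"
      using smooth_on_imp_C_family[OF assms(1,2), of "Suc n"] by (simp add: derivs_singleton)
    show "linear (\<phi> x)" if "\<phi> \<in> {fderiv f}" "x \<in> S" for \<phi> x
      using linear_frechet_derivative[OF smooth_on_differentiable[OF assms(1,2) that(2)]] that(1) by simp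
  qed
  then show "C_family n S {\<lambda>x. fderiv f x (r x)}" by simp
qed

lemma fderiv_fderiv_apply:
  assumes "open S" "smooth_on S f" "r differentiable (at x)" "x \<in> S"
  shows "((\<lambda>y. fderiv f y (r y)) has_derivative
    (\<lambda>k. fderiv (\<lambda>y. fderiv f y (r x)) x k + fderiv f x (fderiv r x k))) (at x)"
proof (rule pairing_has_derivative[OF assms(1,4) _ _ _ assms(3), of "{fderiv f}"])
  show "C_family (Suc 0) S (evals {fderiv f})"
    using smooth_on_imp_C_family[OF assms(1,2), of "Suc (Suc 0)"] by (simp add: derivs_singleton)
  show "linear (fderiv f x)" if "x \<in> S" for x
    by (rule linear_frechet_derivative[OF smooth_on_differentiable[OF assms(1,2) that]])
qed simp

lemma smooth_on_fderiv_compose: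
  assumes "open T" "smooth_on T Q" "open S" "smooth_on S \<iota>" "\<And>x. x \<in> S \<Longrightarrow> \<iota> x \<in> T"
  shows "smooth_on S (\<lambda>x. fderiv Q (\<iota> x) w)"
  by (rule smooth_on_compose[OF assms(3,1) smooth_on_fderiv_apply[OF assms(1,2) smooth_on_const[OF assms(1)]]
        assms(4,5)])

lemma smooth_on_descent:
  fixes P :: "'a::banach \<Rightarrow> 'm::banach"
  assumes "open U" "smooth_on U P" "\<And>x. x \<in> U \<Longrightarrow> surj (fderiv P x)" "open (P ` U)"
    and "smooth_on U (\<lambda>x. w (P x))"
  shows "smooth_on (P ` U) w"
  unfolding smooth_on_iff_C_family[OF assms(4)]
proof
  fix n
  have "C_family n U {\<lambda>x. v (P x) | v. v \<in> {w}}"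
    using smooth_on_imp_C_family[OF assms(1,5)] by simp
  show "C_family n (P ` U) {w}"
  proof (rule C_family_descent[OF assms(1)])
    show "C_family n U {P}" for n by (rule smooth_on_imp_C_family[OF assms(1,2)])
  qed (fact | rule assms(3))+
qed

lemma open_image_submersion:
  fixes P :: "'a::banach \<Rightarrow> 'm::banach"
  assumes "open U" "smooth_on U P" "\<And>x. x \<in> U \<Longrightarrow> surj (fderiv P x)"
  shows "open (P ` U)"
proof (rule openI)
  fix y assume "y \<in> P ` U"
  then obtain x where x: "x \<in> U" "y = P x" by blast
  obtain C r where C: "C > 0" "r > 0"
      "\<forall>z\<in>ball x r. \<forall>y\<in>ball (P x) r. \<exists>x'\<in>U. P x' = y \<and> norm (x' - z) \<le> C * norm (y - P z)"
    using metric_regularity[OF assms(1) smooth_on_imp_C_family[OF assms(1,2)] x(1) assms(3)[OF x(1)]] by blast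
  have "ball y r \<subseteq> P ` U"
  proof
    fix z assume "z \<in> ball y r"
    moreover have "x \<in> ball x r" using C by simp
    ultimately have "\<exists>x'\<in>U. P x' = z \<and> norm (x' - x) \<le> C * norm (z - P x)"
      unfolding x(2) by (rule C(3)[rule_format, rotated])
    then show "z \<in> P ` U" by blast
  qed
  then show "\<exists>e>0. ball y e \<subseteq> P ` U" using C(2) by blast
qed

text \<open>The mean value inequality is applied in \<tau> to the increment of f in direction s w
  along x + \<tau> s v, with \<tau> s^2 c subtracted. The \<tau>-derivative is s times the
  linearisation error of g, which \<open>C_family_strict_derivative\<close> makes quadratic in
  s.\<close>

lemma second_difference_bound:
  fixes f :: "'a::real_normed_vector \<Rightarrow> 'b::real_normed_vector"
  assumes "open S" "smooth_on S f" "x \<in> S"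
  shows "\<exists>A>0. \<exists>\<delta>>0. \<forall>s. 0 < s \<longrightarrow> s < \<delta> \<longrightarrow>
    norm (f (x + s *\<^sub>R v + s *\<^sub>R w) - f (x + s *\<^sub>R v) - f (x + s *\<^sub>R w) + f x
      - s^2 *\<^sub>R fderiv (\<lambda>y. fderiv f y v) x w) \<le> A * s^3"
proof -
  define g where "g y = fderiv f y v" for y
  have df: "f differentiable (at y)" if "y \<in> S" for y by (rule smooth_on_differentiable[OF assms(1,2) that])
  have "C_family (Suc (Suc 0)) S {g}"
    unfolding g_def by (rule C_family_fderiv[OF assms(1) smooth_on_imp_C_family[OF assms(1,2)]])
  then obtain L \<delta> where L: "L > 0" "\<delta> > 0" "ball x \<delta> \<subseteq> S"
    "\<forall>h\<in>{g}. \<forall>r y z. 0 < r \<longrightarrow> r \<le> \<delta> \<longrightarrow> y \<in> ball x r \<longrightarrow> z \<in> ball x r \<longrightarrow>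
       norm (h y - h z - fderiv h x (y - z)) \<le> L * r * norm (y - z)"
    using C_family_strict_derivative[OF assms(1) _ assms(3)] by blast
  have lin: "linear (fderiv g x)"
    using \<open>C_family (Suc (Suc 0)) S {g}\<close> assms(3) by (intro linear_frechet_derivative) simp
  \<comment> \<open>All points of the parallelogram lie in the ball of radius s * R; the added 1
    makes the inequality strict and R positive.\<close>
  define R where "R = norm v + norm w + 1"
  have R: "R > 0" unfolding R_def by (simp add: add_nonneg_pos)
  define c where "c = fderiv g x w"
  have main: "norm (f (x + s *\<^sub>R v + s *\<^sub>R w) - f (x + s *\<^sub>R v) - f (x + s *\<^sub>R w) + f x - s^2 *\<^sub>R c) \<le> L * R * (norm w + 1) * s^3"
    if s: "0 < s" "s < \<delta> / R" for s
  proof -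
    have sR: "0 < s * R" "s * R \<le> \<delta>" using s R by (auto simp: field_simps)
    have in_ball: "x + (\<tau> * s) *\<^sub>R v + u *\<^sub>R w \<in> ball x (s * R)" if "\<tau> \<in> {0..1}" "u = 0 \<or> u = s" for \<tau> u
    proof -
      have "norm ((\<tau> * s) *\<^sub>R v + u *\<^sub>R w) \<le> norm ((\<tau> * s) *\<^sub>R v) + norm (u *\<^sub>R w)" by (rule norm_triangle_ineq)
      also have "\<dots> \<le> s * norm v + s * norm w"
        using that s by (intro add_mono) (auto intro!: mult_right_mono mult_left_le_one_le simp: abs_mult)
      also have "\<dots> < s * R" using s by (simp add: R_def algebra_simps)
      finally have "dist x (x + ((\<tau> * s) *\<^sub>R v + u *\<^sub>R w)) < s * R"
        by (subst dist_commute) (simp add: dist_norm)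
      then show ?thesis by (simp add: add.assoc)
    qed
    have sub: "ball x (s * R) \<subseteq> S" using L(3) subset_ball[OF sR(2), of x] by blast
    define \<phi> where "\<phi> \<tau> = f (x + (\<tau> * s) *\<^sub>R v + s *\<^sub>R w) - f (x + (\<tau> * s) *\<^sub>R v) - \<tau> *\<^sub>R (s^2 *\<^sub>R c)" for \<tau>
    define \<phi>' where "\<phi>' \<tau> = s *\<^sub>R (g (x + (\<tau> * s) *\<^sub>R v + s *\<^sub>R w) - g (x + (\<tau> * s) *\<^sub>R v)) - s^2 *\<^sub>R c" for \<tau>
    have f_line: "((\<lambda>\<tau>. f (x + (\<tau> * s) *\<^sub>R v + u *\<^sub>R w)) has_derivative
        (\<lambda>t. t *\<^sub>R (s *\<^sub>R g (x + (\<tau> * s) *\<^sub>R v + u *\<^sub>R w)))) (at \<tau> within {0..1})"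
      if "\<tau> \<in> {0..1}" "u = 0 \<or> u = s" for \<tau> u
    proof -
      have y: "x + (\<tau> * s) *\<^sub>R v + u *\<^sub>R w \<in> S" using in_ball[OF that] sub by blast
      have "((\<lambda>\<tau>. x + (\<tau> * s) *\<^sub>R v + u *\<^sub>R w) has_derivative (\<lambda>t. (t * s) *\<^sub>R v)) (at \<tau> within {0..1})"
        by (auto intro!: derivative_eq_intros)
      from has_derivative_compose[OF this fderiv_works[OF df[OF y]]]
      have "((\<lambda>\<tau>. f (x + (\<tau> * s) *\<^sub>R v + u *\<^sub>R w)) has_derivative
        (\<lambda>t. fderiv f (x + (\<tau> * s) *\<^sub>R v + u *\<^sub>R w) ((t * s) *\<^sub>R v))) (at \<tau> within {0..1})" .
      moreover have "fderiv f (x + (\<tau> * s) *\<^sub>R v + u *\<^sub>R w) ((t * s) *\<^sub>R v) =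
          t *\<^sub>R (s *\<^sub>R g (x + (\<tau> * s) *\<^sub>R v + u *\<^sub>R w))" for t
        using linear_scale[OF linear_frechet_derivative[OF df[OF y]], of "t * s" v] by (simp add: g_def)
      ultimately show ?thesis by simp
    qed
    have "norm (\<phi> 1 - \<phi> 0) \<le> L * R * (norm w + 1) * s^3 * norm (1 - 0 :: real)"
    proof (rule differentiable_bound[where S="{0..1}" and f'="\<lambda>\<tau> t. t *\<^sub>R \<phi>' \<tau>"])
      fix \<tau> :: real assume \<tau>: "\<tau> \<in> {0..1}"
      have "((\<lambda>\<tau>. f (x + (\<tau> * s) *\<^sub>R v + s *\<^sub>R w) - f (x + (\<tau> * s) *\<^sub>R v + 0 *\<^sub>R w) - \<tau> *\<^sub>R (s^2 *\<^sub>R c)) has_derivative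
        (\<lambda>t. t *\<^sub>R (s *\<^sub>R g (x + (\<tau> * s) *\<^sub>R v + s *\<^sub>R w)) - t *\<^sub>R (s *\<^sub>R g (x + (\<tau> * s) *\<^sub>R v + 0 *\<^sub>R w)) - t *\<^sub>R (s^2 *\<^sub>R c)))
          (at \<tau> within {0..1})"
        by (intro has_derivative_diff f_line[OF \<tau>] has_derivative_scaleR_left has_derivative_ident) auto
      then show "(\<phi> has_derivative (\<lambda>t. t *\<^sub>R \<phi>' \<tau>)) (at \<tau> within {0..1})"
        unfolding \<phi>_def[abs_def] \<phi>'_def by (simp add: scaleR_diff_right)
      have b: "x + (\<tau> * s) *\<^sub>R v + s *\<^sub>R w \<in> ball x (s * R)" "x + (\<tau> * s) *\<^sub>R v \<in> ball x (s * R)"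
        using in_ball[OF \<tau>, of s] in_ball[OF \<tau>, of 0] by auto
      have "norm (g (x + (\<tau> * s) *\<^sub>R v + s *\<^sub>R w) - g (x + (\<tau> * s) *\<^sub>R v) - fderiv g x (s *\<^sub>R w)) \<le> L * (s * R) * norm (s *\<^sub>R w)"
        using L(4)[rule_format, OF _ sR b] by simp
      then have "norm (g (x + (\<tau> * s) *\<^sub>R v + s *\<^sub>R w) - g (x + (\<tau> * s) *\<^sub>R v) - s *\<^sub>R c) \<le> L * (s * R) * (s * norm w)"
        using s linear_scale[OF lin, of s w] by (simp add: c_def)
      then have "s * norm (g (x + (\<tau> * s) *\<^sub>R v + s *\<^sub>R w) - g (x + (\<tau> * s) *\<^sub>R v) - s *\<^sub>R c) \<le> s * (L * (s * R) * (s * norm w))"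
        using s by (intro mult_left_mono) auto
      moreover have "\<phi>' \<tau> = s *\<^sub>R (g (x + (\<tau> * s) *\<^sub>R v + s *\<^sub>R w) - g (x + (\<tau> * s) *\<^sub>R v) - s *\<^sub>R c)"
        by (simp add: \<phi>'_def algebra_simps power2_eq_square)
      ultimately have "norm (\<phi>' \<tau>) \<le> s * (L * (s * R) * (s * norm w))" using s by simp
      also have "\<dots> = L * R * s^3 * norm w" by (simp add: power3_eq_cube mult_ac)
      also have "\<dots> \<le> L * R * s^3 * (norm w + 1)" using L R s by (intro mult_left_mono) auto
      finally have n: "norm (\<phi>' \<tau>) \<le> L * R * (norm w + 1) * s^3" by (simp add: mult_ac)
      show "onorm (\<lambda>t. t *\<^sub>R \<phi>' \<tau>) \<le> L * R * (norm w + 1) * s^3"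
      proof (rule onorm_bound)
        show "0 \<le> L * R * (norm w + 1) * s^3" by (rule order_trans[OF norm_ge_zero n])
        show "norm (t *\<^sub>R \<phi>' \<tau>) \<le> L * R * (norm w + 1) * s^3 * norm t" for t
          using mult_left_mono[OF n, of "\<bar>t\<bar>"] by (simp add: mult_ac)
      qed
    qed auto
    then show ?thesis by (simp add: \<phi>_def algebra_simps)
  qed
  have c: "c = fderiv (\<lambda>y. fderiv f y v) x w" unfolding c_def g_def[abs_def] ..
  show ?thesis
  proof (intro exI conjI allI impI)
    show "L * R * (norm w + 1) > 0" using L R by (simp add: add_nonneg_pos)
    show "\<delta> / R > 0" using L R by simp
  qed (fold c, rule main)
qed

text \<open>The second difference does not change when v and w are swapped, so both mixed
  derivatives differ from the same quotient by O(s).\<close>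

lemma fderiv_symmetric:
  fixes f :: "'a::real_normed_vector \<Rightarrow> 'b::real_normed_vector"
  assumes "open S" "smooth_on S f" "x \<in> S"
  shows "fderiv (\<lambda>y. fderiv f y v) x w = fderiv (\<lambda>y. fderiv f y w) x v"
proof -
  let ?a = "fderiv (\<lambda>y. fderiv f y v) x w" and ?b = "fderiv (\<lambda>y. fderiv f y w) x v"
  obtain A \<delta> where A: "A > 0" "\<delta> > 0" "\<forall>s. 0 < s \<longrightarrow> s < \<delta> \<longrightarrow>
    norm (f (x + s *\<^sub>R v + s *\<^sub>R w) - f (x + s *\<^sub>R v) - f (x + s *\<^sub>R w) + f x - s^2 *\<^sub>R ?a) \<le> A * s^3"
    using second_difference_bound[OF assms, of v w] by blast
  obtain B \<eta> where B: "B > 0" "\<eta> > 0" "\<forall>s. 0 < s \<longrightarrow> s < \<eta> \<longrightarrow>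
    norm (f (x + s *\<^sub>R w + s *\<^sub>R v) - f (x + s *\<^sub>R w) - f (x + s *\<^sub>R v) + f x - s^2 *\<^sub>R ?b) \<le> B * s^3"
    using second_difference_bound[OF assms, of w v] by blast
  have bound: "norm (?a - ?b) \<le> (A + B) * s" if s: "0 < s" "s < \<delta>" "s < \<eta>" for s
  proof -
    let ?X = "f (x + s *\<^sub>R v + s *\<^sub>R w) - f (x + s *\<^sub>R v) - f (x + s *\<^sub>R w) + f x"
    have "x + s *\<^sub>R w + s *\<^sub>R v = x + s *\<^sub>R v + s *\<^sub>R w" by simp
    then have "f (x + s *\<^sub>R w + s *\<^sub>R v) - f (x + s *\<^sub>R w) - f (x + s *\<^sub>R v) + f x = ?X"
      unfolding \<open>x + s *\<^sub>R w + s *\<^sub>R v = x + s *\<^sub>R v + s *\<^sub>R w\<close> by simp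
    with B(3)[rule_format, OF s(1,3)] have 2: "norm (?X - s^2 *\<^sub>R ?b) \<le> B * s^3" by (simp only:)
    have 1: "norm (?X - s^2 *\<^sub>R ?a) \<le> A * s^3" by (rule A(3)[rule_format, OF s(1,2)])
    have "s^2 *\<^sub>R (?a - ?b) = (?X - s^2 *\<^sub>R ?b) - (?X - s^2 *\<^sub>R ?a)" by (simp add: scaleR_diff_right)
    then have "norm (s^2 *\<^sub>R (?a - ?b)) \<le> norm (?X - s^2 *\<^sub>R ?b) + norm (?X - s^2 *\<^sub>R ?a)"
      using norm_triangle_ineq4[of "?X - s^2 *\<^sub>R ?b" "?X - s^2 *\<^sub>R ?a"] by simp
    also have "\<dots> \<le> B * s^3 + A * s^3" by (rule add_mono[OF 2 1])
    also have "\<dots> = s^2 * ((A + B) * s)" by (simp add: distrib_left distrib_right power3_eq_cube power2_eq_square)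
    finally have "s^2 * norm (?a - ?b) \<le> s^2 * ((A + B) * s)" by simp
    then show ?thesis using s by (subst (asm) mult_le_cancel_left_pos) auto
  qed
  have "norm (?a - ?b) \<le> 0"
  proof (rule field_le_epsilon)
    fix e :: real assume e: "e > 0"
    define s where "s = min (e / (A + B)) (min (\<delta> / 2) (\<eta> / 2))"
    have "s > 0" "s < \<delta>" "s < \<eta>" using A B e by (auto simp: s_def min_less_iff_disj)
    moreover have "s \<le> e / (A + B)" by (simp add: s_def)
    then have "(A + B) * s \<le> e" using A B by (simp add: pos_le_divide_eq mult.commute)
    ultimately show "norm (?a - ?b) \<le> 0 + e" using bound[of s] by linarith
  qed
  then show ?thesis by simp
qed

section \<open>Charts and differentials\<close>

text \<open>The part of being a manifold that controls chart inverses. It is isolated because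
  product atlases and tangent bundles enter the arguments through this property alone.\<close>

definition regular_atlas :: "('p, 'e::real_normed_vector) atlas \<Rightarrow> bool" where
  "regular_atlas A \<longleftrightarrow> (\<forall>c\<in>A. inj_on (snd c) (fst c) \<and> open (snd c ` fst c))"

abbreviation loc_rep :: "('p, 'e) chart \<Rightarrow> ('q, 'f) chart \<Rightarrow> ('p \<Rightarrow> 'q) \<Rightarrow> 'e \<Rightarrow> 'f" where
  "loc_rep c d f \<equiv> snd d \<circ> f \<circ> chart_inv c"

abbreviation loc_dom :: "('p, 'e) chart \<Rightarrow> ('q, 'f) chart \<Rightarrow> ('p \<Rightarrow> 'q) \<Rightarrow> 'e set" where
  "loc_dom c d f \<equiv> snd c ` (fst c \<inter> f -` fst d)"

lemma banach_manifold_regular: "banach_manifold A \<Longrightarrow> regular_atlas A"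
  by (auto simp: banach_manifold_def regular_atlas_def)

lemma regular_atlas_open: "regular_atlas A \<Longrightarrow> c \<in> A \<Longrightarrow> open (snd c ` fst c)"
  by (simp add: regular_atlas_def)

lemma chart_inv_left [simp]: "regular_atlas A \<Longrightarrow> c \<in> A \<Longrightarrow> p \<in> fst c \<Longrightarrow> chart_inv c (snd c p) = p"
  by (simp add: regular_atlas_def chart_inv_def)

lemma chart_inv_right: "x \<in> snd c ` fst c \<Longrightarrow> snd c (chart_inv c x) = x"
  unfolding chart_inv_def by (rule f_inv_into_f)

lemma chart_inv_in: "x \<in> snd c ` fst c \<Longrightarrow> chart_inv c x \<in> fst c"
  unfolding chart_inv_def by (rule inv_into_into)

lemma points_iff: "p \<in> points A \<longleftrightarrow> (\<exists>c\<in>A. p \<in> fst c)"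
  by (auto simp: points_def)

lemma pointsI: "c \<in> A \<Longrightarrow> p \<in> fst c \<Longrightarrow> p \<in> points A"
  by (auto simp: points_def)

lemma mem_loc_dom_iff:
  assumes "regular_atlas A" "c \<in> A"
  shows "x \<in> loc_dom c d f \<longleftrightarrow> x \<in> snd c ` fst c \<and> f (chart_inv c x) \<in> fst d"
proof
  assume "x \<in> loc_dom c d f"
  then obtain p where "p \<in> fst c" "f p \<in> fst d" "x = snd c p" by blast
  then show "x \<in> snd c ` fst c \<and> f (chart_inv c x) \<in> fst d" using assms by simp
next
  assume x: "x \<in> snd c ` fst c \<and> f (chart_inv c x) \<in> fst d"
  then have "chart_inv c x \<in> fst c \<inter> f -` fst d" using chart_inv_in[OF conjunct1[OF x]] by blast
  then have "snd c (chart_inv c x) \<in> loc_dom c d f" by (rule imageI)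
  then show "x \<in> loc_dom c d f" using x chart_inv_right by metis
qed

lemma chart_at_in: "p \<in> points A \<Longrightarrow> chart_at A p \<in> A \<and> p \<in> fst (chart_at A p)"
  unfolding chart_at_def points_iff by (rule someI_ex) blast

lemma smooth_map_points: "smooth_map A B f \<Longrightarrow> p \<in> points A \<Longrightarrow> f p \<in> points B"
  by (auto simp: smooth_map_def)

lemma smooth_map_loc_dom: "smooth_map A B f \<Longrightarrow> c \<in> A \<Longrightarrow> d \<in> B \<Longrightarrow> open (loc_dom c d f)"
  by (simp add: smooth_map_def)

lemma smooth_map_loc_rep: "smooth_map A B f \<Longrightarrow> c \<in> A \<Longrightarrow> d \<in> B \<Longrightarrow> smooth_on (loc_dom c d f) (loc_rep c d f)"
  by (simp add: smooth_map_def)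

lemma smooth_mapI_local:
  assumes A: "regular_atlas A" and im: "\<And>p. p \<in> points A \<Longrightarrow> f p \<in> points B"
    and loc: "\<And>c d p. c \<in> A \<Longrightarrow> d \<in> B \<Longrightarrow> p \<in> fst c \<Longrightarrow> f p \<in> fst d \<Longrightarrow>
      \<exists>T. open T \<and> snd c p \<in> T \<and> T \<subseteq> loc_dom c d f \<and> smooth_on T (loc_rep c d f)"
  shows "smooth_map A B f"
proof -
  have *: "\<exists>T. open T \<and> x \<in> T \<and> T \<subseteq> loc_dom c d f \<and> smooth_on T (loc_rep c d f)"
    if cd: "c \<in> A" "d \<in> B" and x: "x \<in> loc_dom c d f" for c d x
  proof -
    obtain p where "p \<in> fst c" "f p \<in> fst d" "x = snd c p" using x by blast
    then show ?thesis using loc[OF cd] by blast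
  qed
  have o: "open (loc_dom c d f)" if "c \<in> A" "d \<in> B" for c d
    using *[OF that] by (subst open_subopen) blast
  have "smooth_on (loc_dom c d f) (loc_rep c d f)" if "c \<in> A" "d \<in> B" for c d
    using *[OF that] by (intro smooth_on_local o that) blast
  then show ?thesis using im o by (auto simp: smooth_map_def)
qed

text \<open>The intermediate chart d sees only part of the domain, so T is cut down to the points
  whose image lies in d and whose second image lies in e. Openness of T uses continuity of the first
  representative.\<close>

lemma smooth_map_compose_chart:
  assumes A: "regular_atlas A" and B: "regular_atlas B" and f: "smooth_map A B f" and g: "smooth_map B C g"
    and c: "c \<in> A" "p \<in> fst c" and d: "d \<in> B" "f p \<in> fst d" and e: "e \<in> C" "g (f p) \<in> fst e"
  shows "\<exists>T. open T \<and> snd c p \<in> T \<and> T \<subseteq> loc_dom c e (g \<circ> f) \<and> T \<subseteq> loc_dom c d f \<and>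
    (\<forall>x\<in>T. loc_rep c d f x \<in> loc_dom d e g \<and> loc_rep c e (g \<circ> f) x = loc_rep d e g (loc_rep c d f x))"
proof -
  define T where "T = loc_dom c d f \<inter> loc_rep c d f -` loc_dom d e g"
  note oc = smooth_map_loc_dom[OF f c(1) d(1)]
  have 1: "open T"
    unfolding T_def
    by (rule continuous_open_preimage[OF smooth_on_continuous_on[OF oc smooth_map_loc_rep[OF f c(1) d(1)]] oc
          smooth_map_loc_dom[OF g d(1) e(1)]])
  have 2: "snd c p \<in> T"
  proof -
    have "snd c p \<in> loc_dom c d f" using c d by blast
    moreover have "snd d (f p) \<in> loc_dom d e g" using d e by blast
    then have "loc_rep c d f (snd c p) \<in> loc_dom d e g" using A c by simp
    ultimately show ?thesis unfolding T_def by blast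
  qed
  have 3: "T \<subseteq> loc_dom c d f" by (simp add: T_def)
  have dd: "f (chart_inv c x) \<in> fst d" if "x \<in> T" for x
  proof -
    have "x \<in> loc_dom c d f" using that 3 by blast
    from iffD1[OF mem_loc_dom_iff[OF A c(1)] this] show ?thesis by blast
  qed
  have 4: "loc_rep c d f x \<in> loc_dom d e g" if "x \<in> T" for x using that unfolding T_def by blast
  have 5: "loc_rep c e (g \<circ> f) x = loc_rep d e g (loc_rep c d f x)" if "x \<in> T" for x
    using dd[OF that] B d(1) by simp
  have 6: "T \<subseteq> loc_dom c e (g \<circ> f)"
  proof
    fix x assume x: "x \<in> T"
    have "g (chart_inv d (loc_rep c d f x)) \<in> fst e"
      using iffD1[OF mem_loc_dom_iff[OF B d(1)] 4[OF x]] by blast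
    then have "g (f (chart_inv c x)) \<in> fst e" using dd[OF x] B d(1) by simp
    moreover have "x \<in> snd c ` fst c" using x unfolding T_def by blast
    ultimately show "x \<in> loc_dom c e (g \<circ> f)"
      unfolding mem_loc_dom_iff[OF A c(1)] by simp
  qed
  show ?thesis
    by (intro exI[of _ T] conjI ballI 1 2 3 6 4 5)
qed

lemma smooth_map_compose:
  assumes A: "regular_atlas A" and B: "regular_atlas B" and f: "smooth_map A B f" and g: "smooth_map B C g"
  shows "smooth_map A C (g \<circ> f)"
proof (rule smooth_mapI_local[OF A])
  show "(g \<circ> f) p \<in> points C" if "p \<in> points A" for p
    using smooth_map_points[OF g smooth_map_points[OF f that]] by simp
  fix c e p assume c: "c \<in> A" and e: "e \<in> C" and p: "p \<in> fst c" "(g \<circ> f) p \<in> fst e"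
  obtain d where d: "d \<in> B" "f p \<in> fst d"
    using smooth_map_points[OF f pointsI[OF c p(1)]] unfolding points_iff by blast
  have "g (f p) \<in> fst e" using p by simp
  obtain T where T: "open T" "snd c p \<in> T" "T \<subseteq> loc_dom c e (g \<circ> f)" "T \<subseteq> loc_dom c d f"
    "\<forall>x\<in>T. loc_rep c d f x \<in> loc_dom d e g \<and> loc_rep c e (g \<circ> f) x = loc_rep d e g (loc_rep c d f x)"
    using smooth_map_compose_chart[OF A B f g c p(1) d e \<open>g (f p) \<in> fst e\<close>] by blast
  have "smooth_on T (\<lambda>x. loc_rep d e g (loc_rep c d f x))"
  proof (rule smooth_on_compose[OF T(1), where g="loc_rep d e g" and f="loc_rep c d f"])
    show "open (loc_dom d e g)" "smooth_on (loc_dom d e g) (loc_rep d e g)"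
      using smooth_map_loc_dom[OF g d(1) e] smooth_map_loc_rep[OF g d(1) e] by auto
    show "smooth_on T (loc_rep c d f)"
      by (rule smooth_on_subset[OF smooth_map_loc_dom[OF f c d(1)] smooth_map_loc_rep[OF f c d(1)] T(1,4)])
  qed (use T(5) in blast)
  then have "smooth_on T (loc_rep c e (g \<circ> f))"
    by (rule smooth_on_cong[OF T(1)]) (use T(5) in blast)
  then show "\<exists>T. open T \<and> snd c p \<in> T \<and> T \<subseteq> loc_dom c e (g \<circ> f) \<and> smooth_on T (loc_rep c e (g \<circ> f))"
    using T by blast
qed

lemma loc_dom_cong:
  "(\<And>p. p \<in> points A \<Longrightarrow> g p = f p) \<Longrightarrow> c \<in> A \<Longrightarrow> loc_dom c d g = loc_dom c d f"
  using pointsI[of c A] by (auto intro!: imageI)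

lemma smooth_map_cong:
  assumes A: "regular_atlas A" and f: "smooth_map A B f" and eq: "\<And>p. p \<in> points A \<Longrightarrow> g p = f p"
  shows "smooth_map A B g"
proof (rule smooth_mapI_local[OF A])
  show "g p \<in> points B" if "p \<in> points A" for p using smooth_map_points[OF f that] eq[OF that] by simp
  fix c d p assume c: "c \<in> A" and d: "d \<in> B" and p: "p \<in> fst c" "g p \<in> fst d"
  have dom: "loc_dom c d g = loc_dom c d f" by (rule loc_dom_cong[OF eq c])
  have "smooth_on (loc_dom c d f) (loc_rep c d g)"
  proof (rule smooth_on_cong[OF smooth_map_loc_dom[OF f c d] smooth_map_loc_rep[OF f c d]])
    fix x assume "x \<in> loc_dom c d f"
    then have "chart_inv c x \<in> points A" using pointsI[OF c chart_inv_in[of x c]] by blast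
    then show "loc_rep c d g x = loc_rep c d f x" by (simp add: eq)
  qed
  then show "\<exists>T. open T \<and> snd c p \<in> T \<and> T \<subseteq> loc_dom c d g \<and> smooth_on T (loc_rep c d g)"
    using smooth_map_loc_dom[OF f c d] p unfolding dom[symmetric] by blast
qed

lemma smooth_map_id: "banach_manifold A \<Longrightarrow> smooth_map A A (\<lambda>p. p)"
  by (simp add: smooth_map_def banach_manifold_def comp_def)

section \<open>Differentials in arbitrary charts\<close>

abbreviation ldiff :: "('p, 'e::real_normed_vector) chart \<Rightarrow> ('q, 'f::real_normed_vector) chart \<Rightarrow> ('p \<Rightarrow> 'q) \<Rightarrow> 'p \<Rightarrow> 'e \<Rightarrow> 'f" where
  "ldiff c d f p \<equiv> fderiv (loc_rep c d f) (snd c p)"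

lemma smooth_map_differentiable:
  assumes "smooth_map A B f" "c \<in> A" "p \<in> fst c" "d \<in> B" "f p \<in> fst d"
  shows "loc_rep c d f differentiable (at (snd c p))"
  using assms by (intro smooth_on_differentiable[OF smooth_map_loc_dom smooth_map_loc_rep]) auto

lemma ldiff_compose:
  assumes A: "regular_atlas A" and B: "regular_atlas B" and f: "smooth_map A B f" and g: "smooth_map B C g"
    and c: "c \<in> A" "p \<in> fst c" and d: "d \<in> B" "f p \<in> fst d" and e: "e \<in> C" "g (f p) \<in> fst e"
  shows "ldiff c e (g \<circ> f) p v = ldiff d e g (f p) (ldiff c d f p v)"
proof -
  obtain T where T: "open T" "snd c p \<in> T"
    "\<forall>x\<in>T. loc_rep c e (g \<circ> f) x = loc_rep d e g (loc_rep c d f x)"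
    using smooth_map_compose_chart[OF assms] by blast
  have eq: "loc_rep c d f (snd c p) = snd d (f p)" using A c by simp
  have "((\<lambda>x. loc_rep d e g (loc_rep c d f x)) has_derivative (\<lambda>v. ldiff d e g (f p) (ldiff c d f p v))) (at (snd c p))"
    by (rule has_derivative_compose[OF fderiv_works[OF smooth_map_differentiable[OF f c d]]])
       (unfold eq, rule fderiv_works[OF smooth_map_differentiable[OF g d e]])
  then have "(loc_rep c e (g \<circ> f) has_derivative (\<lambda>v. ldiff d e g (f p) (ldiff c d f p v))) (at (snd c p))"
    by (rule has_derivative_transform_within_open[OF _ T(1,2)]) (use T(3) in metis)
  then show ?thesis by (simp add: fderiv_eq)
qed

lemma ldiff_cong:
  assumes A: "regular_atlas A" and f: "smooth_map A B f" and eq: "\<And>p. p \<in> points A \<Longrightarrow> g p = f p"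
    and c: "c \<in> A" "p \<in> fst c" and d: "d \<in> B" "f p \<in> fst d"
  shows "ldiff c d g p = ldiff c d f p"
proof (rule fderiv_cong_open[OF smooth_map_differentiable[OF f c d] regular_atlas_open[OF A c(1)]])
  show "snd c p \<in> snd c ` fst c" using c by simp
  fix x assume "x \<in> snd c ` fst c"
  then show "loc_rep c d f x = loc_rep c d g x"
    using eq[OF pointsI[OF c(1) chart_inv_in[of x c]]] by simp
qed

lemma ldiff_id:
  assumes A: "regular_atlas A" and c: "c \<in> A" "p \<in> fst c"
  shows "ldiff c c (\<lambda>p. p) p = (\<lambda>v. v)"
proof -
  have "ldiff c c (\<lambda>p. p) p = fderiv (\<lambda>x. x) (snd c p)"
    by (rule fderiv_cong_open[OF differentiable_ident regular_atlas_open[OF A c(1)]])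
       (use c in \<open>auto simp: chart_inv_right\<close>)
  then show ?thesis by simp
qed

lemma coord_change_eq: "coord_change A c p = ldiff (chart_at A p) c (\<lambda>p. p) p"
  by (simp add: coord_change_def comp_def)

lemma differential_eq: "differential A B f p = ldiff (chart_at A p) (chart_at B (f p)) f p"
  by (simp add: differential_def)

lemma coord_change_chart_at:
  assumes "banach_manifold A" "p \<in> points A"
  shows "coord_change A (chart_at A p) p = (\<lambda>v. v)"
  unfolding coord_change_eq
  using ldiff_id[OF banach_manifold_regular[OF assms(1)]] chart_at_in[OF assms(2)] by blast

lemma coord_change_compose:
  assumes A: "banach_manifold A" and c: "c \<in> A" "p \<in> fst c" and d: "d \<in> A" "p \<in> fst d"
  shows "ldiff c d (\<lambda>p. p) p (coord_change A c p v) = coord_change A d p v"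
  unfolding coord_change_eq
  using ldiff_compose[OF banach_manifold_regular[OF A] banach_manifold_regular[OF A] smooth_map_id[OF A] smooth_map_id[OF A],
      of "chart_at A p" p c d v] chart_at_in[OF pointsI[OF c]] c d
  by (simp add: comp_def)

lemma coord_change_inverse:
  assumes A: "banach_manifold A" and c: "c \<in> A" "p \<in> fst c"
  shows "ldiff c (chart_at A p) (\<lambda>p. p) p (coord_change A c p v) = v"
    and "coord_change A c p (ldiff c (chart_at A p) (\<lambda>p. p) p v) = v"
proof -
  have p: "chart_at A p \<in> A" "p \<in> fst (chart_at A p)" using chart_at_in[OF pointsI[OF c]] by auto
  note R = banach_manifold_regular[OF A] and I = smooth_map_id[OF A]
  show "ldiff c (chart_at A p) (\<lambda>p. p) p (coord_change A c p v) = v"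
    unfolding coord_change_compose[OF A c p] coord_change_chart_at[OF A pointsI[OF c]] ..
  show "coord_change A c p (ldiff c (chart_at A p) (\<lambda>p. p) p v) = v"
    unfolding coord_change_eq
    using ldiff_compose[OF R R I I c p c, of v] ldiff_id[OF R c] by (simp add: comp_def)
qed

text \<open>\<open>differential\<close> refers to the fixed charts \<open>chart_at\<close>,
  calculations refer to arbitrary ones. Both sides equal the derivative of f from
  \<open>chart_at A p\<close> to d, by the chain rule for f preceded or followed by the
  identity.\<close>

lemma ldiff_coord_change:
  assumes A: "banach_manifold A" and B: "banach_manifold B" and f: "smooth_map A B f"
    and c: "c \<in> A" "p \<in> fst c" and d: "d \<in> B" "f p \<in> fst d"
  shows "ldiff c d f p (coord_change A c p v) = coord_change B d (f p) (differential A B f p v)"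
proof -
  let ?c = "chart_at A p" and ?d = "chart_at B (f p)"
  have p: "?c \<in> A" "p \<in> fst ?c" using chart_at_in[OF pointsI[OF c]] by auto
  have q: "?d \<in> B" "f p \<in> fst ?d" using chart_at_in[OF pointsI[OF d]] by auto
  note RA = banach_manifold_regular[OF A] and RB = banach_manifold_regular[OF B]
  have "ldiff c d f p (coord_change A c p v) = ldiff ?c d f p v"
    unfolding coord_change_eq
    using ldiff_compose[OF RA RA smooth_map_id[OF A] f p c d, of v] by (simp add: comp_def)
  also have "\<dots> = coord_change B d (f p) (differential A B f p v)"
    unfolding coord_change_eq differential_eq
    using ldiff_compose[OF RA RB f smooth_map_id[OF B] p q d, of v] by (simp add: comp_def)
  finally show ?thesis .
qed

lemma differential_compose:
  assumes A: "banach_manifold A" and B: "banach_manifold B" and C: "banach_manifold C"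
    and f: "smooth_map A B f" and g: "smooth_map B C g" and p: "p \<in> points A"
  shows "differential A C (g \<circ> f) p v = differential B C g (f p) (differential A B f p v)"
proof -
  have e: "(g \<circ> f) p = g (f p)" by simp
  show ?thesis
    unfolding differential_eq e
    by (rule ldiff_compose[OF banach_manifold_regular[OF A] banach_manifold_regular[OF B] f g])
       (simp_all add: chart_at_in[OF p] chart_at_in[OF smooth_map_points[OF f p]]
          chart_at_in[OF smooth_map_points[OF g smooth_map_points[OF f p]]])
qed

lemma differential_cong:
  assumes A: "banach_manifold A" and f: "smooth_map A B f" and eq: "\<And>p. p \<in> points A \<Longrightarrow> g p = f p" and p: "p \<in> points A"
  shows "differential A B g p = differential A B f p"
  unfolding differential_eq eq[OF p]
  using ldiff_cong[OF banach_manifold_regular[OF A] f eq, of "chart_at A p" p "chart_at B (f p)"]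
    chart_at_in[OF p] chart_at_in[OF smooth_map_points[OF f p]] by simp

text \<open>In charts \<pi> becomes a map P with surjective derivatives, and the composite of f with
  \<pi> becomes the representative of f after P. The set U is small enough for both to take values
  in the chosen charts; its image under P is open and serves as the neighbourhood on which the
  representative of f is smooth.\<close>

lemma smooth_map_descent:
  fixes A :: "('p, 'e::banach) atlas" and M :: "('q, 'm::banach) atlas" and C :: "('r, 'f::banach) atlas"
  assumes A: "banach_manifold A" and M: "banach_manifold M"
    and \<pi>: "smooth_map A M \<pi>" "\<pi> ` points A = points M" "\<And>h. h \<in> points A \<Longrightarrow> surj (differential A M \<pi> h)"
    and f: "smooth_map A C (f \<circ> \<pi>)"
  shows "smooth_map M C f"
proof (rule smooth_mapI_local[OF banach_manifold_regular[OF M]])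
  note RA = banach_manifold_regular[OF A] and RM = banach_manifold_regular[OF M]
  show "f p \<in> points C" if "p \<in> points M" for p
    using that smooth_map_points[OF f] unfolding \<pi>(2)[symmetric] by auto
  fix c e p assume c: "c \<in> M" and e: "e \<in> C" and p: "p \<in> fst c" "f p \<in> fst e"
  obtain h where h: "h \<in> points A" "p = \<pi> h" using pointsI[OF c p(1)] \<pi>(2) by blast
  obtain a where a: "a \<in> A" "h \<in> fst a" using h(1) unfolding points_iff by blast
  define U where "U = loc_dom a c \<pi> \<inter> loc_dom a e (f \<circ> \<pi>)"
  define P where "P = loc_rep a c \<pi>"
  have oU: "open U" unfolding U_def by (intro open_Int smooth_map_loc_dom[OF \<pi>(1) a(1) c] smooth_map_loc_dom[OF f a(1) e])
  have P: "smooth_on U P" unfolding P_def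
    by (rule smooth_on_subset[OF smooth_map_loc_dom[OF \<pi>(1) a(1) c] smooth_map_loc_rep[OF \<pi>(1) a(1) c] oU])
       (simp add: U_def)
  have U_iff: "x \<in> U \<longleftrightarrow> x \<in> snd a ` fst a \<and> \<pi> (chart_inv a x) \<in> fst c \<and> f (\<pi> (chart_inv a x)) \<in> fst e" for x
    unfolding U_def Int_iff mem_loc_dom_iff[OF RA a(1)] by auto
  have sP: "surj (fderiv P x)" if x: "x \<in> U" for x
  proof -
    define k where "k = chart_inv a x"
    have k: "k \<in> fst a" "\<pi> k \<in> fst c" "snd a k = x"
      using x unfolding U_iff k_def by (auto simp: chart_inv_in chart_inv_right)
    have "\<exists>v. fderiv P x v = y" for y
    proof -
      obtain v where v: "differential A M \<pi> k v = ldiff c (chart_at M (\<pi> k)) (\<lambda>p. p) (\<pi> k) y"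
        using \<pi>(3)[OF pointsI[OF a(1) k(1)]] by (metis surjD)
      have "fderiv P x (coord_change A a k v) = y"
        using ldiff_coord_change[OF A M \<pi>(1) a(1) k(1) c k(2), of v] coord_change_inverse(2)[OF M c k(2), of y]
        unfolding P_def v k(3) by simp
      then show ?thesis by blast
    qed
    then show ?thesis by (metis surjI)
  qed
  have oV: "open (P ` U)" by (rule open_image_submersion[OF oU P sP])
  have PU: "P x = snd c (\<pi> (chart_inv a x))" "P x \<in> snd c ` fst c" "chart_inv c (P x) = \<pi> (chart_inv a x)" if "x \<in> U" for x
    using that RM c unfolding U_iff P_def by auto
  have "smooth_on (P ` U) (loc_rep c e f)"
  proof (rule smooth_on_descent[OF oU P sP oV])
    have "smooth_on U (loc_rep a e (f \<circ> \<pi>))"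
      by (rule smooth_on_subset[OF smooth_map_loc_dom[OF f a(1) e] smooth_map_loc_rep[OF f a(1) e] oU])
         (simp add: U_def)
    then show "smooth_on U (\<lambda>x. loc_rep c e f (P x))"
      by (rule smooth_on_cong[OF oU]) (simp add: PU(3))
  qed
  moreover have "P ` U \<subseteq> loc_dom c e f"
  proof
    fix y assume "y \<in> P ` U"
    then obtain x where x: "x \<in> U" "y = P x" by blast
    show "y \<in> loc_dom c e f"
      unfolding mem_loc_dom_iff[OF RM c] using PU[OF x(1)] x U_iff by auto
  qed
  moreover have "snd c p \<in> P ` U"
  proof
    show "snd a h \<in> U" unfolding U_iff using a h p RA by simp
    show "snd c p = P (snd a h)" unfolding P_def using a h RA by simp
  qed
  ultimately show "\<exists>T. open T \<and> snd c p \<in> T \<and> T \<subseteq> loc_dom c e f \<and> smooth_on T (loc_rep c e f)"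
    using oV by blast
qed

section \<open>Tangent bundles and products\<close>

abbreviation tangent_chart :: "('p, 'e::real_normed_vector) atlas \<Rightarrow> ('p, 'e) chart \<Rightarrow> ('p \<times> 'e, 'e \<times> 'e) chart" where
  "tangent_chart A c \<equiv> (fst c \<times> UNIV, \<lambda>(p, \<xi>). (snd c p, coord_change A c p \<xi>))"

lemma tangent_chart_in: "c \<in> A \<Longrightarrow> tangent_chart A c \<in> tangent_bundle A"
  by (simp add: tangent_bundle_def)

lemma tangent_chart_inj:
  assumes "banach_manifold A" "c \<in> A"
  shows "inj_on (snd (tangent_chart A c)) (fst (tangent_chart A c))"
proof (rule inj_onI)
  fix x y assume x: "x \<in> fst (tangent_chart A c)" and y: "y \<in> fst (tangent_chart A c)"
    and eq: "snd (tangent_chart A c) x = snd (tangent_chart A c) y"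
  obtain p \<xi> where p: "x = (p, \<xi>)" "p \<in> fst c" using x by auto
  obtain q \<eta> where q: "y = (q, \<eta>)" "q \<in> fst c" using y by auto
  have "snd c p = snd c q" and cc: "coord_change A c p \<xi> = coord_change A c q \<eta>" using eq p q by auto
  then have "p = q" using p q chart_inv_left[OF banach_manifold_regular[OF assms(1)] assms(2)] by metis
  moreover have "\<xi> = \<eta>"
    using coord_change_inverse(1)[OF assms p(2)] cc unfolding \<open>p = q\<close> by metis
  ultimately show "x = y" using p q by simp
qed

lemma tangent_chart_image:
  fixes A :: "('p, 'e::banach) atlas"
  assumes "banach_manifold A" "c \<in> A"
  shows "snd (tangent_chart A c) ` fst (tangent_chart A c) = (snd c ` fst c) \<times> UNIV"
proof
  show "(snd c ` fst c) \<times> UNIV \<subseteq> snd (tangent_chart A c) ` fst (tangent_chart A c)"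
  proof
    fix z assume "z \<in> (snd c ` fst c) \<times> (UNIV :: 'e set)"
    then obtain p \<eta> where p: "z = (snd c p, \<eta>)" "p \<in> fst c" by auto
    have "z = snd (tangent_chart A c) (p, ldiff c (chart_at A p) (\<lambda>p. p) p \<eta>)"
      using coord_change_inverse(2)[OF assms p(2), of \<eta>] p(1) by simp
    moreover have "(p, ldiff c (chart_at A p) (\<lambda>p. p) p \<eta>) \<in> fst (tangent_chart A c)" using p(2) by simp
    ultimately show "z \<in> snd (tangent_chart A c) ` fst (tangent_chart A c)" by (rule image_eqI)
  qed
qed auto

lemma tangent_bundle_regular: "banach_manifold A \<Longrightarrow> regular_atlas (tangent_bundle A)"
  unfolding regular_atlas_def
proof
  fix t assume A: "banach_manifold A" and t: "t \<in> tangent_bundle A"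
  obtain c where c: "c \<in> A" "t = tangent_chart A c" using t unfolding tangent_bundle_def by blast
  show "inj_on (snd t) (fst t) \<and> open (snd t ` fst t)"
    unfolding c(2) using tangent_chart_inj[OF A c(1)] tangent_chart_image[OF A c(1)]
      open_Times[OF regular_atlas_open[OF banach_manifold_regular[OF A] c(1)] open_UNIV] by simp
qed

lemma points_tangent_bundle: "points (tangent_bundle A) = points A \<times> UNIV"
  by (auto simp: points_def tangent_bundle_def)

lemma chart_inv_tangent_chart:
  assumes "banach_manifold A" "c \<in> A" "p \<in> fst c"
  shows "chart_inv (tangent_chart A c) (snd c p, coord_change A c p \<xi>) = (p, \<xi>)"
  using chart_inv_left[OF tangent_bundle_regular[OF assms(1)] tangent_chart_in[OF assms(2)], of "(p, \<xi>)"] assms(3)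
  by simp

lemma smooth_map_tangentI:
  assumes A: "regular_atlas A" and f: "smooth_map A M f"
    and V: "\<And>a d. a \<in> A \<Longrightarrow> d \<in> M \<Longrightarrow>
      smooth_on (loc_dom a d f) (\<lambda>x. coord_change M d (f (chart_inv a x)) (V (chart_inv a x)))"
  shows "smooth_map A (tangent_bundle M) (\<lambda>h. (f h, V h))"
proof (rule smooth_mapI_local[OF A])
  show "(f p, V p) \<in> points (tangent_bundle M)" if "p \<in> points A" for p
    using smooth_map_points[OF f that] by (simp add: points_tangent_bundle)
  fix a t p assume a: "a \<in> A" and t: "t \<in> tangent_bundle M" and p: "p \<in> fst a" "(f p, V p) \<in> fst t"
  obtain d where d: "d \<in> M" "t = tangent_chart M d" using t unfolding tangent_bundle_def by blast
  have p': "f p \<in> fst d" using p(2) d(2) by simp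
  note o = smooth_map_loc_dom[OF f a d(1)]
  have "smooth_on (loc_dom a d f) (\<lambda>x. (loc_rep a d f x, coord_change M d (f (chart_inv a x)) (V (chart_inv a x))))"
    by (rule smooth_on_Pair[OF o smooth_map_loc_rep[OF f a d(1)] V[OF a d(1)]])
  then have "smooth_on (loc_dom a d f) (loc_rep a t (\<lambda>h. (f h, V h)))"
    by (rule smooth_on_cong[OF o]) (simp add: d(2))
  moreover have "loc_dom a d f \<subseteq> loc_dom a t (\<lambda>h. (f h, V h))" using d(2) by auto
  moreover have "snd a p \<in> loc_dom a d f" using p p' by blast
  ultimately show "\<exists>T. open T \<and> snd a p \<in> T \<and> T \<subseteq> loc_dom a t (\<lambda>h. (f h, V h)) \<and>
      smooth_on T (loc_rep a t (\<lambda>h. (f h, V h)))" using o by blast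
qed

lemma vector_field_smooth_on:
  assumes M: "banach_manifold M" and X: "vector_field M X" and c: "c \<in> M"
  shows "smooth_on (snd c ` fst c) (local_rep M c X)"
proof -
  let ?t = "tangent_chart M c" and ?\<sigma> = "\<lambda>p. (p, X p)"
  have S: "smooth_map M (tangent_bundle M) ?\<sigma>" using X by (simp add: vector_field_def)
  have dom: "loc_dom c ?t ?\<sigma> = snd c ` fst c" by auto
  note o = regular_atlas_open[OF banach_manifold_regular[OF M] c]
  have "smooth_on (snd c ` fst c) (loc_rep c ?t ?\<sigma>)"
    using smooth_map_loc_rep[OF S c tangent_chart_in[OF c]] unfolding dom .
  then have "smooth_on (snd c ` fst c) (\<lambda>x. snd (loc_rep c ?t ?\<sigma> x))"
    by (rule smooth_on_bounded_linear[OF o bounded_linear_snd])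
  then show ?thesis
    by (rule smooth_on_cong[OF o]) (simp add: local_rep_def)
qed

text \<open>The fibre component of the representative of a bundle map: coordinates with respect to c
  are converted to the reference chart, where \<open>\<N> p\<close> acts, and back. As a function of
  a pair it is an ordinary smooth map on an open subset of the product space, to which the chain
  rule applies.\<close>

definition local_bundle_map :: "('p, 'e::real_normed_vector) atlas \<Rightarrow> ('p, 'e) chart \<Rightarrow> ('p \<Rightarrow> 'e \<Rightarrow> 'e) \<Rightarrow> 'e \<times> 'e \<Rightarrow> 'e" where
  "local_bundle_map A c \<N> z = (let p = chart_inv c (fst z) in
     coord_change A c p (\<N> p (ldiff c (chart_at A p) (\<lambda>p. p) p (snd z))))"

lemma local_bundle_map_coord_change:
  assumes A: "banach_manifold A" and c: "c \<in> A" "p \<in> fst c"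
  shows "local_bundle_map A c \<N> (snd c p, coord_change A c p \<xi>) = coord_change A c p (\<N> p \<xi>)"
  using coord_change_inverse(1)[OF A c] chart_inv_left[OF banach_manifold_regular[OF A] c]
  by (simp add: local_bundle_map_def)

lemma bundle_map_smooth_on:
  fixes A :: "('p, 'e::banach) atlas"
  assumes A: "banach_manifold A" and N: "bundle_map A \<N>" and c: "c \<in> A"
  shows "smooth_on ((snd c ` fst c) \<times> UNIV) (local_bundle_map A c \<N>)"
proof -
  let ?t = "tangent_chart A c" and ?n = "\<lambda>(p, \<xi>). (p, \<N> p \<xi>)"
  have S: "smooth_map (tangent_bundle A) (tangent_bundle A) ?n" using N by (simp add: bundle_map_def)
  have "fst ?t \<inter> ?n -` fst ?t = fst ?t" by auto
  then have dom: "loc_dom ?t ?t ?n = (snd c ` fst c) \<times> UNIV"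
    using tangent_chart_image[OF A c] by simp
  have o: "open ((snd c ` fst c) \<times> (UNIV :: 'e set))"
    by (intro open_Times regular_atlas_open[OF banach_manifold_regular[OF A] c] open_UNIV)
  have "smooth_on ((snd c ` fst c) \<times> UNIV) (loc_rep ?t ?t ?n)"
    using smooth_map_loc_rep[OF S tangent_chart_in[OF c] tangent_chart_in[OF c]] unfolding dom .
  then have "smooth_on ((snd c ` fst c) \<times> UNIV) (\<lambda>z. snd (loc_rep ?t ?t ?n z))"
    by (rule smooth_on_bounded_linear[OF o bounded_linear_snd])
  then show ?thesis
  proof (rule smooth_on_cong[OF o])
    fix z assume "z \<in> (snd c ` fst c) \<times> (UNIV :: 'e set)"
    then obtain p \<eta> where p: "z = (snd c p, \<eta>)" "p \<in> fst c" by auto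
    define \<xi> where "\<xi> = ldiff c (chart_at A p) (\<lambda>p. p) p \<eta>"
    have z: "z = (snd c p, coord_change A c p \<xi>)"
      unfolding p(1) \<xi>_def using coord_change_inverse(2)[OF A c p(2)] by simp
    show "local_bundle_map A c \<N> z = snd (loc_rep ?t ?t ?n z)"
      unfolding z local_bundle_map_coord_change[OF A c p(2)] comp_apply chart_inv_tangent_chart[OF A c p(2)]
      by simp
  qed
qed

section \<open>Product atlases and partial derivatives\<close>

abbreviation prod_chart :: "('p, 'e) chart \<Rightarrow> ('q, 'f) chart \<Rightarrow> ('p \<times> 'q, 'e \<times> 'f) chart" where
  "prod_chart c d \<equiv> (fst c \<times> fst d, map_prod (snd c) (snd d))"

lemma prod_chart_in: "c \<in> A \<Longrightarrow> d \<in> B \<Longrightarrow> prod_chart c d \<in> prod_atlas A B"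
  unfolding prod_atlas_def by (intro CollectI exI[of _ c] exI[of _ d]) simp

lemma prod_atlasE:
  assumes "t \<in> prod_atlas A B"
  obtains c d where "c \<in> A" "d \<in> B" "t = prod_chart c d"
  using assms unfolding prod_atlas_def by blast

lemma prod_atlas_regular:
  assumes "regular_atlas A" "regular_atlas B"
  shows "regular_atlas (prod_atlas A B)"
  unfolding regular_atlas_def
proof
  fix t assume "t \<in> prod_atlas A B"
  then obtain c d where cd: "c \<in> A" "d \<in> B" "t = prod_chart c d" by (rule prod_atlasE)
  have "snd t ` fst t = (snd c ` fst c) \<times> (snd d ` fst d)" unfolding cd(3) by force
  moreover have "inj_on (snd t) (fst t)"
    unfolding cd(3) snd_conv fst_conv using assms cd(1,2) by (intro map_prod_inj_on) (auto simp: regular_atlas_def)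
  ultimately show "inj_on (snd t) (fst t) \<and> open (snd t ` fst t)"
    using assms cd(1,2) by (simp add: open_Times regular_atlas_open)
qed

lemma points_prod_atlas: "points (prod_atlas A B) = points A \<times> points B"
proof (intro Set.set_eqI iffI)
  fix z assume "z \<in> points (prod_atlas A B)"
  then obtain t where t: "t \<in> prod_atlas A B" "z \<in> fst t" unfolding points_iff by blast
  obtain c d where "c \<in> A" "d \<in> B" "t = prod_chart c d" using t(1) by (rule prod_atlasE)
  then show "z \<in> points A \<times> points B" using t(2) by (auto intro: pointsI)
next
  fix z assume "z \<in> points A \<times> points B"
  then obtain p q c d where "z = (p, q)" "c \<in> A" "p \<in> fst c" "d \<in> B" "q \<in> fst d"
    by (auto simp: points_iff)
  then show "z \<in> points (prod_atlas A B)" using pointsI[OF prod_chart_in[of c A d B]] by simp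
qed

lemma chart_inv_prod_chart:
  assumes "regular_atlas A" "regular_atlas B" "c \<in> A" "d \<in> B" "p \<in> fst c" "q \<in> fst d"
  shows "chart_inv (prod_chart c d) (snd c p, snd d q) = (p, q)"
  using chart_inv_left[OF prod_atlas_regular[OF assms(1,2)] prod_chart_in[OF assms(3,4)], of "(p, q)"] assms(5,6)
  by simp

lemma smooth_map_Pair_const:
  assumes A: "banach_manifold A" and h: "h \<in> points B"
  shows "smooth_map A (prod_atlas A B) (\<lambda>k. (k, h))" and "smooth_map A (prod_atlas B A) (\<lambda>k. (h, k))"
proof -
  note R = banach_manifold_regular[OF A] and I = smooth_map_id[OF A]
  show "smooth_map A (prod_atlas A B) (\<lambda>k. (k, h))"
  proof (rule smooth_mapI_local[OF R])
    show "(p, h) \<in> points (prod_atlas A B)" if "p \<in> points A" for p using that h by (simp add: points_prod_atlas)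
    fix a t p assume a: "a \<in> A" and t: "t \<in> prod_atlas A B" and p: "p \<in> fst a" "(p, h) \<in> fst t"
    obtain c d where cd: "c \<in> A" "d \<in> B" "t = prod_chart c d" using t by (rule prod_atlasE)
    note o = smooth_map_loc_dom[OF I a cd(1)]
    have "smooth_on (loc_dom a c (\<lambda>p. p)) (\<lambda>x. (loc_rep a c (\<lambda>p. p) x, snd d h))"
      by (rule smooth_on_Pair[OF o smooth_map_loc_rep[OF I a cd(1)] smooth_on_const[OF o]])
    then have "smooth_on (loc_dom a c (\<lambda>p. p)) (loc_rep a t (\<lambda>k. (k, h)))"
      by (rule smooth_on_cong[OF o]) (simp add: cd(3))
    moreover have "loc_dom a c (\<lambda>p. p) \<subseteq> loc_dom a t (\<lambda>k. (k, h))" using cd(3) p(2) by auto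
    moreover have "snd a p \<in> loc_dom a c (\<lambda>p. p)" using p cd(3) by auto
    ultimately show "\<exists>T. open T \<and> snd a p \<in> T \<and> T \<subseteq> loc_dom a t (\<lambda>k. (k, h)) \<and> smooth_on T (loc_rep a t (\<lambda>k. (k, h)))"
      using o by blast
  qed
  show "smooth_map A (prod_atlas B A) (\<lambda>k. (h, k))"
  proof (rule smooth_mapI_local[OF R])
    show "(h, p) \<in> points (prod_atlas B A)" if "p \<in> points A" for p using that h by (simp add: points_prod_atlas)
    fix a t p assume a: "a \<in> A" and t: "t \<in> prod_atlas B A" and p: "p \<in> fst a" "(h, p) \<in> fst t"
    obtain d c where cd: "d \<in> B" "c \<in> A" "t = prod_chart d c" using t by (rule prod_atlasE)
    note o = smooth_map_loc_dom[OF I a cd(2)]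
    have "smooth_on (loc_dom a c (\<lambda>p. p)) (\<lambda>x. (snd d h, loc_rep a c (\<lambda>p. p) x))"
      by (rule smooth_on_Pair[OF o smooth_on_const[OF o] smooth_map_loc_rep[OF I a cd(2)]])
    then have "smooth_on (loc_dom a c (\<lambda>p. p)) (loc_rep a t (\<lambda>k. (h, k)))"
      by (rule smooth_on_cong[OF o]) (simp add: cd(3))
    moreover have "loc_dom a c (\<lambda>p. p) \<subseteq> loc_dom a t (\<lambda>k. (h, k))" using cd(3) p(2) by auto
    moreover have "snd a p \<in> loc_dom a c (\<lambda>p. p)" using p cd(3) by auto
    ultimately show "\<exists>T. open T \<and> snd a p \<in> T \<and> T \<subseteq> loc_dom a t (\<lambda>k. (h, k)) \<and> smooth_on T (loc_rep a t (\<lambda>k. (h, k)))"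
      using o by blast
  qed
qed

text \<open>The partial derivative at k in direction v is the full derivative of the local
  representative in direction (v, 0), hence smooth in the second variable. The smoothness of
  fundamental and of left-invariant fields rests on this.\<close>

lemma partial_ldiff_smooth:
  assumes A: "regular_atlas A" and B: "regular_atlas B" and F: "smooth_map (prod_atlas A B) C F"
    and a: "a \<in> A" "k \<in> fst a" and b: "b \<in> B" and e: "e \<in> C"
  shows "open {x \<in> snd b ` fst b. F (k, chart_inv b x) \<in> fst e}"
    and "smooth_on {x \<in> snd b ` fst b. F (k, chart_inv b x) \<in> fst e} (\<lambda>x. ldiff a e (\<lambda>k. F (k, chart_inv b x)) k v)"
proof -
  let ?p = "prod_chart a b" and ?S = "{x \<in> snd b ` fst b. F (k, chart_inv b x) \<in> fst e}"
  let ?T = "loc_dom ?p e F" and ?Q = "loc_rep ?p e F" and ?i = "\<lambda>x. (snd a k, x)"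
  note pin = prod_chart_in[OF a(1) b]
  note oT = smooth_map_loc_dom[OF F pin e] and Q = smooth_map_loc_rep[OF F pin e]
  note RP = prod_atlas_regular[OF A B]
  have S: "x \<in> ?S \<longleftrightarrow> ?i x \<in> ?T" for x
  proof
    assume x: "x \<in> ?S"
    then obtain q where q: "q \<in> fst b" "x = snd b q" by blast
    have "(k, q) \<in> fst ?p \<inter> F -` fst e" using x q a b B by simp
    from imageI[OF this, of "snd ?p"] show "?i x \<in> ?T" using q by simp
  next
    assume "?i x \<in> ?T"
    then obtain k' q where q: "k' \<in> fst a" "q \<in> fst b" "F (k', q) \<in> fst e" "snd a k' = snd a k" "x = snd b q"
      by auto
    then have "k' = k" using chart_inv_left[OF A a(1)] a(2) by metis
    then show "x \<in> ?S" using q b B by simp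
  qed
  have eq: "?S = ?i -` ?T" by (rule Set.set_eqI) (unfold vimage_eq, rule S)
  show oS: "open ?S" unfolding eq by (rule open_vimage[OF oT]) (intro continuous_intros)
  have "smooth_on ?S (\<lambda>x. fderiv ?Q (?i x) (v, 0))"
  proof (rule smooth_on_fderiv_compose[OF oT Q oS])
    show "smooth_on ?S ?i"
      by (intro smooth_on_Pair oS smooth_on_const smooth_on_linear bounded_linear_ident)
  qed (rule iffD1[OF S])
  then show "smooth_on ?S (\<lambda>x. ldiff a e (\<lambda>k. F (k, chart_inv b x)) k v)"
  proof (rule smooth_on_cong[OF oS])
    fix x assume x: "x \<in> ?S"
    then have xb: "x \<in> snd b ` fst b" by blast
    have "((\<lambda>y. ?Q (y, x)) has_derivative (\<lambda>v. fderiv ?Q (?i x) (v, 0))) (at (snd a k))"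
    proof (rule has_derivative_compose[where f="\<lambda>y. (y, x)" and g="?Q"])
      show "((\<lambda>y. (y, x)) has_derivative (\<lambda>v. (v, 0))) (at (snd a k))"
        by (intro has_derivative_Pair has_derivative_ident has_derivative_const)
      show "(?Q has_derivative fderiv ?Q (?i x)) (at (snd a k, x))"
        by (rule fderiv_works[OF smooth_on_differentiable[OF oT Q iffD1[OF S x]]])
    qed
    then have "(loc_rep a e (\<lambda>k. F (k, chart_inv b x)) has_derivative (\<lambda>v. fderiv ?Q (?i x) (v, 0))) (at (snd a k))"
    proof (rule has_derivative_transform_within_open[OF _ regular_atlas_open[OF A a(1)]])
      fix y assume y: "y \<in> snd a ` fst a"
      have "chart_inv ?p (y, x) = (chart_inv a y, chart_inv b x)"
        using chart_inv_prod_chart[OF A B a(1) b chart_inv_in[OF y] chart_inv_in[OF xb]]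
        by (simp add: chart_inv_right[OF y] chart_inv_right[OF xb])
      then show "?Q (y, x) = loc_rep a e (\<lambda>k. F (k, chart_inv b x)) y" by simp
    qed (use a in simp)
    then show "ldiff a e (\<lambda>k. F (k, chart_inv b x)) k v = fderiv ?Q (?i x) (v, 0)"
      by (simp add: fderiv_eq)
  qed
qed

text \<open>\<open>partial_ldiff_smooth\<close> differentiates in the first factor, whereas
  left-invariant fields require a derivative in the second factor of the multiplication; exchanging
  the factors reconciles the two.\<close>

lemma smooth_map_swap:
  assumes A: "banach_manifold A" and B: "banach_manifold B"
  shows "smooth_map (prod_atlas A B) (prod_atlas B A) prod.swap"
proof -
  note RA = banach_manifold_regular[OF A] and RB = banach_manifold_regular[OF B]
  note IA = smooth_map_id[OF A] and IB = smooth_map_id[OF B]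
  show ?thesis
  proof (rule smooth_mapI_local[OF prod_atlas_regular[OF RA RB]])
    show "prod.swap p \<in> points (prod_atlas B A)" if "p \<in> points (prod_atlas A B)" for p
      using that unfolding points_prod_atlas by auto
    fix t t' p assume t: "t \<in> prod_atlas A B" and t': "t' \<in> prod_atlas B A" and p: "p \<in> fst t" "prod.swap p \<in> fst t'"
    obtain a b where ab: "a \<in> A" "b \<in> B" "t = prod_chart a b" using t by (rule prod_atlasE)
    obtain b' a' where ab': "b' \<in> B" "a' \<in> A" "t' = prod_chart b' a'" using t' by (rule prod_atlasE)
    let ?Ta = "loc_dom a a' (\<lambda>p. p)" and ?Tb = "loc_dom b b' (\<lambda>p. p)"
    note oa = smooth_map_loc_dom[OF IA ab(1) ab'(2)] and ob = smooth_map_loc_dom[OF IB ab(2) ab'(1)]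
    have o: "open (?Ta \<times> ?Tb)" using oa ob by (rule open_Times)
    have split: "\<exists>q r. z = (snd a q, snd b r) \<and> q \<in> fst a \<and> q \<in> fst a' \<and> r \<in> fst b \<and> r \<in> fst b'"
      if z: "z \<in> ?Ta \<times> ?Tb" for z
    proof -
      from z have "fst z \<in> ?Ta" unfolding mem_Times_iff ..
      then obtain q where q: "fst z = snd a q" "q \<in> fst a \<inter> (\<lambda>p. p) -` fst a'" by (rule imageE)
      from z have "snd z \<in> ?Tb" unfolding mem_Times_iff ..
      then obtain r where r: "snd z = snd b r" "r \<in> fst b \<inter> (\<lambda>p. p) -` fst b'" by (rule imageE)
      show ?thesis using q(2) r(2) unfolding q(1)[symmetric] r(1)[symmetric]
        by (intro exI[of _ q] exI[of _ r]) (simp add: q(1)[symmetric] r(1)[symmetric])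
    qed
    have "smooth_on (?Ta \<times> ?Tb) (\<lambda>z. (loc_rep b b' (\<lambda>p. p) (snd z), loc_rep a a' (\<lambda>p. p) (fst z)))"
    proof (rule smooth_on_Pair[OF o])
      show "smooth_on (?Ta \<times> ?Tb) (\<lambda>z. loc_rep b b' (\<lambda>p. p) (snd z))"
        by (rule smooth_on_compose[OF o ob smooth_map_loc_rep[OF IB ab(2) ab'(1)] smooth_on_linear[OF o bounded_linear_snd]])
           (simp only: mem_Times_iff)
      show "smooth_on (?Ta \<times> ?Tb) (\<lambda>z. loc_rep a a' (\<lambda>p. p) (fst z))"
        by (rule smooth_on_compose[OF o oa smooth_map_loc_rep[OF IA ab(1) ab'(2)] smooth_on_linear[OF o bounded_linear_fst]])
           (simp only: mem_Times_iff)
    qed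
    then have "smooth_on (?Ta \<times> ?Tb) (loc_rep t t' prod.swap)"
    proof (rule smooth_on_cong[OF o])
      fix z assume z: "z \<in> ?Ta \<times> ?Tb"
      obtain q r where q: "z = (snd a q, snd b r)" "q \<in> fst a" "r \<in> fst b" using split[OF z] by metis
      show "loc_rep t t' prod.swap z = (loc_rep b b' (\<lambda>p. p) (snd z), loc_rep a a' (\<lambda>p. p) (fst z))"
        unfolding q(1) ab(3) ab'(3) comp_apply chart_inv_prod_chart[OF RA RB ab(1,2) q(2,3)]
        using chart_inv_left[OF RA ab(1) q(2)] chart_inv_left[OF RB ab(2) q(3)] by simp
    qed
    moreover have "snd t p \<in> ?Ta \<times> ?Tb"
    proof -
      have "fst p \<in> fst a \<inter> (\<lambda>p. p) -` fst a'" "snd p \<in> fst b \<inter> (\<lambda>p. p) -` fst b'"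
        using p unfolding ab(3) ab'(3) by (simp_all add: mem_Times_iff)
      from imageI[OF this(1), of "snd a"] imageI[OF this(2), of "snd b"] show ?thesis
        unfolding mem_Times_iff ab(3) by (simp only: fst_map_prod snd_map_prod snd_conv)
    qed
    moreover have "?Ta \<times> ?Tb \<subseteq> loc_dom t t' prod.swap"
    proof
      fix z assume z: "z \<in> ?Ta \<times> ?Tb"
      obtain q r where q: "z = (snd a q, snd b r)" "q \<in> fst a" "q \<in> fst a'" "r \<in> fst b" "r \<in> fst b'"
        using split[OF z] by metis
      have "(q, r) \<in> fst t \<inter> prod.swap -` fst t'" using q unfolding ab(3) ab'(3) by simp
      from imageI[OF this, of "snd t"] show "z \<in> loc_dom t t' prod.swap" using q unfolding ab(3) by simp
    qed
    ultimately show "\<exists>T. open T \<and> snd t p \<in> T \<and> T \<subseteq> loc_dom t t' prod.swap \<and> smooth_on T (loc_rep t t' prod.swap)"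
      using o by (intro exI[of _ "?Ta \<times> ?Tb"] conjI)
  qed
qed

lemma differential_linear:
  assumes "smooth_map A B f" "p \<in> points A"
  shows "linear (differential A B f p)"
  unfolding differential_eq
  using chart_at_in[OF assms(2)] chart_at_in[OF smooth_map_points[OF assms]]
  by (intro linear_frechet_derivative smooth_map_differentiable[OF assms(1)]) auto

lemma differential_id:
  assumes "banach_manifold A" "p \<in> points A"
  shows "differential A A (\<lambda>p. p) p = (\<lambda>v. v)"
  unfolding differential_eq
  using ldiff_id[OF banach_manifold_regular[OF assms(1)]] chart_at_in[OF assms(2)] by simp

section \<open>Nijenhuis torsion of a bundle map\<close>

text \<open>A bounded linear map is its own derivative, so the fibre direction contributes n itself
  and only the base direction carries new information.\<close>

lemma fderiv_fiberwise_linear: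
  assumes n: "n differentiable (at (y, \<xi>))" and lin: "bounded_linear (\<lambda>\<eta>. n (y, \<eta>))"
  shows "fderiv n (y, \<xi>) (k, \<eta>) = fderiv n (y, \<xi>) (k, 0) + n (y, \<eta>)"
proof -
  have "((\<lambda>\<eta>. n (y, \<eta>)) has_derivative (\<lambda>\<eta>. fderiv n (y, \<xi>) (0, \<eta>))) (at \<xi>)"
  proof (rule has_derivative_compose[where f="\<lambda>\<eta>. (y, \<eta>)" and g=n])
    show "((\<lambda>\<eta>. (y, \<eta>)) has_derivative (\<lambda>\<eta>. (0, \<eta>))) (at \<xi>)"
      by (intro has_derivative_Pair has_derivative_ident has_derivative_const)
    show "(n has_derivative fderiv n (y, \<xi>)) (at (y, \<xi>))" by (rule fderiv_works[OF n])
  qed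
  moreover have "((\<lambda>\<eta>. n (y, \<eta>)) has_derivative (\<lambda>\<eta>. n (y, \<eta>))) (at \<xi>)"
    by (rule bounded_linear.has_derivative[OF lin has_derivative_ident])
  ultimately have "(\<lambda>\<eta>. fderiv n (y, \<xi>) (0, \<eta>)) = (\<lambda>\<eta>. n (y, \<eta>))" by (rule has_derivative_unique)
  then have "fderiv n (y, \<xi>) (0, \<eta>) = n (y, \<eta>)" by (rule fun_cong)
  moreover have "fderiv n (y, \<xi>) (k, \<eta>) = fderiv n (y, \<xi>) ((k, 0) + (0, \<eta>))" by simp
  ultimately show ?thesis
    using linear_add[OF linear_frechet_derivative[OF n], of "(k, 0)" "(0, \<eta>)"] by simp
qed

lemma has_derivative_fiberwise:
  assumes n: "n differentiable (at (f x, X x))" and lin: "bounded_linear (\<lambda>\<eta>. n (f x, \<eta>))"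
    and f: "f differentiable (at x)" and X: "X differentiable (at x)"
  shows "((\<lambda>x. n (f x, X x)) has_derivative
    (\<lambda>k. fderiv n (f x, X x) (fderiv f x k, 0) + n (f x, fderiv X x k))) (at x)"
proof -
  have "((\<lambda>x. n (f x, X x)) has_derivative (\<lambda>k. fderiv n (f x, X x) (fderiv f x k, fderiv X x k))) (at x)"
    by (rule has_derivative_compose[where f="\<lambda>x. (f x, X x)" and g=n,
          OF has_derivative_Pair[OF fderiv_works[OF f] fderiv_works[OF X]] fderiv_works[OF n]])
  moreover have "(\<lambda>k. fderiv n (f x, X x) (fderiv f x k, fderiv X x k)) =
      (\<lambda>k. fderiv n (f x, X x) (fderiv f x k, 0) + n (f x, fderiv X x k))"
    by (rule ext) (rule fderiv_fiberwise_linear[OF n lin])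
  ultimately show ?thesis by (rule subst[rotated])
qed

text \<open>In the torsion the derivatives of the two fields cancel, only the derivative of the bundle map
  in the base direction survives.\<close>

lemma local_torsion:
  fixes n :: "'e::real_normed_vector \<times> 'e \<Rightarrow> 'e" and X Y :: "'e \<Rightarrow> 'e"
  assumes n: "\<And>\<xi>. n differentiable (at (y, \<xi>))" and lin: "bounded_linear (\<lambda>\<eta>. n (y, \<eta>))"
    and X: "X differentiable (at y)" and Y: "Y differentiable (at y)"
  defines "br \<equiv> \<lambda>U V. fderiv V y (U y) - fderiv U y (V y)"
    and "D \<equiv> \<lambda>k \<xi>. fderiv n (y, \<xi>) (k, 0)" and "L \<equiv> \<lambda>\<eta>. n (y, \<eta>)"
  shows "L (br (\<lambda>x. n (x, X x)) Y) + L (br X (\<lambda>x. n (x, Y x))) - br (\<lambda>x. n (x, X x)) (\<lambda>x. n (x, Y x)) - L (L (br X Y))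
    = L (D (X y) (Y y)) - L (D (Y y) (X y)) - D (L (X y)) (Y y) + D (L (Y y)) (X y)"
proof -
  interpret L: bounded_linear L unfolding L_def by (rule lin)
  have d: "fderiv (\<lambda>x. n (x, Z x)) y k = D k (Z y) + L (fderiv Z y k)" if "Z differentiable (at y)" for Z k
    unfolding D_def L_def
    using fderiv_eq[OF has_derivative_fiberwise[where f="\<lambda>x. x", OF n lin differentiable_ident that]] by simp
  have L: "n (y, \<eta>) = L \<eta>" for \<eta> by (simp add: L_def)
  show ?thesis
    unfolding br_def d[OF X] d[OF Y] L by (simp add: L.add L.diff)
qed

text \<open>Here \<open>q v k\<close> stands for the derivative in direction k of the lifted field
  of v, \<open>T\<close> for the differential of the projection and \<open>L\<close> for the bundle
  map on the fibre. The hypothesis on \<open>D\<close> is the differentiated homogeneity identity.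
  Substituting it gives eight terms, which pair up into antisymmetrised \<open>q\<close>, that is
  into the four brackets.\<close>

lemma lifted_torsion:
  assumes L: "linear L" and T: "linear T" and LT: "\<And>v. L (T v) = T (N v)"
    and D: "\<And>k v. D (T k) (T v) = q (N v) k - L (q v k)"
    and br: "\<And>v w. q w v - q v w = T (br v w)"
  shows "L (D (T v) (T w)) - L (D (T w) (T v)) - D (L (T v)) (T w) + D (L (T w)) (T v)
    = T (N (br v (N w)) + N (br (N v) w) - br (N v) (N w) - N (N (br v w)))"
proof -
  have "L (D (T v) (T w)) - L (D (T w) (T v)) - D (L (T v)) (T w) + D (L (T w)) (T v)
    = L (q (N w) v - q v (N w)) + L (q w (N v) - q (N v) w) - (q (N w) (N v) - q (N v) (N w)) - L (L (q w v - q v w))"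
    unfolding LT D by (simp add: linear_diff[OF L] linear_add[OF L] algebra_simps)
  also have "\<dots> = T (N (br v (N w)) + N (br (N v) w) - br (N v) (N w) - N (N (br v w)))"
    unfolding br LT by (simp add: linear_diff[OF T] linear_add[OF T])
  finally show ?thesis .
qed

lemma nijenhuis_torsion_local:
  fixes M :: "('p, 'm::banach) atlas"
  assumes M: "banach_manifold M" and N: "bundle_map M \<N>" and X: "vector_field M X" and Y: "vector_field M Y"
    and p: "p \<in> points M"
  defines "c \<equiv> chart_at M p"
  defines "D \<equiv> \<lambda>k \<xi>. fderiv (local_bundle_map M c \<N>) (snd c p, \<xi>) (k, 0)"
  shows "nijenhuis_torsion M \<N> X Y p =
    \<N> p (D (X p) (Y p)) - \<N> p (D (Y p) (X p)) - D (\<N> p (X p)) (Y p) + D (\<N> p (Y p)) (X p)"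
proof -
  note R = banach_manifold_regular[OF M]
  have c: "c \<in> M" "p \<in> fst c" unfolding c_def using chart_at_in[OF p] by auto
  \<comment> \<open>The chart c is the reference chart of p itself, so values of fields and of the
    bundle map at p need no conversion.\<close>
  have cc: "coord_change M c p = (\<lambda>v. v)" unfolding c_def by (rule coord_change_chart_at[OF M p])
  define y where "y = snd c p"
  define n where "n = local_bundle_map M c \<N>"
  note oc = regular_atlas_open[OF R c(1)]
  have y: "y \<in> snd c ` fst c" unfolding y_def using c by simp
  have o2: "open ((snd c ` fst c) \<times> (UNIV :: 'm set))" using oc open_UNIV by (rule open_Times)
  have n_p: "n (y, \<xi>) = \<N> p \<xi>" for \<xi>
    using local_bundle_map_coord_change[OF M c, of \<N> \<xi>] unfolding n_def y_def cc .
  have dn: "n differentiable (at (y, \<xi>))" for \<xi>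
    unfolding n_def using smooth_on_differentiable[OF o2 bundle_map_smooth_on[OF M N c(1)]] y by blast
  have lin: "bounded_linear (\<lambda>\<eta>. n (y, \<eta>))"
    unfolding n_p using N p by (simp add: bundle_map_def eta_contract_eq)
  have dX: "local_rep M c Z differentiable (at y)" if "vector_field M Z" for Z
    by (rule smooth_on_differentiable[OF oc vector_field_smooth_on[OF M that c(1)] y])
  have val: "local_rep M c Z y = Z p" for Z
    unfolding local_rep_def y_def chart_inv_left[OF R c] cc ..
  have rep: "local_rep M c (\<lambda>q. \<N> q (Z q)) x = n (x, local_rep M c Z x)" if x: "x \<in> snd c ` fst c" for Z x
  proof -
    have q: "chart_inv c x \<in> fst c" "snd c (chart_inv c x) = x" using chart_inv_in[OF x] chart_inv_right[OF x] by auto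
    show ?thesis
      unfolding local_rep_def n_def using local_bundle_map_coord_change[OF M c(1) q(1), of \<N>] unfolding q(2) by simp
  qed
  have drep: "fderiv (local_rep M c (\<lambda>q. \<N> q (Z q))) y = fderiv (\<lambda>x. n (x, local_rep M c Z x)) y" if Z: "vector_field M Z" for Z
  proof (rule fderiv_cong_open[OF _ oc y])
    show "(\<lambda>x. n (x, local_rep M c Z x)) differentiable (at y)"
      by (rule differentiableI[OF has_derivative_fiberwise[where f="\<lambda>x. x", OF dn lin differentiable_ident dX[OF Z]]])
  qed (rule rep[symmetric])
  have br: "lie_bracket M U V p = fderiv (local_rep M c V) y (local_rep M c U y) - fderiv (local_rep M c U) y (local_rep M c V y)" for U V
    by (simp add: lie_bracket_def Let_def c_def y_def)
  show ?thesis
    unfolding nijenhuis_torsion_def br rep[OF y] drep[OF X] drep[OF Y]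
    using local_torsion[OF dn lin dX[OF X] dX[OF Y]]
    unfolding val n_p D_def n_def[symmetric] y_def[symmetric] by simp
qed

section \<open>Homogeneous spaces\<close>

locale homogeneous_manifold =
  fixes G :: "('g, 'z) monoid_scheme" (structure)
    and A :: "('g, 'e::banach) atlas" and K :: "'g set" and M :: "('g set, 'm::banach) atlas"
  assumes lie_group: "banach_lie_group G A" and K: "subgroup K G" and homogeneous: "homogeneous_space G A K M"
begin

sublocale group G using lie_group by (simp add: banach_lie_group_def)

abbreviation \<pi> :: "'g \<Rightarrow> 'g set" where "\<pi> \<equiv> quot_map G K"

lemma manifold_G: "banach_manifold A" and points_G: "points A = carrier G"
  and manifold_M: "banach_manifold M" and points_M: "points M = lcosets K" and smooth_\<pi>: "smooth_map A M \<pi>"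
  and smooth_mult: "smooth_map (prod_atlas A A) A (\<lambda>(g, h). g \<otimes> h)"
  and surj_\<pi>: "g \<in> carrier G \<Longrightarrow> surj (differential A M \<pi> g)"
  using lie_group homogeneous by (auto simp: banach_lie_group_def homogeneous_space_def)

lemmas regular_G = banach_manifold_regular[OF manifold_G]
lemmas regular_M = banach_manifold_regular[OF manifold_M]

lemma \<pi>_image: "\<pi> ` points A = points M"
  unfolding points_M points_G LCOSETS_def by auto

lemma \<pi>_in: "g \<in> carrier G \<Longrightarrow> \<pi> g \<in> points M"
  using \<pi>_image points_G by blast

lemma translation_\<pi>: "g \<in> carrier G \<Longrightarrow> h \<in> carrier G \<Longrightarrow> translation G g (\<pi> h) = \<pi> (g \<otimes> h)"
  using translation_quot_map[OF is_group K] by simp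

section \<open>Translations and their differentials\<close>

lemma smooth_left_mult: "g \<in> carrier G \<Longrightarrow> smooth_map A A (\<lambda>h. g \<otimes> h)"
  using smooth_map_compose[OF regular_G prod_atlas_regular[OF regular_G regular_G]
      smooth_map_Pair_const(2)[OF manifold_G] smooth_mult, of g] points_G
  by (simp add: comp_def)

lemma smooth_\<pi>_left_mult:
  assumes "g \<in> carrier G"
  shows "smooth_map A M (\<lambda>h. \<pi> (g \<otimes> h))"
  using smooth_map_compose[OF regular_G regular_G smooth_left_mult[OF assms] smooth_\<pi>] by (simp add: comp_def)

lemma smooth_translation:
  assumes "g \<in> carrier G"
  shows "smooth_map M M (translation G g)"
proof (rule smooth_map_descent[OF manifold_G manifold_M smooth_\<pi> \<pi>_image])
  show "surj (differential A M \<pi> h)" if "h \<in> points A" for h using surj_\<pi> that points_G by simp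
  show "smooth_map A M (translation G g \<circ> \<pi>)"
    by (rule smooth_map_cong[OF regular_G smooth_\<pi>_left_mult[OF assms]])
       (simp add: points_G translation_\<pi> assms)
qed

lemma differential_\<pi>_left_mult:
  assumes "g \<in> carrier G"
  shows "differential A M (\<lambda>h. \<pi> (g \<otimes> h)) \<one> v = d_alpha G K M g (d_pi G A K M v)"
proof -
  have one: "\<one> \<in> points A" using points_G by simp
  have "differential A M (\<lambda>h. \<pi> (g \<otimes> h)) \<one> = differential A M (translation G g \<circ> \<pi>) \<one>"
    by (rule differential_cong[OF manifold_G smooth_map_compose[OF regular_G regular_M smooth_\<pi> smooth_translation[OF assms]] _ one])
       (simp add: points_G translation_\<pi> assms)
  then show ?thesis
    unfolding d_alpha_def d_pi_def
    using differential_compose[OF manifold_G manifold_M manifold_M smooth_\<pi> smooth_translation[OF assms] one] by simp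
qed

lemma translation_inverse:
  assumes "g \<in> carrier G" "p \<in> points M"
  shows "translation G (inv g) (translation G g p) = p" "translation G g (translation G (inv g) p) = p"
proof -
  obtain h where h: "h \<in> carrier G" "p = \<pi> h" using assms(2) \<pi>_image points_G by blast
  show "translation G (inv g) (translation G g p) = p" "translation G g (translation G (inv g) p) = p"
    unfolding h(2) using assms(1) h(1) by (simp_all add: translation_\<pi> m_assoc[symmetric])
qed

lemma d_alpha_inverse:
  assumes g: "g \<in> carrier G"
  shows "differential M M (translation G (inv g)) (\<pi> g) (d_alpha G K M g v) = v"
    and "d_alpha G K M g (differential M M (translation G (inv g)) (\<pi> g) v) = v"
proof -
  have i: "inv g \<in> carrier G" using g by simp
  have p0: "\<pi> \<one> \<in> points M" and pg: "\<pi> g \<in> points M" using \<pi>_in g by auto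
  have t: "translation G g (\<pi> \<one>) = \<pi> g" "translation G (inv g) (\<pi> g) = \<pi> \<one>"
    using g by (simp_all add: translation_\<pi>)
  note I = smooth_map_id[OF manifold_M]
  have "differential M M (translation G (inv g)) (\<pi> g) (d_alpha G K M g v)
      = differential M M (translation G (inv g) \<circ> translation G g) (\<pi> \<one>) v"
    unfolding d_alpha_def
    using differential_compose[OF manifold_M manifold_M manifold_M smooth_translation[OF g] smooth_translation[OF i] p0] t by simp
  also have "\<dots> = differential M M (\<lambda>p. p) (\<pi> \<one>) v"
    using differential_cong[OF manifold_M I _ p0, of "translation G (inv g) \<circ> translation G g"] translation_inverse(1)[OF g] by simp
  finally show "differential M M (translation G (inv g)) (\<pi> g) (d_alpha G K M g v) = v"
    using differential_id[OF manifold_M p0] by simp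
  have "d_alpha G K M g (differential M M (translation G (inv g)) (\<pi> g) v)
      = differential M M (translation G g \<circ> translation G (inv g)) (\<pi> g) v"
    unfolding d_alpha_def
    using differential_compose[OF manifold_M manifold_M manifold_M smooth_translation[OF i] smooth_translation[OF g] pg] t by simp
  also have "\<dots> = differential M M (\<lambda>p. p) (\<pi> g) v"
    using differential_cong[OF manifold_M I _ pg, of "translation G g \<circ> translation G (inv g)"] translation_inverse(2)[OF g] by simp
  finally show "d_alpha G K M g (differential M M (translation G (inv g)) (\<pi> g) v) = v"
    using differential_id[OF manifold_M pg] by simp
qed

lemma d_alpha_one: "d_alpha G K M \<one> v = v"
proof -
  have p0: "\<pi> \<one> \<in> points M" using \<pi>_in by simp
  have "translation G \<one> p = p" if p: "p \<in> points M" for p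
  proof -
    obtain h where h: "h \<in> carrier G" "p = \<pi> h" using p \<pi>_image points_G by blast
    then show ?thesis by (simp add: translation_\<pi>)
  qed
  then show ?thesis
    unfolding d_alpha_def
    using differential_cong[OF manifold_M smooth_map_id[OF manifold_M] _ p0, of "translation G \<one>"]
      differential_id[OF manifold_M p0] by simp
qed

lemma d_alpha_linear: "g \<in> carrier G \<Longrightarrow> linear (d_alpha G K M g)"
  unfolding d_alpha_def by (rule differential_linear[OF smooth_translation \<pi>_in]) simp_all

lemma tangent_vector_lift:
  assumes "g \<in> carrier G"
  shows "\<exists>v. \<xi> = d_alpha G K M g (d_pi G A K M v)"
proof -
  have "surj (d_pi G A K M)" unfolding d_pi_def by (rule surj_\<pi>[OF one_closed])
  then obtain v where v: "differential M M (translation G (inv g)) (\<pi> g) \<xi> = d_pi G A K M v" by (rule surjE)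
  show ?thesis by (rule exI[of _ v]) (simp only: v[symmetric] d_alpha_inverse(2)[OF assms])
qed

text \<open>Translations have invertible differentials, so \<open>inv_into\<close> in the definition
  of the induced map is an honest inverse. The identity holds for every representative of the coset,
  which allows it to be differentiated along g h with h varying in G.\<close>

lemma induced_bundle_map_lift:
  assumes "induced_bundle_map G A K M N \<N>" "g \<in> carrier G"
  shows "\<N> (\<pi> g) (d_alpha G K M g (d_pi G A K M v)) = d_alpha G K M g (d_pi G A K M (N v))"
proof -
  have "inj (d_alpha G K M g)"
    by (rule inj_on_inverseI[where g="differential M M (translation G (inv g)) (\<pi> g)"]) (rule d_alpha_inverse(1)[OF assms(2)])
  then have inv: "inv_into UNIV (d_alpha G K M g) (d_alpha G K M g \<xi>) = \<xi>" for \<xi> by (rule inv_f_f)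
  have "\<N> (\<pi> g) = d_alpha G K M g \<circ> \<N> (\<pi> \<one>) \<circ> inv_into UNIV (d_alpha G K M g)"
    and base: "\<N> (\<pi> \<one>) (d_pi G A K M v) = d_pi G A K M (N v)"
    using assms unfolding induced_bundle_map_def by blast+
  from this(1) show ?thesis by (simp only: comp_apply inv base)
qed

text \<open>Fields with a prescribed value are taken from this family, as a Banach manifold need not have smooth
  bump functions.\<close>

definition fundamental_field :: "'e \<Rightarrow> 'g set \<Rightarrow> 'm" where
  "fundamental_field v p = differential A M (\<lambda>k. translation G k p) \<one> v"

section \<open>Fundamental fields and left-invariant fields\<close>

lemma smooth_action: "smooth_map (prod_atlas A A) M (\<lambda>z. \<pi> (fst z \<otimes> snd z))"
  using smooth_map_compose[OF prod_atlas_regular[OF regular_G regular_G] regular_G smooth_mult smooth_\<pi>]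
  by (simp add: comp_def case_prod_beta)

lemma smooth_orbit_map:
  assumes "h \<in> carrier G"
  shows "smooth_map A M (\<lambda>k. \<pi> (k \<otimes> h))"
  using smooth_map_compose[OF regular_G prod_atlas_regular[OF regular_G regular_G]
      smooth_map_Pair_const(1)[OF manifold_G] smooth_action, of h] assms points_G
  by (simp add: comp_def)

lemma fundamental_field_\<pi>:
  assumes "h \<in> carrier G"
  shows "fundamental_field v (\<pi> h) = differential A M (\<lambda>k. \<pi> (k \<otimes> h)) \<one> v"
proof -
  have "differential A M (\<lambda>k. translation G k (\<pi> h)) \<one> = differential A M (\<lambda>k. \<pi> (k \<otimes> h)) \<one>"
    by (rule differential_cong[OF manifold_G smooth_orbit_map[OF assms]]) (simp_all add: points_G translation_\<pi> assms)
  then show ?thesis by (simp add: fundamental_field_def)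
qed

lemma fundamental_field_base_point: "fundamental_field v (\<pi> \<one>) = d_pi G A K M v"
proof -
  have "differential A M (\<lambda>k. \<pi> (k \<otimes> \<one>)) \<one> = differential A M \<pi> \<one>"
    by (rule differential_cong[OF manifold_G smooth_\<pi>]) (simp_all add: points_G)
  then show ?thesis by (simp add: fundamental_field_\<pi> d_pi_def)
qed

lemma ldiff_at_one:
  assumes f: "smooth_map A M f" and d: "d \<in> M" "f \<one> \<in> fst d"
  shows "ldiff (chart_at A \<one>) d f \<one> v = coord_change M d (f \<one>) (differential A M f \<one> v)"
proof -
  have one: "\<one> \<in> points A" using points_G by simp
  then show ?thesis
    using ldiff_coord_change[OF manifold_G manifold_M f _ _ d, of "chart_at A \<one>" v] chart_at_in[OF one]
      coord_change_chart_at[OF manifold_G one] by simp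
qed

text \<open>Along \<pi> the field is the partial derivative, at k = 1, of the smooth map taking (k,
  h) to \<pi>(k h), so its pullback to G is smooth. As a section of the tangent bundle it then
  descends along the submersion.\<close>

lemma fundamental_vector_field: "vector_field M (fundamental_field v)"
  unfolding vector_field_def
proof (rule smooth_map_descent[OF manifold_G manifold_M smooth_\<pi> \<pi>_image])
  show "surj (differential A M \<pi> h)" if "h \<in> points A" for h using surj_\<pi> that points_G by simp
  have one: "chart_at A \<one> \<in> A" "\<one> \<in> fst (chart_at A \<one>)" using chart_at_in[of \<one> A] points_G by auto
  have "smooth_map A (tangent_bundle M) (\<lambda>h. (\<pi> h, fundamental_field v (\<pi> h)))"
  proof (rule smooth_map_tangentI[OF regular_G smooth_\<pi>])
    fix a d assume a: "a \<in> A" and d: "d \<in> M"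
    let ?S = "{x \<in> snd a ` fst a. \<pi> (fst (\<one>, chart_inv a x) \<otimes> snd (\<one>, chart_inv a x)) \<in> fst d}"
    have h: "chart_inv a x \<in> carrier G" if "x \<in> snd a ` fst a" for x
      using pointsI[OF a chart_inv_in[OF that]] points_G by simp
    have S: "?S = loc_dom a d \<pi>"
      by (rule Set.set_eqI) (unfold mem_loc_dom_iff[OF regular_G a], use h in auto)
    have "smooth_on ?S (\<lambda>x. ldiff (chart_at A \<one>) d (\<lambda>k. \<pi> (fst (k, chart_inv a x) \<otimes> snd (k, chart_inv a x))) \<one> v)"
      by (rule partial_ldiff_smooth(2)[OF regular_G regular_G smooth_action one a d])
    then have "smooth_on (loc_dom a d \<pi>) (\<lambda>x. ldiff (chart_at A \<one>) d (\<lambda>k. \<pi> (fst (k, chart_inv a x) \<otimes> snd (k, chart_inv a x))) \<one> v)"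
      unfolding S .
    then show "smooth_on (loc_dom a d \<pi>) (\<lambda>x. coord_change M d (\<pi> (chart_inv a x)) (fundamental_field v (\<pi> (chart_inv a x))))"
    proof (rule smooth_on_cong[OF smooth_map_loc_dom[OF smooth_\<pi> a d]])
      fix x assume x: "x \<in> loc_dom a d \<pi>"
      have x': "x \<in> snd a ` fst a" "\<pi> (chart_inv a x) \<in> fst d" using iffD1[OF mem_loc_dom_iff[OF regular_G a] x] by auto
      note hx = h[OF x'(1)]
      show "coord_change M d (\<pi> (chart_inv a x)) (fundamental_field v (\<pi> (chart_inv a x)))
        = ldiff (chart_at A \<one>) d (\<lambda>k. \<pi> (fst (k, chart_inv a x) \<otimes> snd (k, chart_inv a x))) \<one> v"
        unfolding fundamental_field_\<pi>[OF hx] fst_conv snd_conv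
        using ldiff_at_one[OF smooth_orbit_map[OF hx] d, of v] x'(2) hx by simp
    qed
  qed
  then show "smooth_map A (tangent_bundle M) ((\<lambda>p. (p, fundamental_field v p)) \<circ> \<pi>)" by (simp add: comp_def)
qed

text \<open>Coordinate expression, in the chart at 1, of the left-invariant field with value v at 1.
  Taking this chart as the target makes it a partial derivative of the multiplication, hence
  smooth.\<close>

definition left_field :: "'e \<Rightarrow> 'e \<Rightarrow> 'e" where
  "left_field v x = ldiff (chart_at A \<one>) (chart_at A \<one>) (\<lambda>k. chart_inv (chart_at A \<one>) x \<otimes> k) \<one> v"

lemma chart_one: "chart_at A \<one> \<in> A" "\<one> \<in> fst (chart_at A \<one>)"
  using chart_at_in[of \<one> A] points_G by auto

lemma chart_one_carrier: "x \<in> snd (chart_at A \<one>) ` fst (chart_at A \<one>) \<Longrightarrow> chart_inv (chart_at A \<one>) x \<in> carrier G"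
  using pointsI[OF chart_one(1) chart_inv_in] points_G by blast

lemma smooth_left_field: "smooth_on (snd (chart_at A \<one>) ` fst (chart_at A \<one>)) (left_field v)"
proof -
  let ?b = "chart_at A \<one>"
  let ?S = "{x \<in> snd ?b ` fst ?b. snd (\<one>, chart_inv ?b x) \<otimes> fst (\<one>, chart_inv ?b x) \<in> fst ?b}"
  have F: "smooth_map (prod_atlas A A) A (\<lambda>z. snd z \<otimes> fst z)"
    using smooth_map_compose[OF prod_atlas_regular[OF regular_G regular_G] prod_atlas_regular[OF regular_G regular_G]
        smooth_map_swap[OF manifold_G manifold_G] smooth_mult]
    by (simp add: comp_def case_prod_beta)
  have S: "?S = snd ?b ` fst ?b"
  proof (intro equalityI subsetI)
    fix x assume x: "x \<in> snd ?b ` fst ?b"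
    then show "x \<in> ?S" using chart_one_carrier[OF x] chart_inv_in[OF x] by simp
  qed blast
  have "smooth_on ?S (\<lambda>x. ldiff ?b ?b (\<lambda>k. snd (k, chart_inv ?b x) \<otimes> fst (k, chart_inv ?b x)) \<one> v)"
    by (rule partial_ldiff_smooth(2)[OF regular_G regular_G F chart_one chart_one(1) chart_one(1)])
  then have "smooth_on (snd ?b ` fst ?b) (\<lambda>x. ldiff ?b ?b (\<lambda>k. snd (k, chart_inv ?b x) \<otimes> fst (k, chart_inv ?b x)) \<one> v)"
    unfolding S .
  then show ?thesis
    by (rule smooth_on_cong[OF regular_atlas_open[OF regular_G chart_one(1)]]) (simp only: left_field_def fst_conv snd_conv)
qed

lemma left_field_one: "left_field v (snd (chart_at A \<one>) \<one>) = v"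
proof -
  let ?b = "chart_at A \<one>"
  have "ldiff ?b ?b (\<lambda>k. \<one> \<otimes> k) \<one> = ldiff ?b ?b (\<lambda>k. k) \<one>"
    by (rule ldiff_cong[OF regular_G smooth_map_id[OF manifold_G] _ chart_one chart_one]) (simp add: points_G)
  then show ?thesis
    using ldiff_id[OF regular_G chart_one] chart_inv_left[OF regular_G chart_one] by (simp add: left_field_def)
qed

lemma lie_algebra_bracket_eq:
  "lie_algebra_bracket G A v w =
     fderiv (left_field w) (snd (chart_at A \<one>) \<one>) v - fderiv (left_field v) (snd (chart_at A \<one>) \<one>) w"
proof -
  let ?b = "chart_at A \<one>"
  let ?x = "snd ?b \<one>"
  have one: "\<one> \<in> points A" using points_G by simp
  have x: "?x \<in> snd ?b ` fst ?b" using chart_one by simp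
  note ob = regular_atlas_open[OF regular_G chart_one(1)]
  have rep: "local_rep A ?b (left_invariant_field G A u) x = left_field u x" if x: "x \<in> snd ?b ` fst ?b" for u x
  proof -
    let ?h = "chart_inv ?b x"
    have h: "?h \<in> carrier G" "?h \<otimes> \<one> = ?h" using chart_one_carrier[OF x] by auto
    have "left_field u x = ldiff ?b ?b (\<lambda>k. ?h \<otimes> k) \<one> (coord_change A ?b \<one> u)"
      unfolding left_field_def coord_change_chart_at[OF manifold_G one] ..
    also have "\<dots> = coord_change A ?b ?h (differential A A (\<lambda>k. ?h \<otimes> k) \<one> u)"
      using ldiff_coord_change[OF manifold_G manifold_G smooth_left_mult[OF h(1)] chart_one chart_one(1), of u]
        chart_inv_in[OF x] unfolding h(2) by simp
    finally show ?thesis by (simp add: local_rep_def left_invariant_field_def)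
  qed
  have d: "fderiv (local_rep A ?b (left_invariant_field G A u)) ?x = fderiv (left_field u) ?x" for u
    by (rule fderiv_cong_open[OF smooth_on_differentiable[OF ob smooth_left_field x] ob x]) (rule rep[symmetric])
  show ?thesis
    unfolding lie_algebra_bracket_def lie_bracket_def Let_def d rep[OF x] left_field_one ..
qed

theorem nijenhuis_torsion_eq:
  assumes ind: "induced_bundle_map G A K M N \<N>" and X: "vector_field M X" and Y: "vector_field M Y"
    and g: "g \<in> carrier G"
    and Xv: "X (\<pi> g) = d_alpha G K M g (d_pi G A K M v)" and Yw: "Y (\<pi> g) = d_alpha G K M g (d_pi G A K M w)"
  shows "nijenhuis_torsion M \<N> X Y (\<pi> g) = d_alpha G K M g (d_pi G A K M (algebraic_torsion G A N v w))"
proof -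
  have bm: "bundle_map M \<N>" using ind by (simp add: induced_bundle_map_def)
  note pg = \<pi>_in[OF g]
  define b where "b = chart_at A \<one>"
  define c where "c = chart_at M (\<pi> g)"
  have b: "b \<in> A" "\<one> \<in> fst b" unfolding b_def by (rule chart_one)+
  have c: "c \<in> M" "\<pi> g \<in> fst c" unfolding c_def using chart_at_in[OF pg] by auto
  define f where "f = (\<lambda>h. \<pi> (g \<otimes> h))"
  define P where "P = loc_rep b c f"
  define U where "U = loc_dom b c f"
  define x where "x = snd b \<one>"
  define y where "y = snd c (\<pi> g)"
  have f: "smooth_map A M f" unfolding f_def by (rule smooth_\<pi>_left_mult[OF g])
  have f1: "f \<one> = \<pi> g" using g by (simp add: f_def)
  have oU: "open U" unfolding U_def by (rule smooth_map_loc_dom[OF f b(1) c(1)])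
  have P: "smooth_on U P" unfolding U_def P_def by (rule smooth_map_loc_rep[OF f b(1) c(1)])
  have xU: "x \<in> U" unfolding U_def x_def using b c f1 by auto
  have Px: "P x = y" unfolding P_def x_def y_def using chart_inv_left[OF regular_G b] f1 by simp
  have Ub: "U \<subseteq> snd b ` fst b" unfolding U_def by blast
  have lam: "smooth_on U (left_field u)" for u
    by (rule smooth_on_subset[OF regular_atlas_open[OF regular_G b(1)] _ oU Ub]) (unfold b_def, rule smooth_left_field)
  \<comment> \<open>A field along P and not on G/K, since it depends on z and not only on P z. By
    left invariance its value over h is the translate by g h of the image of u, which is proved
    next.\<close>
  define Q where "Q u z = fderiv P z (left_field u z)" for u z
  have Q_eq: "Q u z = coord_change M c (f (chart_inv b z)) (d_alpha G K M (g \<otimes> chart_inv b z) (d_pi G A K M u))"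
    if z: "z \<in> U" for u z
  proof -
    define h where "h = chart_inv b z"
    have h: "h \<in> fst b" "snd b h = z" "h \<in> carrier G" "f h \<in> fst c"
      using iffD1[OF mem_loc_dom_iff[OF regular_G b(1)] z[unfolded U_def]] chart_inv_in[of z b] chart_inv_right[of z b]
        chart_one_carrier[of z] unfolding h_def b_def[symmetric] by auto
    have gh: "g \<otimes> h \<in> carrier G" using g h by simp
    note fc = smooth_\<pi>_left_mult[OF gh]
    have f1': "\<pi> (g \<otimes> h \<otimes> \<one>) = f h" using gh by (simp add: f_def)
    have "Q u z = ldiff b c f (h \<otimes> \<one>) (ldiff b b (\<lambda>k. h \<otimes> k) \<one> u)"
      unfolding Q_def left_field_def b_def[symmetric] h_def[symmetric] P_def using h by simp
    also have "\<dots> = ldiff b c (f \<circ> (\<lambda>k. h \<otimes> k)) \<one> u"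
      by (rule ldiff_compose[OF regular_G regular_G smooth_left_mult[OF h(3)] f b b(1) _ c(1), symmetric])
         (use h in simp_all)
    also have "\<dots> = ldiff b c (\<lambda>k. \<pi> (g \<otimes> h \<otimes> k)) \<one> u"
    proof -
      have "ldiff b c (f \<circ> (\<lambda>k. h \<otimes> k)) \<one> = ldiff b c (\<lambda>k. \<pi> (g \<otimes> h \<otimes> k)) \<one>"
        by (rule ldiff_cong[OF regular_G fc _ b c(1)]) (use g h f1' in \<open>simp_all add: points_G m_assoc f_def\<close>)
      then show ?thesis by simp
    qed
    also have "\<dots> = coord_change M c (f h) (differential A M (\<lambda>k. \<pi> (g \<otimes> h \<otimes> k)) \<one> u)"
      using ldiff_at_one[OF fc c(1), of u] h(4) unfolding f1' b_def by simp
    also have "\<dots> = coord_change M c (f h) (d_alpha G K M (g \<otimes> h) (d_pi G A K M u))"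
      unfolding differential_\<pi>_left_mult[OF gh] ..
    finally show ?thesis unfolding h_def .
  qed
  define n where "n = local_bundle_map M c \<N>"
  have cc: "coord_change M c (\<pi> g) = (\<lambda>v. v)" unfolding c_def by (rule coord_change_chart_at[OF manifold_M pg])
  \<comment> \<open>Homogeneity at all points g h with h near 1: in coordinates the bundle map sends
    the lifted field of u to that of N u. Being an identity on an open set, it may be
    differentiated.\<close>
  have nQ: "n (P z, Q u z) = Q (N u) z" if z: "z \<in> U" for u z
  proof -
    define h where "h = chart_inv b z"
    have h: "h \<in> carrier G" "f h \<in> fst c"
      using iffD1[OF mem_loc_dom_iff[OF regular_G b(1)] z[unfolded U_def]]
        chart_one_carrier[of z] unfolding h_def b_def[symmetric] by auto
    have gh: "g \<otimes> h \<in> carrier G" using g h by simp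
    have Pz: "P z = snd c (f h)" by (simp add: P_def h_def)
    show ?thesis
      unfolding Q_eq[OF z] Pz h_def[symmetric] n_def local_bundle_map_coord_change[OF manifold_M c(1) h(2)]
      unfolding f_def induced_bundle_map_lift[OF ind gh] ..
  qed
  define T where "T u = d_alpha G K M g (d_pi G A K M u)" for u
  have Qx: "Q u x = T u" for u
    unfolding Q_eq[OF xU] T_def using chart_inv_left[OF regular_G b] f1 cc g by (simp add: x_def)
  have lx: "left_field u x = u" for u unfolding x_def b_def by (rule left_field_one)
  have dP: "fderiv P x = T" using Qx unfolding Q_def lx by auto
  have dP': "P differentiable (at x)" by (rule smooth_on_differentiable[OF oU P xU])
  \<comment> \<open>The two terms are the second derivative of P and the derivative of the
    left-invariant field pushed forward by T.\<close>
  have dQ: "(Q u has_derivative (\<lambda>k. fderiv (\<lambda>z. fderiv P z u) x k + T (fderiv (left_field u) x k))) (at x)" for u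
    using fderiv_fderiv_apply[OF oU P smooth_on_differentiable[OF oU lam xU] xU, of u]
    unfolding Q_def[abs_def] lx dP .
  define q where "q u = fderiv (Q u) x" for u
  have q_eq: "q u k = fderiv (\<lambda>z. fderiv P z u) x k + T (fderiv (left_field u) x k)" for u k
    unfolding q_def fderiv_eq[OF dQ] ..
  have linT: "linear T" unfolding dP[symmetric] by (rule linear_frechet_derivative[OF dP'])
  \<comment> \<open>The second derivatives of P cancel by symmetry; what remains is T applied to the
    coordinate formula of the bracket at 1.\<close>
  have br: "q w v - q v w = T (lie_algebra_bracket G A v w)" for v w
    unfolding q_eq lie_algebra_bracket_eq b_def[symmetric] x_def[symmetric]
    using fderiv_symmetric[OF oU P xU, of w v] by (simp add: linear_diff[OF linT])
  have o2: "open ((snd c ` fst c) \<times> (UNIV :: 'm set))"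
    by (intro open_Times regular_atlas_open[OF regular_M c(1)] open_UNIV)
  have dn: "n differentiable (at (y, \<xi>))" for \<xi>
    unfolding n_def y_def using smooth_on_differentiable[OF o2 bundle_map_smooth_on[OF manifold_M bm c(1)]] c by blast
  have n_p: "n (y, \<xi>) = \<N> (\<pi> g) \<xi>" for \<xi>
    using local_bundle_map_coord_change[OF manifold_M c, of \<N> \<xi>] unfolding n_def y_def cc .
  have bl: "bounded_linear (\<N> (\<pi> g))" using bm pg by (simp add: bundle_map_def)
  then have lin: "bounded_linear (\<lambda>\<eta>. n (P x, \<eta>))" unfolding Px n_p by (simp add: eta_contract_eq)
  define D where "D k \<xi> = fderiv n (y, \<xi>) (k, 0)" for k \<xi>
  \<comment> \<open>Differentiate \<open>nQ\<close> at x in direction k. The fibre part of the chain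
    rule is the bundle map applied to \<open>q u k\<close>, the base part is the wanted derivative
    in direction T k.\<close>
  have D: "D (T k) (T u) = q (N u) k - \<N> (\<pi> g) (q u k)" for k u
  proof -
    have "((\<lambda>z. n (P z, Q u z)) has_derivative
      (\<lambda>k. fderiv n (P x, Q u x) (fderiv P x k, 0) + n (P x, fderiv (Q u) x k))) (at x)"
      by (rule has_derivative_fiberwise[OF _ lin dP' differentiableI[OF dQ]]) (unfold Px, rule dn)
    then have "(Q (N u) has_derivative
      (\<lambda>k. fderiv n (P x, Q u x) (fderiv P x k, 0) + n (P x, fderiv (Q u) x k))) (at x)"
      by (rule has_derivative_transform_within_open[OF _ oU xU]) (rule nQ)
    from fun_cong[OF fderiv_eq[OF this], of k] show ?thesis
      unfolding q_def D_def Px Qx dP n_p by simp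
  qed
  have LT: "\<N> (\<pi> g) (T u) = T (N u)" for u
    unfolding T_def by (rule induced_bundle_map_lift[OF ind g])
  have "nijenhuis_torsion M \<N> X Y (\<pi> g) =
      \<N> (\<pi> g) (D (T v) (T w)) - \<N> (\<pi> g) (D (T w) (T v)) - D (\<N> (\<pi> g) (T v)) (T w) + D (\<N> (\<pi> g) (T w)) (T v)"
    using nijenhuis_torsion_local[OF manifold_M bm X Y pg]
    unfolding Xv Yw c_def[symmetric] n_def[symmetric] y_def[symmetric] D_def[symmetric] T_def[symmetric] .
  also have "\<dots> = T (algebraic_torsion G A N v w)"
    unfolding algebraic_torsion_def
    by (rule lifted_torsion[where L="\<N> (\<pi> g)" and T=T and N=N and D=D and q=q and br="lie_algebra_bracket G A",
          OF bounded_linear.linear[OF bl] linT LT D br])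
  finally show ?thesis unfolding T_def .
qed

end

theorem theorem3p6:
  fixes G :: "('g, 'z) monoid_scheme"
    and A :: "('g, 'e::banach) atlas"
    and K :: "'g set"
    and B :: "('g, 'f::banach) atlas"
    and M :: "('g set, 'm::banach) atlas"
    and N :: "'e \<Rightarrow>\<^sub>L 'e"
    and \<N> :: "'g set \<Rightarrow> 'm \<Rightarrow> 'm"
  assumes "banach_lie_group G A"
    and "immersed_lie_subgroup G A K B"
    and "homogeneous_space G A K M"
    and "{v. d_pi G A K M v = 0} = lie_subalgebra G A B"
    and "N \<in> admissible G A K B"
    and "induced_bundle_map G A K M N \<N>"
  shows "(\<forall>X Y g v w.
            vector_field M X \<longrightarrow> vector_field M Y \<longrightarrow> g \<in> carrier G \<longrightarrow>
            X (quot_map G K g) = d_alpha G K M g (d_pi G A K M v) \<longrightarrow>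
            Y (quot_map G K g) = d_alpha G K M g (d_pi G A K M w) \<longrightarrow>
            nijenhuis_torsion M \<N> X Y (quot_map G K g) =
              d_alpha G K M g (d_pi G A K M (algebraic_torsion G A N v w))) \<and>
         (nijenhuis_operator M \<N> \<longleftrightarrow>
            (\<forall>v w. algebraic_torsion G A N v w \<in> lie_subalgebra G A B))"
proof -
  interpret homogeneous_manifold G A K M
    using assms(1-3) by (simp add: homogeneous_manifold_def immersed_lie_subgroup_def)
  have ker: "u \<in> lie_subalgebra G A B \<longleftrightarrow> d_pi G A K M u = 0" for u
    using assms(4) by blast
  note formula = nijenhuis_torsion_eq[OF assms(6)]
  show ?thesis
  proof (intro conjI iffI allI impI)
    \<comment> \<open>Fundamental fields realise every pair of values at the base point, where the
      translation by 1 acts trivially.\<close>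
    fix v w assume *: "nijenhuis_operator M \<N>"
    have "nijenhuis_torsion M \<N> (fundamental_field v) (fundamental_field w) (quot_map G K \<one>\<^bsub>G\<^esub>) = 0"
      using * fundamental_vector_field \<pi>_in[OF one_closed] unfolding nijenhuis_operator_def by blast
    moreover have "nijenhuis_torsion M \<N> (fundamental_field v) (fundamental_field w) (quot_map G K \<one>\<^bsub>G\<^esub>)
        = d_alpha G K M \<one>\<^bsub>G\<^esub> (d_pi G A K M (algebraic_torsion G A N v w))"
      by (rule formula[OF fundamental_vector_field fundamental_vector_field one_closed])
         (simp_all add: d_alpha_one fundamental_field_base_point)
    ultimately show "algebraic_torsion G A N v w \<in> lie_subalgebra G A B"
      unfolding ker d_alpha_one by simp
  next
    assume *: "\<forall>v w. algebraic_torsion G A N v w \<in> lie_subalgebra G A B"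
    show "nijenhuis_operator M \<N>"
      unfolding nijenhuis_operator_def
    proof (intro allI impI ballI)
      fix X Y p assume X: "vector_field M X" and Y: "vector_field M Y" and p: "p \<in> points M"
      obtain g where g: "g \<in> carrier G" "p = quot_map G K g" using p \<pi>_image points_G by blast
      \<comment> \<open>Surjectivity of the differential of \<pi> lifts the values of X and Y, so
        the formula applies at every point; the torsion is then the image of an element of the
        kernel.\<close>
      obtain v where v: "X p = d_alpha G K M g (d_pi G A K M v)" using tangent_vector_lift[OF g(1)] by blast
      obtain w where w: "Y p = d_alpha G K M g (d_pi G A K M w)" using tangent_vector_lift[OF g(1)] by blast
      have "nijenhuis_torsion M \<N> X Y p = d_alpha G K M g (d_pi G A K M (algebraic_torsion G A N v w))"
        using formula[OF X Y g(1)] v w unfolding g(2) by blast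
      also have "d_pi G A K M (algebraic_torsion G A N v w) = 0" using * ker by blast
      finally show "nijenhuis_torsion M \<N> X Y p = 0" using linear_0[OF d_alpha_linear[OF g(1)]] by simp
    qed
  qed (rule formula)
qed

end
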